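(* Let $(M,h)$ be a Hermitian manifold of complex dimension $n$ with background Riemannian metric $g=\mathrm{Re}\,h$, let $D$ be the metric connection on $TM$ induced by the Chern connection under the bundle isomorphism $u\mapsto u_o=\frac12(u-\sqrt{-1}Ju)$ from $TM$ to $T^{1,0}M$, and let $\mathrm{Ric}_D$ be its Ricci curvature. For arbitrary tangent vectors $u,w\in TM$ (at the same point), writing $\xi=u_o=\xi^\alpha\frac{\partial}{\partial z^\alpha}$ and $\zeta=w_o=\zeta^\alpha\frac{\partial}{\partial z^\alpha}$ in local holomorphic coordinates, we have $$\mathrm{Ric}_D(u,w)=\mathfrak R^{(4)}_{\alpha\bar\delta}\,\xi^\alpha\bar\zeta^\delta+\mathfrak R^{(3)}_{\alpha\bar\delta}\,\zeta^\alpha\bar\xi^\delta ,$$ where $\mathfrak R^{(3)}_{\alpha\bar\beta}=h^{\bar\delta\gamma}\mathfrak R_{\gamma\bar\beta\alpha\bar\delta}$ and $\mathfrak R^{(4)}_{\alpha\bar\beta}=h^{\bar\delta\gamma}\mathfrak R_{\alpha\bar\delta\gamma\bar\beta}$ are the third and fourth Ricci curvatures of the Chern connection.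
   Context: Greek indices run from $1$ to $n$, and repeated indices are summed. Local holomorphic coordinates are $z^\alpha=x^\alpha+\sqrt{-1}x^{n+\alpha}$; $h=h_{\alpha\bar\beta}\,dz^\alpha d\bar z^\beta$, and $g=\mathrm{Re}\,h$, so that $g(u,w)=\mathrm{Re}(h_{\alpha\bar\beta}\xi^\alpha\bar\zeta^\beta)$ for $\xi=u_o,\ \zeta=w_o$. $J$ is the complex structure and $(h^{\bar\beta\alpha})$ denotes the inverse matrix of $(h_{\alpha\bar\beta})$. The Chern connection is the unique connection on $T^{1,0}M$ compatible with $h$ and the holomorphic structure; its connection 1-forms are $\theta^\alpha_\beta=h^{\bar\lambda\alpha}\frac{\partial h_{\beta\bar\lambda}}{\partial z^\gamma}dz^\gamma$, and its curvature components are $$\mathfrak R_{\alpha\bar\beta\gamma\bar\delta}=-\frac{\partial^2h_{\alpha\bar\beta}}{\partial z^\gamma\partial\bar z^\delta}+\frac{\partial h_{\alpha\bar\lambda}}{\partial z^\gamma}h^{\bar\lambda\kappa}\frac{\partial h_{\kappa\bar\beta}}{\partial\bar z^\delta}.$$ The induced metric connection, still denoted $D$, is the connection on the real tangent bundle $TM$ obtained by transporting the Chern connection through $u\mapsto u_o$, i.e. $(D_vu)_o=D_v(u_o)$ for real vector fields $u,v$. Its curvature is $(D^2u)(v,w)=D_vD_wu-D_wD_vu-D_{[v,w]}u$. Its Ricci curvature is $$\mathrm{Ric}_D(u,v)=\sum_{i=1}^{2n}g\big((D^2u)(e_i,v),e_i\big),$$ where $\{e_i\}_{i=1}^{2n}$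 is any $g$-orthonormal frame. *)

theory Defs
  imports "HOL-Analysis.Analysis"
begin

section \<open>Smooth and holomorphic functions on open subsets of complex n-space\<close>

text \<open>On an open set \<open>S\<close> of a finite-dimensional space, \<open>Ck_on k S f\<close> is the usual class
  \<open>C^k\<close>; it is only used for open \<open>S\<close>. Derivatives are real Frechet derivatives.\<close>

fun Ck_on :: "nat \<Rightarrow> 'a::real_normed_vector set \<Rightarrow> ('a \<Rightarrow> 'b::real_normed_vector) \<Rightarrow> bool" where
  "Ck_on 0 S f \<longleftrightarrow> continuous_on S f"
| "Ck_on (Suc k) S f \<longleftrightarrow>
     (\<forall>x\<in>S. f differentiable (at x)) \<and> (\<forall>v. Ck_on k S (\<lambda>x. frechet_derivative f (at x) v))"

definition smooth_on :: "'a::real_normed_vector set \<Rightarrow> ('a \<Rightarrow> 'b::real_normed_vector) \<Rightarrow> bool" where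
  "smooth_on S f \<longleftrightarrow> (\<forall>k. Ck_on k S f)"

text \<open>Holomorphic functions of several variables: smooth solutions of the Cauchy-Riemann
  equations, i.e. the real derivative is complex linear.\<close>

definition holomorphic_fun :: "(complex^'n::finite) set \<Rightarrow> (complex^'n \<Rightarrow> complex) \<Rightarrow> bool" where
  "holomorphic_fun S f \<longleftrightarrow> smooth_on S f \<and>
     (\<forall>z\<in>S. \<forall>v. frechet_derivative f (at z) (\<i> *s v) = \<i> * frechet_derivative f (at z) v)"


section \<open>Complex manifolds\<close>

text \<open>The points of the manifold form a whole type (Hausdorff and second countable, by its type
  classes). A local holomorphic coordinate system is a domain \<open>U\<close> with a map
  \<open>\<phi>\<close> into \<open>complex^'n\<close>; the values of \<open>\<phi>\<close> outside \<open>U\<close> are irrelevant.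
  The atlas need not be maximal, but it may be.\<close>

type_synonym ('a, 'n) atlas = "('a set \<times> ('a \<Rightarrow> complex^'n)) set"

definition chart :: "'a::topological_space set \<Rightarrow> ('a \<Rightarrow> complex^'n::finite) \<Rightarrow> bool" where
  "chart U \<phi> \<longleftrightarrow> open U \<and> open (\<phi> ` U) \<and> homeomorphism U (\<phi> ` U) \<phi> (inv_into U \<phi>)"

definition complex_atlas :: "('a::topological_space, 'n::finite) atlas \<Rightarrow> bool" where
  "complex_atlas A \<longleftrightarrow>
     (\<forall>(U, \<phi>)\<in>A. chart U \<phi>) \<and> (\<forall>p. \<exists>(U, \<phi>)\<in>A. p \<in> U) \<and>
     (\<forall>(U, \<phi>)\<in>A. \<forall>(V, \<psi>)\<in>A. \<forall>\<alpha>. holomorphic_fun (\<phi> ` (U \<inter> V)) (\<lambda>z. \<psi> (inv_into U \<phi> z) $ \<alpha>))"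

definition smooth_fun :: "('a::topological_space, 'n::finite) atlas \<Rightarrow> 'a set \<Rightarrow> ('a \<Rightarrow> complex) \<Rightarrow> bool" where
  "smooth_fun A W f \<longleftrightarrow> (\<forall>(U, \<phi>)\<in>A. smooth_on (\<phi> ` (U \<inter> W)) (f \<circ> inv_into U \<phi>))"

definition smooth_near :: "('a::topological_space, 'n::finite) atlas \<Rightarrow> 'a \<Rightarrow> ('a \<Rightarrow> complex) \<Rightarrow> bool" where
  "smooth_near A p f \<longleftrightarrow> (\<exists>W. open W \<and> p \<in> W \<and> smooth_fun A W f)"


section \<open>Tangent vectors\<close>

text \<open>A (complexified) tangent vector at \<open>p\<close> is a derivation acting on complex functions that are
  smooth near \<open>p\<close>, extended by \<open>0\<close> to all other functions (so that equality of tangent vectors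
  is equality of functionals). The tangent spaces are the real and the complex span of the
  coordinate derivations \<open>d/dx^i\<close> of any chart around \<open>p\<close>. Real indices \<open>1, ..., 2n\<close> are the elements of \<open>'n + 'n\<close>:
  \<open>Inl \<alpha>\<close> stands for \<open>\<alpha>\<close> and \<open>Inr \<alpha>\<close> for \<open>n + \<alpha>\<close>, so the coordinates are
  \<open>z^\<alpha> = x^(Inl \<alpha>) + i x^(Inr \<alpha>)\<close>.\<close>

type_synonym 'a tvec = "('a \<Rightarrow> complex) \<Rightarrow> complex"

fun real_axis :: "'n + 'n \<Rightarrow> complex^'n::finite" where
  "real_axis (Inl \<alpha>) = axis \<alpha> 1"
| "real_axis (Inr \<alpha>) = axis \<alpha> \<i>"

fun real_coord :: "('a \<Rightarrow> complex^'n::finite) \<Rightarrow> 'n + 'n \<Rightarrow> 'a \<Rightarrow> complex" where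
  "real_coord \<phi> (Inl \<alpha>) = (\<lambda>q. complex_of_real (Re (\<phi> q $ \<alpha>)))"
| "real_coord \<phi> (Inr \<alpha>) = (\<lambda>q. complex_of_real (Im (\<phi> q $ \<alpha>)))"

definition d_x :: "('a::topological_space, 'n::finite) atlas \<Rightarrow> 'a set \<Rightarrow> ('a \<Rightarrow> complex^'n) \<Rightarrow>
    'n + 'n \<Rightarrow> 'a \<Rightarrow> 'a tvec" where
  "d_x A U \<phi> i p = (\<lambda>f. if smooth_near A p f
     then frechet_derivative (f \<circ> inv_into U \<phi>) (at (\<phi> p)) (real_axis i) else 0)"

definition d_z :: "('a::topological_space, 'n::finite) atlas \<Rightarrow> 'a set \<Rightarrow> ('a \<Rightarrow> complex^'n) \<Rightarrow>
    'n \<Rightarrow> 'a \<Rightarrow> 'a tvec" where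
  "d_z A U \<phi> \<alpha> p = (\<lambda>f. (d_x A U \<phi> (Inl \<alpha>) p f - \<i> * d_x A U \<phi> (Inr \<alpha>) p f) / 2)"

definition d_zbar :: "('a::topological_space, 'n::finite) atlas \<Rightarrow> 'a set \<Rightarrow> ('a \<Rightarrow> complex^'n) \<Rightarrow>
    'n \<Rightarrow> 'a \<Rightarrow> 'a tvec" where
  "d_zbar A U \<phi> \<alpha> p = (\<lambda>f. (d_x A U \<phi> (Inl \<alpha>) p f + \<i> * d_x A U \<phi> (Inr \<alpha>) p f) / 2)"

definition tangent :: "('a::topological_space, 'n::finite) atlas \<Rightarrow> 'a \<Rightarrow> 'a tvec set" where
  "tangent A p = {v. \<exists>(U, \<phi>)\<in>A. p \<in> U \<and>
     (\<exists>a :: 'n + 'n \<Rightarrow> real. v = (\<lambda>f. \<Sum>i\<in>UNIV. complex_of_real (a i) * d_x A U \<phi> i p f))}"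

definition complex_tangent :: "('a::topological_space, 'n::finite) atlas \<Rightarrow> 'a \<Rightarrow> 'a tvec set" where
  "complex_tangent A p = {v. \<exists>(U, \<phi>)\<in>A. p \<in> U \<and>
     (\<exists>a :: 'n + 'n \<Rightarrow> complex. v = (\<lambda>f. \<Sum>i\<in>UNIV. a i * d_x A U \<phi> i p f))}"

text \<open>The complex structure, \<open>J (d/dx^\<alpha>) = d/dx^(n+\<alpha>)\<close> and
  \<open>J (d/dx^(n+\<alpha>)) = - d/dx^\<alpha>\<close>, extended linearly; the result is the same in every chart.
  Note that \<open>v (real_coord \<phi> i)\<close> is the \<open>i\<close>-th component of \<open>v\<close> in the chart.\<close>

definition J :: "('a::topological_space, 'n::finite) atlas \<Rightarrow> 'a \<Rightarrow> 'a tvec \<Rightarrow> 'a tvec" where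
  "J A p v = (THE w. \<forall>(U, \<phi>)\<in>A. p \<in> U \<longrightarrow>
     w = (\<lambda>f. \<Sum>\<alpha>\<in>UNIV. v (real_coord \<phi> (Inl \<alpha>)) * d_x A U \<phi> (Inr \<alpha>) p f
                        - v (real_coord \<phi> (Inr \<alpha>)) * d_x A U \<phi> (Inl \<alpha>) p f))"

definition T10 :: "('a::topological_space, 'n::finite) atlas \<Rightarrow> 'a \<Rightarrow> 'a tvec set" where
  "T10 A p = {v \<in> complex_tangent A p. J A p v = (\<lambda>f. \<i> * v f)}"

definition T01 :: "('a::topological_space, 'n::finite) atlas \<Rightarrow> 'a \<Rightarrow> 'a tvec set" where
  "T01 A p = {v \<in> complex_tangent A p. J A p v = (\<lambda>f. - \<i> * v f)}"

text \<open>The isomorphism \<open>u \<mapsto> u_o\<close> from the real tangent space onto \<open>T10\<close>.\<close>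

definition part10 :: "('a::topological_space, 'n::finite) atlas \<Rightarrow> 'a \<Rightarrow> 'a tvec \<Rightarrow> 'a tvec" where
  "part10 A p u = (\<lambda>f. (u f - \<i> * J A p u f) / 2)"


section \<open>Vector fields\<close>

text \<open>Fields are total functions, but only their restriction to the open set \<open>W\<close> in question
  matters. \<open>E\<close> is one of \<open>tangent A\<close>, \<open>complex_tangent A\<close>, \<open>T10 A\<close>, \<open>T01 A\<close>.\<close>

definition smooth_section :: "('a::topological_space, 'n::finite) atlas \<Rightarrow> ('a \<Rightarrow> 'a tvec set) \<Rightarrow>
    'a set \<Rightarrow> ('a \<Rightarrow> 'a tvec) \<Rightarrow> bool" where
  "smooth_section A E W s \<longleftrightarrow> (\<forall>p\<in>W. s p \<in> E p) \<and>
     (\<forall>V f. open V \<longrightarrow> V \<subseteq> W \<longrightarrow> smooth_fun A V f \<longrightarrow> smooth_fun A V (\<lambda>q. s q f))"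

text \<open>Holomorphic sections of \<open>T10\<close>: \<open>s (z^\<alpha>)\<close> is the component of \<open>s\<close> with respect to
  \<open>d/dz^\<alpha>\<close>, and all these components have to be holomorphic.\<close>

definition holomorphic_section :: "('a::topological_space, 'n::finite) atlas \<Rightarrow> 'a set \<Rightarrow>
    ('a \<Rightarrow> 'a tvec) \<Rightarrow> bool" where
  "holomorphic_section A W s \<longleftrightarrow> smooth_section A (T10 A) W s \<and>
     (\<forall>(U, \<phi>)\<in>A. \<forall>\<alpha>. holomorphic_fun (\<phi> ` (U \<inter> W)) ((\<lambda>q. s q (\<lambda>r. \<phi> r $ \<alpha>)) \<circ> inv_into U \<phi>))"

definition bracket :: "('a::topological_space, 'n::finite) atlas \<Rightarrow> ('a \<Rightarrow> 'a tvec) \<Rightarrow>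
    ('a \<Rightarrow> 'a tvec) \<Rightarrow> 'a \<Rightarrow> 'a tvec" where
  "bracket A v w p = (\<lambda>f. if smooth_near A p f
     then v p (\<lambda>q. w q f) - w p (\<lambda>q. v q f) else 0)"


section \<open>Hermitian metrics\<close>

text \<open>\<open>h p\<close> is complex linear in the first argument and conjugate linear in the second.\<close>

definition hermitian_metric :: "('a::topological_space, 'n::finite) atlas \<Rightarrow>
    ('a \<Rightarrow> 'a tvec \<Rightarrow> 'a tvec \<Rightarrow> complex) \<Rightarrow> bool" where
  "hermitian_metric A h \<longleftrightarrow>
     (\<forall>p. \<forall>s\<in>T10 A p. \<forall>s'\<in>T10 A p. \<forall>t\<in>T10 A p. \<forall>c.
        h p (\<lambda>f. c * s f + s' f) t = c * h p s t + h p s' t) \<and>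
     (\<forall>p. \<forall>s\<in>T10 A p. \<forall>t\<in>T10 A p. h p t s = cnj (h p s t)) \<and>
     (\<forall>p. \<forall>s\<in>T10 A p. s \<noteq> (\<lambda>f. 0) \<longrightarrow> Re (h p s s) > 0) \<and>
     (\<forall>W s t. open W \<longrightarrow> smooth_section A (T10 A) W s \<longrightarrow> smooth_section A (T10 A) W t \<longrightarrow>
        smooth_fun A W (\<lambda>q. h q (s q) (t q)))"

definition riemannian :: "('a::topological_space, 'n::finite) atlas \<Rightarrow>
    ('a \<Rightarrow> 'a tvec \<Rightarrow> 'a tvec \<Rightarrow> complex) \<Rightarrow> 'a \<Rightarrow> 'a tvec \<Rightarrow> 'a tvec \<Rightarrow> real" where
  "riemannian A h p u w = Re (h p (part10 A p u) (part10 A p w))"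


section \<open>The Chern connection\<close>

text \<open>A connection \<open>D\<close> acts on local sections: \<open>D v s\<close> is the covariant derivative of the
  section \<open>s\<close> of \<open>T10\<close> in the direction of the complex vector field \<open>v\<close>. The last clause says
  that on an open set it depends only on the restrictions of \<open>v\<close> and \<open>s\<close>.\<close>

definition connection :: "('a::topological_space, 'n::finite) atlas \<Rightarrow>
    (('a \<Rightarrow> 'a tvec) \<Rightarrow> ('a \<Rightarrow> 'a tvec) \<Rightarrow> ('a \<Rightarrow> 'a tvec)) \<Rightarrow> bool" where
  "connection A D \<longleftrightarrow>
     (\<forall>W v v' s s' k. open W \<longrightarrow>
        smooth_section A (complex_tangent A) W v \<longrightarrow> smooth_section A (complex_tangent A) W v' \<longrightarrow>
        smooth_section A (T10 A) W s \<longrightarrow> smooth_section A (T10 A) W s' \<longrightarrow> smooth_fun A W k \<longrightarrow>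
        smooth_section A (T10 A) W (D v s) \<and>
        (\<forall>p\<in>W. D (\<lambda>q f. k q * v q f + v' q f) s p = (\<lambda>f. k p * D v s p f + D v' s p f)) \<and>
        (\<forall>p\<in>W. D v (\<lambda>q f. s q f + s' q f) p = (\<lambda>f. D v s p f + D v s' p f)) \<and>
        (\<forall>p\<in>W. D v (\<lambda>q f. k q * s q f) p = (\<lambda>f. v p k * s p f + k p * D v s p f)) \<and>
        ((\<forall>q\<in>W. v q = v' q \<and> s q = s' q) \<longrightarrow> (\<forall>p\<in>W. D v s p = D v' s' p)))"

definition metric_compatible :: "('a::topological_space, 'n::finite) atlas \<Rightarrow>
    ('a \<Rightarrow> 'a tvec \<Rightarrow> 'a tvec \<Rightarrow> complex) \<Rightarrow>
    (('a \<Rightarrow> 'a tvec) \<Rightarrow> ('a \<Rightarrow> 'a tvec) \<Rightarrow> ('a \<Rightarrow> 'a tvec)) \<Rightarrow> bool" where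
  "metric_compatible A h D \<longleftrightarrow>
     (\<forall>W v s t. open W \<longrightarrow> smooth_section A (tangent A) W v \<longrightarrow>
        smooth_section A (T10 A) W s \<longrightarrow> smooth_section A (T10 A) W t \<longrightarrow>
        (\<forall>p\<in>W. v p (\<lambda>q. h q (s q) (t q)) = h p (D v s p) (t p) + h p (s p) (D v t p)))"

text \<open>Compatibility with the holomorphic structure: the \<open>(0,1)\<close>-part of \<open>D\<close> is the
  Cauchy-Riemann operator, i.e. it annihilates holomorphic sections.\<close>

definition holomorphic_compatible :: "('a::topological_space, 'n::finite) atlas \<Rightarrow>
    (('a \<Rightarrow> 'a tvec) \<Rightarrow> ('a \<Rightarrow> 'a tvec) \<Rightarrow> ('a \<Rightarrow> 'a tvec)) \<Rightarrow> bool" where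
  "holomorphic_compatible A D \<longleftrightarrow>
     (\<forall>W v s. open W \<longrightarrow> smooth_section A (T01 A) W v \<longrightarrow> holomorphic_section A W s \<longrightarrow>
        (\<forall>p\<in>W. D v s p = (\<lambda>f. 0)))"

definition chern_connection :: "('a::topological_space, 'n::finite) atlas \<Rightarrow>
    ('a \<Rightarrow> 'a tvec \<Rightarrow> 'a tvec \<Rightarrow> complex) \<Rightarrow>
    (('a \<Rightarrow> 'a tvec) \<Rightarrow> ('a \<Rightarrow> 'a tvec) \<Rightarrow> ('a \<Rightarrow> 'a tvec)) \<Rightarrow> bool" where
  "chern_connection A h D \<longleftrightarrow>
     connection A D \<and> metric_compatible A h D \<and> holomorphic_compatible A D"

text \<open>\<open>h_coeff A U \<phi> h p $ \<alpha> $ \<beta>\<close> is \<open>h_{\<alpha> \<beta>bar}\<close> at \<open>p\<close>, and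
  \<open>h_inv A U \<phi> h p $ \<beta> $ \<alpha>\<close> is \<open>h^{\<beta>bar \<alpha>}\<close>.\<close>

definition h_coeff :: "('a::topological_space, 'n::finite) atlas \<Rightarrow> 'a set \<Rightarrow> ('a \<Rightarrow> complex^'n) \<Rightarrow>
    ('a \<Rightarrow> 'a tvec \<Rightarrow> 'a tvec \<Rightarrow> complex) \<Rightarrow> 'a \<Rightarrow> complex^'n^'n" where
  "h_coeff A U \<phi> h p = (\<chi> \<alpha> \<beta>. h p (d_z A U \<phi> \<alpha> p) (d_z A U \<phi> \<beta> p))"

definition h_inv :: "('a::topological_space, 'n::finite) atlas \<Rightarrow> 'a set \<Rightarrow> ('a \<Rightarrow> complex^'n) \<Rightarrow>
    ('a \<Rightarrow> 'a tvec \<Rightarrow> 'a tvec \<Rightarrow> complex) \<Rightarrow> 'a \<Rightarrow> complex^'n^'n" where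
  "h_inv A U \<phi> h p = matrix_inv (h_coeff A U \<phi> h p)"

text \<open>\<open>chern_curv A U \<phi> h p \<alpha> \<beta> \<gamma> \<delta>\<close> is the component with indices
  \<open>\<alpha> \<beta>bar \<gamma> \<delta>bar\<close>.\<close>

definition chern_curv :: "('a::topological_space, 'n::finite) atlas \<Rightarrow> 'a set \<Rightarrow> ('a \<Rightarrow> complex^'n) \<Rightarrow>
    ('a \<Rightarrow> 'a tvec \<Rightarrow> 'a tvec \<Rightarrow> complex) \<Rightarrow> 'a \<Rightarrow> 'n \<Rightarrow> 'n \<Rightarrow> 'n \<Rightarrow> 'n \<Rightarrow> complex" where
  "chern_curv A U \<phi> h p \<alpha> \<beta> \<gamma> \<delta> =
     - d_z A U \<phi> \<gamma> p (\<lambda>q. d_zbar A U \<phi> \<delta> q (\<lambda>r. h_coeff A U \<phi> h r $ \<alpha> $ \<beta>))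
     + (\<Sum>\<mu>\<in>UNIV. \<Sum>\<kappa>\<in>UNIV.
          d_z A U \<phi> \<gamma> p (\<lambda>q. h_coeff A U \<phi> h q $ \<alpha> $ \<mu>) * h_inv A U \<phi> h p $ \<mu> $ \<kappa> *
          d_zbar A U \<phi> \<delta> p (\<lambda>q. h_coeff A U \<phi> h q $ \<kappa> $ \<beta>))"

definition third_ricci :: "('a::topological_space, 'n::finite) atlas \<Rightarrow> 'a set \<Rightarrow> ('a \<Rightarrow> complex^'n) \<Rightarrow>
    ('a \<Rightarrow> 'a tvec \<Rightarrow> 'a tvec \<Rightarrow> complex) \<Rightarrow> 'a \<Rightarrow> 'n \<Rightarrow> 'n \<Rightarrow> complex" where
  "third_ricci A U \<phi> h p \<alpha> \<beta> =
     (\<Sum>\<gamma>\<in>UNIV. \<Sum>\<delta>\<in>UNIV. h_inv A U \<phi> h p $ \<delta> $ \<gamma> * chern_curv A U \<phi> h p \<gamma> \<beta> \<alpha> \<delta>)"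

definition fourth_ricci :: "('a::topological_space, 'n::finite) atlas \<Rightarrow> 'a set \<Rightarrow> ('a \<Rightarrow> complex^'n) \<Rightarrow>
    ('a \<Rightarrow> 'a tvec \<Rightarrow> 'a tvec \<Rightarrow> complex) \<Rightarrow> 'a \<Rightarrow> 'n \<Rightarrow> 'n \<Rightarrow> complex" where
  "fourth_ricci A U \<phi> h p \<alpha> \<beta> =
     (\<Sum>\<gamma>\<in>UNIV. \<Sum>\<delta>\<in>UNIV. h_inv A U \<phi> h p $ \<delta> $ \<gamma> * chern_curv A U \<phi> h p \<alpha> \<delta> \<gamma> \<beta>)"


section \<open>The induced connection on the real tangent bundle and its Ricci curvature\<close>

text \<open>\<open>induced_connection A D v u p\<close> is the real tangent vector whose \<open>T10\<close>-part is
  \<open>D v (u_o)\<close> at \<open>p\<close>.\<close>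

definition induced_connection :: "('a::topological_space, 'n::finite) atlas \<Rightarrow>
    (('a \<Rightarrow> 'a tvec) \<Rightarrow> ('a \<Rightarrow> 'a tvec) \<Rightarrow> ('a \<Rightarrow> 'a tvec)) \<Rightarrow>
    ('a \<Rightarrow> 'a tvec) \<Rightarrow> ('a \<Rightarrow> 'a tvec) \<Rightarrow> ('a \<Rightarrow> 'a tvec)" where
  "induced_connection A D v u p =
     the_inv_into (tangent A p) (part10 A p) (D v (\<lambda>q. part10 A q (u q)) p)"

definition curvature_field :: "('a::topological_space, 'n::finite) atlas \<Rightarrow>
    (('a \<Rightarrow> 'a tvec) \<Rightarrow> ('a \<Rightarrow> 'a tvec) \<Rightarrow> ('a \<Rightarrow> 'a tvec)) \<Rightarrow>
    ('a \<Rightarrow> 'a tvec) \<Rightarrow> ('a \<Rightarrow> 'a tvec) \<Rightarrow> ('a \<Rightarrow> 'a tvec) \<Rightarrow> 'a \<Rightarrow> 'a tvec" where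
  "curvature_field A D u v w p =
     (\<lambda>f. D v (D w u) p f - D w (D v u) p f - D (bracket A v w) u p f)"

text \<open>The curvature as a tensor, \<open>curvature A D p x y z = (D^2 x)(y, z)\<close> for real tangent vectors
  at \<open>p\<close>: the common value for all smooth local extensions of the three vectors.\<close>

definition curvature :: "('a::topological_space, 'n::finite) atlas \<Rightarrow>
    (('a \<Rightarrow> 'a tvec) \<Rightarrow> ('a \<Rightarrow> 'a tvec) \<Rightarrow> ('a \<Rightarrow> 'a tvec)) \<Rightarrow>
    'a \<Rightarrow> 'a tvec \<Rightarrow> 'a tvec \<Rightarrow> 'a tvec \<Rightarrow> 'a tvec" where
  "curvature A D p x y z = (THE r. \<forall>W u v w. open W \<longrightarrow> p \<in> W \<longrightarrow>
     smooth_section A (tangent A) W u \<longrightarrow> smooth_section A (tangent A) W v \<longrightarrow>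
     smooth_section A (tangent A) W w \<longrightarrow> u p = x \<longrightarrow> v p = y \<longrightarrow> w p = z \<longrightarrow>
     r = curvature_field A D u v w p)"

definition orthonormal_frame :: "('a::topological_space, 'n::finite) atlas \<Rightarrow>
    ('a \<Rightarrow> 'a tvec \<Rightarrow> 'a tvec \<Rightarrow> complex) \<Rightarrow> 'a \<Rightarrow> ('n + 'n \<Rightarrow> 'a tvec) \<Rightarrow> bool" where
  "orthonormal_frame A h p e \<longleftrightarrow> (\<forall>i. e i \<in> tangent A p) \<and>
     (\<forall>i j. riemannian A h p (e i) (e j) = (if i = j then 1 else 0))"

text \<open>The common value for all orthonormal frames at \<open>p\<close>.\<close>

definition ricci :: "('a::topological_space, 'n::finite) atlas \<Rightarrow>
    ('a \<Rightarrow> 'a tvec \<Rightarrow> 'a tvec \<Rightarrow> complex) \<Rightarrow>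
    (('a \<Rightarrow> 'a tvec) \<Rightarrow> ('a \<Rightarrow> 'a tvec) \<Rightarrow> ('a \<Rightarrow> 'a tvec)) \<Rightarrow>
    'a \<Rightarrow> 'a tvec \<Rightarrow> 'a tvec \<Rightarrow> real" where
  "ricci A h D p u v = (THE r. \<forall>e. orthonormal_frame A h p e \<longrightarrow>
     r = (\<Sum>i\<in>UNIV. riemannian A h p (curvature A D p u (e i) v) (e i)))"

end

theory Submission
  imports Defs
begin

text \<open>In a holomorphic chart a real tangent vector is a vector \<open>X\<close> of \<open>complex^'n\<close>, its \<open>(1,0)\<close>-part has the
  same components, and the Chern connection becomes \<open>s \<mapsto> s'(X) + \<Gamma>(X, s)\<close>, where metric compatibility
  forces \<open>\<Gamma>\<^sub>\<gamma> H = \<partial>\<^sub>\<gamma> H\<close>. Differentiating this identity once more shows that the \<open>(2,0)\<close>-part of the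
  curvature vanishes and that its \<open>(1,1)\<close>-part is given by the components of \<open>chern_curv\<close>. A real orthonormal
  frame \<open>E\<^sub>i\<close> satisfies \<open>\<Sum>\<^sub>i E\<^sub>i\<^sub>\<gamma> cnj E\<^sub>i\<^sub>\<delta> = 2 h\<^bsup>\<delta>\<gamma>\<^esup>\<close> and \<open>\<Sum>\<^sub>i E\<^sub>i\<^sub>\<gamma> E\<^sub>i\<^sub>\<delta> = 0\<close>, so that one of the two \<open>(1,1)\<close>-terms
  disappears in the trace and the other one gives twice the real part of the fourth Ricci curvature. The
  third Ricci curvature is the Hermitian transpose of the fourth one.\<close>

text \<open>\<open>J\<close>, \<open>curvature\<close> and \<open>ricci\<close> are definite
  descriptions, ranging over all charts, all smooth local extensions and all orthonormal frames.
  Each of them needs a formula that is the same for every admissible choice and, for uniqueness, at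
  least one choice: the given chart, the fields with constant components, a frame produced by
  Gram-Schmidt. Christoffel symbols occur only along \<open>d_z\<close>: the coordinate fields
  \<open>d_z\<close> are holomorphic sections, which rests on the symmetry of second derivatives of
  transition maps, so \<open>D\<close> annihilates them along \<open>d_zbar\<close>. Metric
  compatibility is assumed for real directions X only and yields a term linear in X plus a term
  antilinear in X; the combination of the directions e and i e that forms a Wirtinger derivative
  removes the antilinear one. The factor 2 in the frame sum arises because the frame is orthonormal
  for Re h: the real expansions of X and of i X combine to two copies of X.\<close>

lemma frechet_derivative_eqI:
  "(f has_derivative f') (at x) \<Longrightarrow> frechet_derivative f (at x) = f'"
  by (rule frechet_derivative_at [symmetric])

text \<open>\<open>frechet_derivative\<close> chooses from the set of all derivatives. Functions
  that agree near \<open>x\<close> have the same such set, so the choices coincide even where no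
  derivative exists.\<close>

lemma frechet_derivative_cong_open:
  assumes "open S" "x \<in> S" "\<And>y. y \<in> S \<Longrightarrow> f y = g y"
  shows "frechet_derivative f (at x) = frechet_derivative g (at x)"
proof -
  have "(f has_derivative D) (at x) \<longleftrightarrow> (g has_derivative D) (at x)" for D
    using assms has_derivative_transform_within_open[of f D x UNIV S g]
      has_derivative_transform_within_open[of g D x UNIV S f] by auto
  then show ?thesis
    by (simp add: frechet_derivative_def)
qed

lemma differentiable_cong_open:
  assumes "open S" "x \<in> S" "\<And>y. y \<in> S \<Longrightarrow> f y = g y"
  shows "f differentiable (at x) \<longleftrightarrow> g differentiable (at x)"
proof -
  have "(f has_derivative D) (at x) \<longleftrightarrow> (g has_derivative D) (at x)" for D
    using assms has_derivative_transform_within_open[of f D x UNIV S g]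
      has_derivative_transform_within_open[of g D x UNIV S f] by auto
  then show ?thesis
    by (simp add: differentiable_def)
qed

section \<open>Functions of class \<open>C^k\<close>\<close>

lemma Ck_on_subset: "Ck_on k S f \<Longrightarrow> T \<subseteq> S \<Longrightarrow> Ck_on k T f"
  by (induction k arbitrary: f) (auto intro: continuous_on_subset)

lemma Ck_on_cong:
  assumes "open S" "\<And>y. y \<in> S \<Longrightarrow> f y = g y"
  shows "Ck_on k S f \<longleftrightarrow> Ck_on k S g"
  using assms(2)
proof (induction k arbitrary: f g)
  case 0
  then show ?case by (auto cong: continuous_on_cong)
next
  case (Suc k)
  have "f differentiable (at x) \<longleftrightarrow> g differentiable (at x)" if "x \<in> S" for x
    using differentiable_cong_open[OF assms(1) that Suc.prems] .
  moreover have "Ck_on k S (\<lambda>x. frechet_derivative f (at x) v)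
      \<longleftrightarrow> Ck_on k S (\<lambda>x. frechet_derivative g (at x) v)" for v
    using frechet_derivative_cong_open[OF assms(1) _ Suc.prems] by (intro Suc.IH) auto
  ultimately show ?case by simp
qed

lemma Ck_on_Suc_imp: "Ck_on (Suc k) S f \<Longrightarrow> Ck_on k S f"
  by (induction k arbitrary: f)
    (auto intro!: continuous_at_imp_continuous_on differentiable_imp_continuous_within)

lemma Ck_on_const: "Ck_on k S (\<lambda>x. c)"
proof (induction k arbitrary: c)
  case (Suc k)
  show ?case using Suc[of 0] by simp
qed auto

lemma Ck_on_bounded_linear_compose:
  assumes "bounded_linear L" "open S" "Ck_on k S f"
  shows "Ck_on k S (\<lambda>x. L (f x))"
  using assms(3)
proof (induction k arbitrary: f)
  case 0
  then show ?case using assms(1) by (auto intro: bounded_linear.continuous_on)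
next
  case (Suc k)
  have d: "((\<lambda>x. L (f x)) has_derivative (\<lambda>v. L (frechet_derivative f (at x) v))) (at x)"
    if "x \<in> S" for x
    using Suc.prems that
    by (auto simp: frechet_derivative_works intro: bounded_linear.has_derivative[OF assms(1)])
  have "Ck_on k S (\<lambda>x. frechet_derivative (\<lambda>x. L (f x)) (at x) v)" for v
  proof -
    have "Ck_on k S (\<lambda>x. L (frechet_derivative f (at x) v))"
      using Suc by auto
    then show ?thesis
      by (subst Ck_on_cong[OF assms(2), where g="\<lambda>x. L (frechet_derivative f (at x) v)"])
        (auto simp: frechet_derivative_eqI[OF d])
  qed
  then show ?case using d by (auto simp: differentiable_def)
qed

lemma Ck_on_add:
  assumes "open S" "Ck_on k S f" "Ck_on k S g"
  shows "Ck_on k S (\<lambda>x. f x + g x)"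
  using assms(2,3)
proof (induction k arbitrary: f g)
  case 0
  then show ?case by (auto intro: continuous_on_add)
next
  case (Suc k)
  have d: "((\<lambda>x. f x + g x) has_derivative
      (\<lambda>v. frechet_derivative f (at x) v + frechet_derivative g (at x) v)) (at x)"
    if "x \<in> S" for x
    using Suc.prems that by (auto simp: frechet_derivative_works intro!: has_derivative_add)
  have "Ck_on k S (\<lambda>x. frechet_derivative (\<lambda>x. f x + g x) (at x) v)" for v
  proof -
    have "Ck_on k S (\<lambda>x. frechet_derivative f (at x) v + frechet_derivative g (at x) v)"
      using Suc by auto
    then show ?thesis
      by (subst Ck_on_cong[OF assms(1), where
            g="\<lambda>x. frechet_derivative f (at x) v + frechet_derivative g (at x) v"])
        (auto simp: frechet_derivative_eqI[OF d])
  qed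
  then show ?case using d by (auto simp: differentiable_def)
qed

lemma Ck_on_sum:
  assumes "open S" "\<And>i. i \<in> I \<Longrightarrow> Ck_on k S (f i)"
  shows "Ck_on k S (\<lambda>x. \<Sum>i\<in>I. f i x)"
  using assms(2)
  by (induction I rule: infinite_finite_induct) (auto simp: Ck_on_const Ck_on_add[OF assms(1)])

lemma Ck_on_bilinear:
  assumes "bounded_bilinear P" "open S" "Ck_on k S f" "Ck_on k S g"
  shows "Ck_on k S (\<lambda>x. P (f x) (g x))"
  using assms(3,4)
proof (induction k arbitrary: f g)
  case 0
  then show ?case using assms(1) by (auto intro: bounded_bilinear.continuous_on)
next
  case (Suc k)
  let ?D = "\<lambda>x v. P (f x) (frechet_derivative g (at x) v) + P (frechet_derivative f (at x) v) (g x)"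
  have d: "((\<lambda>x. P (f x) (g x)) has_derivative ?D x) (at x)" if "x \<in> S" for x
    using Suc.prems that
    by (auto simp: frechet_derivative_works intro!: bounded_bilinear.FDERIV[OF assms(1)])
  have "Ck_on k S (\<lambda>x. frechet_derivative (\<lambda>x. P (f x) (g x)) (at x) v)" for v
  proof -
    have "Ck_on k S (\<lambda>x. ?D x v)"
      using Suc.prems Ck_on_Suc_imp[OF Suc.prems(1)] Ck_on_Suc_imp[OF Suc.prems(2)]
      by (intro Ck_on_add assms(2) Suc.IH) auto
    then show ?thesis
      by (subst Ck_on_cong[OF assms(2), where g="\<lambda>x. ?D x v"])
        (auto simp: frechet_derivative_eqI[OF d])
  qed
  then show ?case using d by (auto simp: differentiable_def)
qed

lemma linear_basis_expansion:
  assumes "linear L"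
  shows "L y = (\<Sum>b\<in>Basis. (y \<bullet> b) *\<^sub>R L b)"
proof -
  have "L y = L (\<Sum>b\<in>Basis. (y \<bullet> b) *\<^sub>R b)"
    by (simp add: euclidean_representation)
  also have "\<dots> = (\<Sum>b\<in>Basis. (y \<bullet> b) *\<^sub>R L b)"
    using assms by (simp add: linear_sum linear_cmul)
  finally show ?thesis .
qed

text \<open>Expanding \<open>Y z\<close> in a fixed basis turns a linear map that varies with
  \<open>z\<close> into a finite sum of products, to which the bilinear rule applies. Needed
  whenever a derivative is taken in a moving direction.\<close>

lemma Ck_on_linear_apply:
  fixes L :: "'a::real_normed_vector \<Rightarrow> 'b::euclidean_space \<Rightarrow> 'c::real_normed_vector"
  assumes "open S" "\<And>z. z \<in> S \<Longrightarrow> linear (L z)" "\<And>b. Ck_on k S (\<lambda>z. L z b)" "Ck_on k S Y"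
  shows "Ck_on k S (\<lambda>z. L z (Y z))"
proof -
  have "Ck_on k S (\<lambda>z. \<Sum>b\<in>Basis. (Y z \<bullet> b) *\<^sub>R L z b)"
    by (intro Ck_on_sum Ck_on_bilinear[OF bounded_bilinear_scaleR]
        Ck_on_bounded_linear_compose[OF bounded_linear_inner_left] assms)
  moreover have "L z (Y z) = (\<Sum>b\<in>Basis. (Y z \<bullet> b) *\<^sub>R L z b)" if "z \<in> S" for z
    using linear_basis_expansion[OF assms(2)[OF that]] .
  ultimately show ?thesis
    by (subst Ck_on_cong[OF assms(1)]) auto
qed

text \<open>A product rule in which \<open>L\<close> need only be differentiable for each fixed
  argument \<open>b\<close>; finite dimension does the rest. The first term freezes the argument at
  \<open>Y x\<close>, the form in which second derivatives and derivatives of the connection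
  coefficients appear later.\<close>

lemma has_derivative_linear_apply:
  fixes L :: "'a::real_normed_vector \<Rightarrow> 'b::euclidean_space \<Rightarrow> 'c::real_normed_vector"
  assumes "open S" "x \<in> S" "\<And>z. z \<in> S \<Longrightarrow> linear (L z)"
    and "\<And>b. (\<lambda>z. L z b) differentiable (at x)" "(Y has_derivative Y') (at x)"
  shows "((\<lambda>z. L z (Y z)) has_derivative
      (\<lambda>v. frechet_derivative (\<lambda>z. L z (Y x)) (at x) v + L x (Y' v))) (at x)"
proof -
  have e: "L z y = (\<Sum>b\<in>Basis. (y \<bullet> b) *\<^sub>R L z b)" if "z \<in> S" for z y
    using linear_basis_expansion[OF assms(3)[OF that]] .
  let ?L' = "\<lambda>b. frechet_derivative (\<lambda>z. L z b) (at x)"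
  have L': "((\<lambda>z. L z b) has_derivative ?L' b) (at x)" for b
    using assms(4) by (simp add: frechet_derivative_works)
  have "((\<lambda>z. \<Sum>b\<in>Basis. (Y z \<bullet> b) *\<^sub>R L z b) has_derivative
      (\<lambda>v. \<Sum>b\<in>Basis. (Y x \<bullet> b) *\<^sub>R ?L' b v + (Y' v \<bullet> b) *\<^sub>R L x b)) (at x)"
    by (intro has_derivative_sum has_derivative_scaleR has_derivative_inner_left assms(5) L')
  moreover have "((\<lambda>z. \<Sum>b\<in>Basis. (Y x \<bullet> b) *\<^sub>R L z b) has_derivative
      (\<lambda>v. \<Sum>b\<in>Basis. (Y x \<bullet> b) *\<^sub>R ?L' b v)) (at x)"
    by (intro has_derivative_sum has_derivative_scaleR_right L')
  then have "((\<lambda>z. L z (Y x)) has_derivative (\<lambda>v. \<Sum>b\<in>Basis. (Y x \<bullet> b) *\<^sub>R ?L' b v)) (at x)"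
    by (rule has_derivative_transform_within_open[OF _ assms(1,2)]) (simp add: e)
  then have "?L' (Y x) v = (\<Sum>b\<in>Basis. (Y x \<bullet> b) *\<^sub>R ?L' b v)" for v
    by (simp add: frechet_derivative_eqI)
  ultimately have "((\<lambda>z. \<Sum>b\<in>Basis. (Y z \<bullet> b) *\<^sub>R L z b) has_derivative
      (\<lambda>v. ?L' (Y x) v + L x (Y' v))) (at x)"
    by (simp add: sum.distrib e[OF assms(2), symmetric])
  then show ?thesis
    by (rule has_derivative_transform_within_open[OF _ assms(1,2)]) (simp add: e)
qed

lemma Ck_on_compose:
  fixes g :: "'a::real_normed_vector \<Rightarrow> 'b::euclidean_space" and f :: "'b \<Rightarrow> 'c::real_normed_vector"
  assumes "open S" "open T" "g ` S \<subseteq> T" "Ck_on k T f" "Ck_on k S g"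
  shows "Ck_on k S (\<lambda>x. f (g x))"
  using assms(4,5)
proof (induction k arbitrary: f)
  case 0
  then show ?case using assms(3) by (auto intro: continuous_on_compose2)
next
  case (Suc k)
  let ?D = "\<lambda>x v. frechet_derivative f (at (g x)) (frechet_derivative g (at x) v)"
  have f: "f differentiable (at (g x))" if "x \<in> S" for x
    using Suc.prems that assms(3) by auto
  have d: "((\<lambda>x. f (g x)) has_derivative ?D x) (at x)" if "x \<in> S" for x
    using Suc.prems(2) that f[OF that] diff_chain_at[of g _ x f]
    by (auto simp: frechet_derivative_works o_def)
  have "Ck_on k S (\<lambda>x. frechet_derivative (\<lambda>x. f (g x)) (at x) v)" for v
  proof -
    have "Ck_on k S (\<lambda>x. ?D x v)"
    \<comment> \<open>By the chain rule the derivative is a varying linear map applied to a varying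
      vector. For a fixed \<open>b\<close> the map is again a composite with \<open>g\<close>, now
      of order \<open>k\<close>, so the induction hypothesis covers it.\<close>
    proof (rule Ck_on_linear_apply[OF assms(1), where L="\<lambda>x. frechet_derivative f (at (g x))"])
      show "linear (frechet_derivative f (at (g x)))" if "x \<in> S" for x
        by (rule linear_frechet_derivative[OF f[OF that]])
      show "Ck_on k S (\<lambda>x. frechet_derivative f (at (g x)) b)" for b
        using Suc.prems Ck_on_Suc_imp[OF Suc.prems(2)] by (intro Suc.IH) auto
      show "Ck_on k S (\<lambda>x. frechet_derivative g (at x) v)"
        using Suc.prems by simp
    qed
    then show ?thesis
      by (subst Ck_on_cong[OF assms(1), where g="\<lambda>x. ?D x v"])
        (auto simp: frechet_derivative_eqI[OF d])
  qed
  then show ?case using d by (auto simp: differentiable_def)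
qed

section \<open>Smooth functions\<close>

lemma smooth_on_subset: "smooth_on S f \<Longrightarrow> T \<subseteq> S \<Longrightarrow> smooth_on T f"
  unfolding smooth_on_def by (metis Ck_on_subset)

lemma smooth_on_cong: "open S \<Longrightarrow> (\<And>y. y \<in> S \<Longrightarrow> f y = g y) \<Longrightarrow> smooth_on S f \<longleftrightarrow> smooth_on S g"
  unfolding smooth_on_def by (metis Ck_on_cong)

lemma smooth_on_differentiable: "smooth_on S f \<Longrightarrow> x \<in> S \<Longrightarrow> f differentiable (at x)"
  unfolding smooth_on_def by (metis Ck_on.simps(2))

lemma smooth_on_has_derivative:
  "smooth_on S f \<Longrightarrow> x \<in> S \<Longrightarrow> (f has_derivative frechet_derivative f (at x)) (at x)"
  using smooth_on_differentiable frechet_derivative_works by blast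

lemma smooth_on_derivative:
  "smooth_on S f \<Longrightarrow> smooth_on S (\<lambda>x. frechet_derivative f (at x) v)"
  unfolding smooth_on_def by (metis Ck_on.simps(2))

lemma smooth_on_linear_derivative:
  "smooth_on S f \<Longrightarrow> x \<in> S \<Longrightarrow> linear (frechet_derivative f (at x))"
  using linear_frechet_derivative smooth_on_differentiable by blast

lemma smooth_on_const [simp]: "smooth_on S (\<lambda>x. c)"
  by (simp add: smooth_on_def Ck_on_const)

lemma smooth_on_bounded_linear:
  "bounded_linear L \<Longrightarrow> open S \<Longrightarrow> smooth_on S f \<Longrightarrow> smooth_on S (\<lambda>x. L (f x))"
  by (simp add: smooth_on_def Ck_on_bounded_linear_compose)

lemma smooth_on_ident [simp]: "smooth_on S (\<lambda>x. x)"
proof -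
  have "Ck_on k S (\<lambda>x. x)" for k
    by (cases k) (auto simp: Ck_on_const continuous_on_id)
  then show ?thesis by (simp add: smooth_on_def)
qed

lemma smooth_on_add: "open S \<Longrightarrow> smooth_on S f \<Longrightarrow> smooth_on S g \<Longrightarrow> smooth_on S (\<lambda>x. f x + g x)"
  by (simp add: smooth_on_def Ck_on_add)

lemma smooth_on_sum:
  "open S \<Longrightarrow> (\<And>i. i \<in> I \<Longrightarrow> smooth_on S (f i)) \<Longrightarrow> smooth_on S (\<lambda>x. \<Sum>i\<in>I. f i x)"
  by (simp add: smooth_on_def Ck_on_sum)

lemma smooth_on_mult:
  fixes f g :: "'a::real_normed_vector \<Rightarrow> 'b::real_normed_algebra"
  shows "open S \<Longrightarrow> smooth_on S f \<Longrightarrow> smooth_on S g \<Longrightarrow> smooth_on S (\<lambda>x. f x * g x)"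
  unfolding smooth_on_def by (metis Ck_on_bilinear[OF bounded_bilinear_mult])

lemma smooth_on_diff:
  assumes "open S" "smooth_on S f" "smooth_on S g"
  shows "smooth_on S (\<lambda>x. f x - g x)"
  using smooth_on_add[OF assms(1,2) smooth_on_bounded_linear[OF bounded_linear_minus[OF bounded_linear_ident] assms(1,3)]]
  by simp

lemma smooth_on_cnj: "open S \<Longrightarrow> smooth_on S f \<Longrightarrow> smooth_on S (\<lambda>x. cnj (f x))"
  by (rule smooth_on_bounded_linear[OF bounded_linear_cnj])

lemma smooth_on_linear_apply:
  fixes L :: "'a::real_normed_vector \<Rightarrow> 'b::euclidean_space \<Rightarrow> 'c::real_normed_vector"
  assumes "open S" "\<And>z. z \<in> S \<Longrightarrow> linear (L z)" "\<And>b. smooth_on S (\<lambda>z. L z b)" "smooth_on S Y"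
  shows "smooth_on S (\<lambda>z. L z (Y z))"
  using Ck_on_linear_apply[OF assms(1,2)] assms(3,4) by (auto simp: smooth_on_def)

lemma smooth_on_compose:
  fixes g :: "'a::real_normed_vector \<Rightarrow> 'b::euclidean_space" and f :: "'b \<Rightarrow> 'c::real_normed_vector"
  assumes "open S" "open T" "g ` S \<subseteq> T" "smooth_on T f" "smooth_on S g"
  shows "smooth_on S (\<lambda>x. f (g x))"
  using Ck_on_compose[OF assms(1-3)] assms(4,5) by (auto simp: smooth_on_def)

lemma smooth_on_directional:
  fixes f :: "'a::euclidean_space \<Rightarrow> 'b::real_normed_vector"
  assumes "open S" "smooth_on S f" "smooth_on S Y"
  shows "smooth_on S (\<lambda>x. frechet_derivative f (at x) (Y x))"
  by (rule smooth_on_linear_apply[OF assms(1) smooth_on_linear_derivative[OF assms(2)]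
        smooth_on_derivative[OF assms(2)] assms(3)])

lemma smooth_on_vec:
  fixes Y :: "'a::real_normed_vector \<Rightarrow> 'b::euclidean_space ^ 'n::finite"
  assumes "open S" "\<And>i. smooth_on S (\<lambda>x. Y x $ i)"
  shows "smooth_on S Y"
proof -
  have L: "bounded_linear (axis i :: 'b \<Rightarrow> 'b ^ 'n)" for i
    by (intro linear_conv_bounded_linear[THEN iffD1] linearI) (auto simp: axis_def vec_eq_iff)
  have "smooth_on S (\<lambda>x. axis i (Y x $ i) :: 'b ^ 'n)" for i
    by (rule smooth_on_bounded_linear[OF L assms(1) assms(2)])
  then have "smooth_on S (\<lambda>x. \<Sum>i\<in>UNIV. axis i (Y x $ i))"
    by (rule smooth_on_sum[OF assms(1)])
  moreover have "(\<Sum>i\<in>UNIV. axis i (y $ i)) = y" for y :: "'b ^ 'n"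
    by (auto simp: vec_eq_iff axis_def)
  ultimately show ?thesis by simp
qed

lemma smooth_on_nth:
  fixes Y :: "'a::real_normed_vector \<Rightarrow> 'b::euclidean_space ^ 'n::finite"
  shows "open S \<Longrightarrow> smooth_on S Y \<Longrightarrow> smooth_on S (\<lambda>x. Y x $ i)"
  by (rule smooth_on_bounded_linear[OF bounded_linear_vec_nth])

section \<open>Symmetry of the second derivative\<close>

text \<open>The mean value theorem is applied twice: to the increment \<open>g\<close> along
  \<open>u\<close>, then to the \<open>u\<close>-derivative along \<open>v\<close>. The second
  difference thus becomes one mixed derivative at a single point of the parallelogram.\<close>

lemma second_difference_mean_value:
  fixes f :: "'a::real_normed_vector \<Rightarrow> real"
  assumes "Ck_on 2 S f" "0 < h"
    and S: "\<And>s t. 0 \<le> s \<Longrightarrow> s \<le> h \<Longrightarrow> 0 \<le> t \<Longrightarrow> t \<le> h \<Longrightarrow> x + s *\<^sub>R u + t *\<^sub>R v \<in> S"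
  shows "\<exists>s t. 0 \<le> s \<and> s \<le> h \<and> 0 \<le> t \<and> t \<le> h \<and>
    f (x + h *\<^sub>R u + h *\<^sub>R v) - f (x + h *\<^sub>R u) - f (x + h *\<^sub>R v) + f x =
    h * h * frechet_derivative (\<lambda>y. frechet_derivative f (at y) u) (at (x + s *\<^sub>R u + t *\<^sub>R v)) v"
proof -
  have f: "f differentiable (at y)" if "y \<in> S" for y
    using assms(1) that by (auto simp: numeral_2_eq_2)
  let ?d = "\<lambda>y. frechet_derivative f (at y) u"
  have d: "?d differentiable (at y)" if "y \<in> S" for y
    using assms(1) that by (auto simp: numeral_2_eq_2)
  have line: "((\<lambda>s. F (a + s *\<^sub>R w)) has_real_derivative frechet_derivative F (at (a + s *\<^sub>R w)) w) (at s)"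
    if "F differentiable (at (a + s *\<^sub>R w))" for F :: "'a \<Rightarrow> real" and a w s
  proof -
    have "((\<lambda>s. a + s *\<^sub>R w) has_derivative (\<lambda>r. r *\<^sub>R w)) (at s)"
      by (auto intro!: derivative_eq_intros)
    from diff_chain_at[OF this] that
    have "((\<lambda>s. F (a + s *\<^sub>R w)) has_derivative
        (\<lambda>r. frechet_derivative F (at (a + s *\<^sub>R w)) (r *\<^sub>R w))) (at s)"
      by (auto simp: frechet_derivative_works o_def)
    moreover have "frechet_derivative F (at (a + s *\<^sub>R w)) (r *\<^sub>R w)
        = r * frechet_derivative F (at (a + s *\<^sub>R w)) w" for r
      using linear_cmul[OF linear_frechet_derivative[OF that]] by simp
    ultimately show ?thesis
      by (auto simp: has_field_derivative_def mult.commute[of _ "frechet_derivative F _ _"])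
  qed
  define g where "g s = f (x + h *\<^sub>R v + s *\<^sub>R u) - f (x + s *\<^sub>R u)" for s
  have g: "(g has_real_derivative ?d (x + h *\<^sub>R v + s *\<^sub>R u) - ?d (x + s *\<^sub>R u)) (at s)"
    if "0 \<le> s" "s \<le> h" for s
    unfolding g_def using S[OF that, of h] S[OF that, of 0] assms(2)
    by (intro DERIV_diff line f) (auto simp: add_ac)
  obtain s where s: "0 < s" "s < h"
    "g h - g 0 = h * (?d (x + h *\<^sub>R v + s *\<^sub>R u) - ?d (x + s *\<^sub>R u))"
    using MVT2[OF assms(2) g] by auto
  have "((\<lambda>t. ?d (x + s *\<^sub>R u + t *\<^sub>R v)) has_real_derivative
     frechet_derivative ?d (at (x + s *\<^sub>R u + t *\<^sub>R v)) v) (at t)" if "0 \<le> t" "t \<le> h" for t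
    using S[of s t] s that by (intro line d) auto
  from MVT2[OF assms(2) this] obtain t where t: "0 < t" "t < h"
    "?d (x + s *\<^sub>R u + h *\<^sub>R v) - ?d (x + s *\<^sub>R u + 0 *\<^sub>R v)
      = h * frechet_derivative ?d (at (x + s *\<^sub>R u + t *\<^sub>R v)) v"
    by auto
  have "g h - g 0 = h * (h * frechet_derivative ?d (at (x + s *\<^sub>R u + t *\<^sub>R v)) v)"
    using s(3) t(3) by (simp add: add_ac)
  then show ?thesis
    using s(1,2) t(1,2) by (intro exI[where x=s] exI[where x=t]) (simp_all add: g_def add_ac)
qed

text \<open>The second difference does not change when \<open>u\<close> and \<open>v\<close> are
  exchanged. Both mixed derivatives therefore take a common value at points arbitrarily close to
  \<open>x\<close>, and continuity carries this to \<open>x\<close>.\<close>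

lemma second_derivative_symmetric_real:
  fixes f :: "'a::real_normed_vector \<Rightarrow> real"
  assumes "open S" "x \<in> S" "Ck_on 2 S f"
  shows "frechet_derivative (\<lambda>y. frechet_derivative f (at y) u) (at x) v
    = frechet_derivative (\<lambda>y. frechet_derivative f (at y) v) (at x) u"
proof (rule ccontr)
  let ?A = "\<lambda>y. frechet_derivative (\<lambda>y. frechet_derivative f (at y) u) (at y) v"
  let ?B = "\<lambda>y. frechet_derivative (\<lambda>y. frechet_derivative f (at y) v) (at y) u"
  assume neq: "?A x \<noteq> ?B x"
  \<comment> \<open>Half the gap: two deviations below \<open>e\<close> cannot bridge the distance
    between \<open>?A x\<close> and \<open>?B x\<close>.\<close>
  define e where "e = \<bar>?A x - ?B x\<bar> / 2"
  have e: "e > 0" using neq by (simp add: e_def)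
  have cont: "continuous_on S ?A" "continuous_on S ?B"
    using assms(3) by (auto simp: numeral_2_eq_2)
  obtain d1 where d1: "d1 > 0" "\<And>y. y \<in> S \<Longrightarrow> dist y x < d1 \<Longrightarrow> \<bar>?A y - ?A x\<bar> < e"
    using cont(1) assms(2) e unfolding continuous_on_iff dist_real_def by meson
  obtain d2 where d2: "d2 > 0" "\<And>y. y \<in> S \<Longrightarrow> dist y x < d2 \<Longrightarrow> \<bar>?B y - ?B x\<bar> < e"
    using cont(2) assms(2) e unfolding continuous_on_iff dist_real_def by meson
  obtain d3 where d3: "d3 > 0" "ball x d3 \<subseteq> S"
    using assms(1,2) by (meson openE)
  define d where "d = min d1 (min d2 d3)"
  have d: "d > 0" using d1 d2 d3 by (simp add: d_def)
  \<comment> \<open>This size keeps the whole parallelogram with sides \<open>h *\<^sub>R u\<close>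
    and \<open>h *\<^sub>R v\<close> within distance \<open>d\<close> of \<open>x\<close>; the
    summand \<open>1\<close> keeps the denominator positive when both vectors vanish.\<close>
  define h where "h = d / (norm u + norm v + 1)"
  have N: "norm u + norm v + 1 > 0" by (simp add: add_nonneg_pos)
  have h: "h > 0" using d N by (simp add: h_def)
  have near: "dist (x + s *\<^sub>R u + t *\<^sub>R v) x < d" if "0 \<le> s" "s \<le> h" "0 \<le> t" "t \<le> h" for s t
  proof -
    have "dist (x + s *\<^sub>R u + t *\<^sub>R v) x \<le> s * norm u + t * norm v"
      using that norm_triangle_ineq[of "s *\<^sub>R u" "t *\<^sub>R v"] by (simp add: dist_norm)
    also have "\<dots> \<le> h * norm u + h * norm v"
      using that by (intro add_mono mult_right_mono) auto
    also have "\<dots> < h * (norm u + norm v + 1)"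
      using h by (simp add: algebra_simps)
    also have "\<dots> = d" using N by (simp add: h_def)
    finally show ?thesis .
  qed
  have inS: "x + s *\<^sub>R u + t *\<^sub>R v \<in> S" if "0 \<le> s" "s \<le> h" "0 \<le> t" "t \<le> h" for s t
    using near[OF that] d3 by (auto simp: d_def dist_commute)
  obtain s t where st: "0 \<le> s" "s \<le> h" "0 \<le> t" "t \<le> h"
    "f (x + h *\<^sub>R u + h *\<^sub>R v) - f (x + h *\<^sub>R u) - f (x + h *\<^sub>R v) + f x = h * h * ?A (x + s *\<^sub>R u + t *\<^sub>R v)"
    using second_difference_mean_value[OF assms(3) h inS] by blast
  have inS': "x + t *\<^sub>R v + s *\<^sub>R u \<in> S" if "0 \<le> t" "t \<le> h" "0 \<le> s" "s \<le> h" for s t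
    using inS[OF that(3,4,1,2)] by (simp add: add_ac)
  obtain t' s' where st': "0 \<le> s'" "s' \<le> h" "0 \<le> t'" "t' \<le> h"
    "f (x + h *\<^sub>R v + h *\<^sub>R u) - f (x + h *\<^sub>R v) - f (x + h *\<^sub>R u) + f x = h * h * ?B (x + t' *\<^sub>R v + s' *\<^sub>R u)"
    using second_difference_mean_value[OF assms(3) h inS'] by blast
  have "h * h * ?A (x + s *\<^sub>R u + t *\<^sub>R v) = h * h * ?B (x + s' *\<^sub>R u + t' *\<^sub>R v)"
  proof -
    have "x + h *\<^sub>R u + h *\<^sub>R v = x + h *\<^sub>R v + h *\<^sub>R u"
      "x + t' *\<^sub>R v + s' *\<^sub>R u = x + s' *\<^sub>R u + t' *\<^sub>R v" by (simp_all add: add_ac)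
    then show ?thesis
      using st(5) st'(5) by (simp only:)
  qed
  then have "?A (x + s *\<^sub>R u + t *\<^sub>R v) = ?B (x + s' *\<^sub>R u + t' *\<^sub>R v)"
    using h by simp
  moreover have "\<bar>?A (x + s *\<^sub>R u + t *\<^sub>R v) - ?A x\<bar> < e"
    using st near[OF st(1-4)] by (intro d1 inS) (auto simp: d_def)
  moreover have "\<bar>?B (x + s' *\<^sub>R u + t' *\<^sub>R v) - ?B x\<bar> < e"
    using st' near[OF st'(1-4)] by (intro d2 inS) (auto simp: d_def)
  ultimately show False unfolding e_def by argo
qed

text \<open>The mean value theorem is tied to real values, so the general case is reduced to the
  components \<open>f y \<bullet> b\<close>.\<close>

lemma second_derivative_symmetric:
  fixes f :: "'a::real_normed_vector \<Rightarrow> 'b::euclidean_space"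
  assumes "open S" "x \<in> S" "smooth_on S f"
  shows "frechet_derivative (\<lambda>y. frechet_derivative f (at y) u) (at x) v
    = frechet_derivative (\<lambda>y. frechet_derivative f (at y) v) (at x) u"
proof (rule euclidean_eqI)
  fix b :: 'b assume "b \<in> Basis"
  have inner: "frechet_derivative (\<lambda>y. g y \<bullet> b) (at y) w = frechet_derivative g (at y) w \<bullet> b"
    if "smooth_on S g" "y \<in> S" for g :: "'a \<Rightarrow> 'b" and y w
    using frechet_derivative_eqI[OF has_derivative_inner_left[OF smooth_on_has_derivative[OF that], of b]]
    by simp
  have sm: "smooth_on S (\<lambda>y. f y \<bullet> b)"
    by (rule smooth_on_bounded_linear[OF bounded_linear_inner_left assms(1,3)])
  have two: "frechet_derivative (\<lambda>y. frechet_derivative f (at y) u) (at x) v \<bullet> b =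
      frechet_derivative (\<lambda>y. frechet_derivative (\<lambda>y. f y \<bullet> b) (at y) u) (at x) v" for u v
  proof -
    have "frechet_derivative (\<lambda>y. frechet_derivative f (at y) u) (at x) v \<bullet> b =
      frechet_derivative (\<lambda>y. frechet_derivative f (at y) u \<bullet> b) (at x) v"
      using inner[OF smooth_on_derivative[OF assms(3)] assms(2)] by simp
    also have "\<dots> = frechet_derivative (\<lambda>y. frechet_derivative (\<lambda>y. f y \<bullet> b) (at y) u) (at x) v"
      by (subst frechet_derivative_cong_open[OF assms(1,2)]) (auto simp: inner[OF assms(3)])
    finally show ?thesis .
  qed
  show "frechet_derivative (\<lambda>y. frechet_derivative f (at y) u) (at x) v \<bullet> b
    = frechet_derivative (\<lambda>y. frechet_derivative f (at y) v) (at x) u \<bullet> b"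
    unfolding two using second_derivative_symmetric_real[OF assms(1,2)] sm
    by (auto simp: smooth_on_def)
qed

section \<open>Tangent vectors in a chart\<close>

text \<open>\<open>rvec A U \<phi> q X\<close> is the real tangent vector at \<open>q\<close> that is the derivative in direction \<open>X\<close> in the
  chart; \<open>hvec A U \<phi> q X\<close> is its \<open>(1,0)\<close>-part.\<close>

definition rvec :: "('a::topological_space, 'n::finite) atlas \<Rightarrow> 'a set \<Rightarrow> ('a \<Rightarrow> complex^'n) \<Rightarrow>
    'a \<Rightarrow> complex^'n \<Rightarrow> 'a tvec" where
  "rvec A U \<phi> q X = (\<lambda>f. if smooth_near A q f
     then frechet_derivative (f \<circ> inv_into U \<phi>) (at (\<phi> q)) X else 0)"

definition hvec :: "('a::topological_space, 'n::finite) atlas \<Rightarrow> 'a set \<Rightarrow> ('a \<Rightarrow> complex^'n) \<Rightarrow>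
    'a \<Rightarrow> complex^'n \<Rightarrow> 'a tvec" where
  "hvec A U \<phi> q X = (\<lambda>f. \<Sum>\<alpha>\<in>UNIV. X $ \<alpha> * d_z A U \<phi> \<alpha> q f)"

lemma sum_UNIV_Plus:
  "(\<Sum>i\<in>(UNIV :: ('n::finite + 'm::finite) set). g i) = (\<Sum>\<alpha>\<in>UNIV. g (Inl \<alpha>)) + (\<Sum>\<alpha>\<in>UNIV. g (Inr \<alpha>))"
  by (simp flip: UNIV_Plus_UNIV add: sum.Plus)

lemma real_axis_expansion:
  "X = (\<Sum>\<alpha>\<in>UNIV. Re (X $ \<alpha>) *\<^sub>R axis \<alpha> 1 + Im (X $ \<alpha>) *\<^sub>R axis \<alpha> \<i>)"
proof -
  have "(\<Sum>\<alpha>\<in>UNIV. Re (X $ \<alpha>) *\<^sub>R axis \<alpha> 1 + Im (X $ \<alpha>) *\<^sub>R axis \<alpha> \<i>) $ \<beta> = X $ \<beta>" for \<beta>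
  proof -
    have "(\<Sum>\<alpha>\<in>UNIV. Re (X $ \<alpha>) *\<^sub>R axis \<alpha> 1 + Im (X $ \<alpha>) *\<^sub>R axis \<alpha> \<i>) $ \<beta>
      = (\<Sum>\<alpha>\<in>UNIV. if \<alpha> = \<beta> then Complex (Re (X $ \<alpha>)) (Im (X $ \<alpha>)) else 0)"
      unfolding sum_component
      by (rule sum.cong) (auto simp: axis_def complex_eq_iff)
    then show ?thesis by simp
  qed
  then show ?thesis by (simp add: vec_eq_iff)
qed

lemma smooth_fun_subset: "smooth_fun A W f \<Longrightarrow> W' \<subseteq> W \<Longrightarrow> smooth_fun A W' f"
  unfolding smooth_fun_def by (auto elim!: smooth_on_subset dest!: bspec)

lemma smult_scaleR_commute: "c *s (r *\<^sub>R X) = r *\<^sub>R (c *s (X :: complex^'n))"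
  by (simp add: vec_eq_iff)

locale holomorphic_chart =
  fixes A :: "('a::topological_space, 'n::finite) atlas" and U :: "'a set" and \<phi> :: "'a \<Rightarrow> complex^'n"
  assumes atlas: "complex_atlas A" and chart_in: "(U, \<phi>) \<in> A"
begin

abbreviation "\<Phi> \<equiv> inv_into U \<phi>"
abbreviation "rv \<equiv> rvec A U \<phi>"
abbreviation "hv \<equiv> hvec A U \<phi>"

lemma homeo: "homeomorphism U (\<phi> ` U) \<phi> \<Phi>" and open_U: "open U" and open_range: "open (\<phi> ` U)"
  using atlas chart_in by (auto simp: complex_atlas_def chart_def)

lemma inv_chart [simp]: "q \<in> U \<Longrightarrow> \<Phi> (\<phi> q) = q"
  using homeo by (auto simp: homeomorphism_def)

lemma open_image: "open W \<Longrightarrow> W \<subseteq> U \<Longrightarrow> open (\<phi> ` W)"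
  using homeomorphism_imp_open_map[OF homeo, of W] open_U open_range
  by (auto simp: openin_open_eq)

section \<open>Changes of chart and smoothness tested in one chart\<close>

lemma transition:
  assumes "(V, \<psi>) \<in> A" "W \<subseteq> V \<inter> U" "open W"
  shows "smooth_on (\<psi> ` W) (\<lambda>z. \<phi> (inv_into V \<psi> z))"
    and "\<And>z v. z \<in> \<psi> ` W \<Longrightarrow> frechet_derivative (\<lambda>z. \<phi> (inv_into V \<psi> z)) (at z) (\<i> *s v)
      = \<i> *s frechet_derivative (\<lambda>z. \<phi> (inv_into V \<psi> z)) (at z) v"
proof -
  interpret V: holomorphic_chart A V \<psi> by unfold_locales (use atlas assms in auto)
  have o: "open (\<psi> ` W)" using V.open_image assms by auto
  have *: "holomorphic_fun (\<psi> ` (V \<inter> U)) (\<lambda>z. \<phi> (inv_into V \<psi> z) $ \<alpha>)" for \<alpha>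
    using atlas assms(1) chart_in unfolding complex_atlas_def by fastforce
  have c: "smooth_on (\<psi> ` W) (\<lambda>z. \<phi> (inv_into V \<psi> z) $ \<alpha>)" for \<alpha>
    by (rule smooth_on_subset[OF conjunct1[OF *[unfolded holomorphic_fun_def]] image_mono[OF assms(2)]])
  show s: "smooth_on (\<psi> ` W) (\<lambda>z. \<phi> (inv_into V \<psi> z))"
    by (intro smooth_on_vec o c)
  fix z v assume z: "z \<in> \<psi> ` W"
  have "frechet_derivative (\<lambda>z. \<phi> (inv_into V \<psi> z) $ \<alpha>) (at z) w
     = frechet_derivative (\<lambda>z. \<phi> (inv_into V \<psi> z)) (at z) w $ \<alpha>" for \<alpha> w
    using frechet_derivative_eqI[OF bounded_linear.has_derivative[OF bounded_linear_vec_nth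
          smooth_on_has_derivative[OF s z]]] by simp
  moreover have "frechet_derivative (\<lambda>z. \<phi> (inv_into V \<psi> z) $ \<alpha>) (at z) (\<i> *s v)
      = \<i> * frechet_derivative (\<lambda>z. \<phi> (inv_into V \<psi> z) $ \<alpha>) (at z) v" for \<alpha>
    using *[of \<alpha>] subsetD[OF image_mono[OF assms(2)] z] unfolding holomorphic_fun_def by blast
  ultimately show "frechet_derivative (\<lambda>z. \<phi> (inv_into V \<psi> z)) (at z) (\<i> *s v)
      = \<i> *s frechet_derivative (\<lambda>z. \<phi> (inv_into V \<psi> z)) (at z) v"
    by (simp add: vec_eq_iff)
qed

text \<open>\<open>smooth_fun\<close> quantifies over every chart of the atlas. Since transition
  maps are smooth, a single chart containing the set decides the matter.\<close>

lemma smooth_fun_iff: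
  assumes "open W" "W \<subseteq> U"
  shows "smooth_fun A W f \<longleftrightarrow> smooth_on (\<phi> ` W) (f \<circ> \<Phi>)"
proof
  assume "smooth_fun A W f"
  then show "smooth_on (\<phi> ` W) (f \<circ> \<Phi>)"
    using chart_in assms by (auto simp: smooth_fun_def Int_absorb1 dest!: bspec)
next
  assume f: "smooth_on (\<phi> ` W) (f \<circ> \<Phi>)"
  have "smooth_on (\<psi> ` (V \<inter> W)) (f \<circ> inv_into V \<psi>)" if V: "(V, \<psi>) \<in> A" for V \<psi>
  proof -
    interpret V: holomorphic_chart A V \<psi> by unfold_locales (use atlas V in auto)
    have o: "open (\<psi> ` (V \<inter> W))" using V.open_image V.open_U assms(1) by auto
    have "smooth_on (\<psi> ` (V \<inter> W)) (\<lambda>z. (f \<circ> \<Phi>) (\<phi> (inv_into V \<psi> z)))"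
      using assms V.open_U
      by (intro smooth_on_compose[OF o open_image[OF assms] _ f] transition V) auto
    then show ?thesis
      by (subst smooth_on_cong[OF o, where g="\<lambda>z. (f \<circ> \<Phi>) (\<phi> (inv_into V \<psi> z))"]) (use assms(2) in auto)
  qed
  then show "smooth_fun A W f" by (auto simp: smooth_fun_def)
qed

lemma smooth_near_iff:
  assumes "q \<in> U"
  shows "smooth_near A q f \<longleftrightarrow> (\<exists>W. open W \<and> q \<in> W \<and> W \<subseteq> U \<and> smooth_on (\<phi> ` W) (f \<circ> \<Phi>))"
proof
  assume "smooth_near A q f"
  then obtain W where "open W" "q \<in> W" "smooth_fun A W f" by (auto simp: smooth_near_def)
  then show "\<exists>W. open W \<and> q \<in> W \<and> W \<subseteq> U \<and> smooth_on (\<phi> ` W) (f \<circ> \<Phi>)"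
    using open_U assms smooth_fun_iff[of "W \<inter> U" f] smooth_fun_subset[of A W f "W \<inter> U"]
    by (intro exI[where x="W \<inter> U"]) auto
next
  assume "\<exists>W. open W \<and> q \<in> W \<and> W \<subseteq> U \<and> smooth_on (\<phi> ` W) (f \<circ> \<Phi>)"
  then show "smooth_near A q f"
    using smooth_fun_iff by (auto simp: smooth_near_def)
qed

lemma smooth_near_has_derivative:
  assumes "q \<in> U" "smooth_near A q f"
  shows "(f \<circ> \<Phi> has_derivative frechet_derivative (f \<circ> \<Phi>) (at (\<phi> q))) (at (\<phi> q))"
  using assms smooth_near_iff smooth_on_has_derivative by blast

section \<open>Components of tangent vectors and the Wirtinger splitting\<close>

lemma rv_linear:
  assumes "q \<in> U"
  shows "linear (\<lambda>X. rv q X f)"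
proof (cases "smooth_near A q f")
  case True
  then show ?thesis
    using has_derivative_linear[OF smooth_near_has_derivative[OF assms True]]
    by (simp add: rvec_def)
next
  case False
  then show ?thesis by (simp add: rvec_def linear_0 linearI)
qed

lemma d_x_eq: "d_x A U \<phi> i q = rv q (real_axis i)"
  by (simp add: d_x_def rvec_def)

lemma rv_expansion:
  assumes "q \<in> U"
  shows "rv q X f = (\<Sum>\<alpha>\<in>UNIV. complex_of_real (Re (X $ \<alpha>)) * d_x A U \<phi> (Inl \<alpha>) q f
     + complex_of_real (Im (X $ \<alpha>)) * d_x A U \<phi> (Inr \<alpha>) q f)"
proof -
  note L = rv_linear[OF assms, of f]
  have "rv q X f = rv q (\<Sum>\<alpha>\<in>UNIV. Re (X $ \<alpha>) *\<^sub>R axis \<alpha> 1 + Im (X $ \<alpha>) *\<^sub>R axis \<alpha> \<i>) f"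
    using real_axis_expansion[of X] by simp
  then show ?thesis
    unfolding linear_sum[OF L] linear_add[OF L] linear_cmul[OF L] by (simp add: d_x_eq scaleR_conv_of_real)
qed

text \<open>The right-hand side is the formula for \<open>u_o\<close> with \<open>J\<close> acting
  as multiplication by \<open>\<i>\<close> on components; \<open>J_rv_real\<close> later confirms
  that \<open>J\<close> acts this way.\<close>

lemma hv_eq:
  assumes "q \<in> U"
  shows "hv q X f = (rv q X f - \<i> * rv q (\<i> *s X) f) / 2"
proof -
  have i: "rv q (\<i> *s X) f = (\<Sum>\<alpha>\<in>UNIV. complex_of_real (- Im (X $ \<alpha>)) * d_x A U \<phi> (Inl \<alpha>) q f
     + complex_of_real (Re (X $ \<alpha>)) * d_x A U \<phi> (Inr \<alpha>) q f)"
    unfolding rv_expansion[OF assms] by simp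
  show ?thesis
    unfolding i rv_expansion[OF assms, of X] hvec_def d_z_def sum_distrib_left
      sum_subtractf[symmetric] sum_divide_distrib
    by (rule sum.cong) (simp_all add: complex_eq_iff field_simps)
qed

text \<open>Splits a real direction into its (1,0)- and (0,1)-parts, the form in which the two
  compatibility conditions on \<open>D\<close> can be applied separately.\<close>

lemma rv_wirtinger:
  assumes "q \<in> U"
  shows "rv q X f = (\<Sum>\<alpha>\<in>UNIV. X $ \<alpha> * d_z A U \<phi> \<alpha> q f + cnj (X $ \<alpha>) * d_zbar A U \<phi> \<alpha> q f)"
  unfolding rv_expansion[OF assms] d_z_def d_zbar_def
proof (rule sum.cong)
  fix \<alpha> :: 'n
  have "complex_of_real (Re x) * a + complex_of_real (Im x) * b
    = x * ((a - \<i> * b) / 2) + cnj x * ((a + \<i> * b) / 2)" for x a b :: complex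
    by (simp add: complex_eq_iff field_simps)
  then show "complex_of_real (Re (X $ \<alpha>)) * d_x A U \<phi> (Inl \<alpha>) q f
       + complex_of_real (Im (X $ \<alpha>)) * d_x A U \<phi> (Inr \<alpha>) q f =
     X $ \<alpha> * ((d_x A U \<phi> (Inl \<alpha>) q f - \<i> * d_x A U \<phi> (Inr \<alpha>) q f) / 2) +
     cnj (X $ \<alpha>) * ((d_x A U \<phi> (Inl \<alpha>) q f + \<i> * d_x A U \<phi> (Inr \<alpha>) q f) / 2)" .
qed simp

lemma smooth_fun_linear_coordinate:
  fixes L :: "complex^'n \<Rightarrow> complex"
  assumes "bounded_linear L"
  shows "smooth_fun A U (\<lambda>r. L (\<phi> r))"
proof -
  have "smooth_on (\<phi> ` U) L"
    using smooth_on_bounded_linear[OF assms open_range, of "\<lambda>z. z"] by simp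
  then have "smooth_on (\<phi> ` U) ((\<lambda>r. L (\<phi> r)) \<circ> \<Phi>)"
    by (subst smooth_on_cong[OF open_range, where g=L]) auto
  then show ?thesis
    using smooth_fun_iff[OF open_U] by simp
qed

text \<open>Real linear functions of the coordinates serve as test functions: they recover the
  components of a tangent vector from the functional, which makes \<open>rvec\<close> and
  \<open>hvec\<close> injective.\<close>

lemma rv_linear_coordinate:
  fixes L :: "complex^'n \<Rightarrow> complex"
  assumes "bounded_linear L" "q \<in> U"
  shows "rv q X (\<lambda>r. L (\<phi> r)) = L X"
proof -
  have "smooth_near A q (\<lambda>r. L (\<phi> r))"
    using smooth_fun_linear_coordinate[OF assms(1)] open_U assms(2) by (auto simp: smooth_near_def)
  moreover have "frechet_derivative ((\<lambda>r. L (\<phi> r)) \<circ> \<Phi>) (at (\<phi> q)) = frechet_derivative L (at (\<phi> q))"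
    using assms(2) by (intro frechet_derivative_cong_open[OF open_range]) auto
  moreover have "frechet_derivative L (at (\<phi> q)) = L"
    using assms(1) by (intro frechet_derivative_eqI bounded_linear_imp_has_derivative)
  ultimately show ?thesis by (simp add: rvec_def)
qed

lemma bounded_linear_real_coord:
  "bounded_linear (\<lambda>z::complex^'n. complex_of_real (Re (z $ \<alpha>)))"
  "bounded_linear (\<lambda>z::complex^'n. complex_of_real (Im (z $ \<alpha>)))"
  by (intro bounded_linear_of_real[THEN bounded_linear_compose] bounded_linear_Re[THEN bounded_linear_compose]
      bounded_linear_Im[THEN bounded_linear_compose] bounded_linear_vec_nth)+

lemma rv_real_coord:
  assumes "q \<in> U"
  shows "rv q X (real_coord \<phi> (Inl \<alpha>)) = complex_of_real (Re (X $ \<alpha>))"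
    "rv q X (real_coord \<phi> (Inr \<alpha>)) = complex_of_real (Im (X $ \<alpha>))"
  using rv_linear_coordinate[OF bounded_linear_real_coord(1) assms]
    rv_linear_coordinate[OF bounded_linear_real_coord(2) assms] by simp_all

lemma rv_coord [simp]: "q \<in> U \<Longrightarrow> rv q X (\<lambda>r. \<phi> r $ \<alpha>) = X $ \<alpha>"
  by (rule rv_linear_coordinate[OF bounded_linear_vec_nth])

lemma hv_coord [simp]: "q \<in> U \<Longrightarrow> hv q X (\<lambda>r. \<phi> r $ \<alpha>) = X $ \<alpha>"
  by (simp add: hv_eq)

lemma rv_inject: "q \<in> U \<Longrightarrow> rv q X = rv q Y \<longleftrightarrow> X = Y"
  by (metis rv_coord vec_eq_iff)

lemma hv_inject: "q \<in> U \<Longrightarrow> hv q X = hv q Y \<longleftrightarrow> X = Y"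
  by (metis hv_coord vec_eq_iff)

text \<open>\<open>T\<close> is the derivative of the transition map. Its commuting with
  \<open>\<i>\<close> is the Cauchy-Riemann condition, and this is what makes \<open>J\<close>
  independent of the chart.\<close>

lemma chart_change:
  assumes "(V, \<psi>) \<in> A" "q \<in> U" "q \<in> V"
  shows "\<exists>T. (\<forall>X. rvec A V \<psi> q X = rv q (T X) \<and> T (\<i> *s X) = \<i> *s T X)"
proof (intro exI allI conjI)
  interpret V: holomorphic_chart A V \<psi> by unfold_locales (use atlas assms in auto)
  let ?t = "\<lambda>z. \<phi> (inv_into V \<psi> z)"
  let ?T = "frechet_derivative ?t (at (\<psi> q))"
  have o: "open (U \<inter> V)" using open_U V.open_U by auto
  have q: "\<psi> q \<in> \<psi> ` (U \<inter> V)" using assms by auto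
  show "?T (\<i> *s X) = \<i> *s ?T X" for X
    using transition(2)[OF assms(1) _ o q] by auto
  have t: "(?t has_derivative ?T) (at (\<psi> q))"
    using transition(1)[OF assms(1) _ o] smooth_on_has_derivative[OF _ q] by auto
  have "rvec A V \<psi> q X f = rv q (?T X) f" for X f
  \<comment> \<open>On functions that are not smooth near \<open>q\<close> both functionals are
    \<open>0\<close> by convention; otherwise the chain rule applies.\<close>
  proof (cases "smooth_near A q f")
    case True
    have "(f \<circ> \<Phi> \<circ> ?t has_derivative (frechet_derivative (f \<circ> \<Phi>) (at (\<phi> q)) \<circ> ?T)) (at (\<psi> q))"
      using diff_chain_at[OF t, of "f \<circ> \<Phi>"] smooth_near_has_derivative[OF assms(2) True] assms(3)
      by simp
    then have "frechet_derivative (f \<circ> \<Phi> \<circ> ?t) (at (\<psi> q)) X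
        = frechet_derivative (f \<circ> \<Phi>) (at (\<phi> q)) (?T X)"
      by (simp add: frechet_derivative_eqI)
    moreover have "frechet_derivative (f \<circ> \<Phi> \<circ> ?t) (at (\<psi> q)) = frechet_derivative (f \<circ> inv_into V \<psi>) (at (\<psi> q))"
      using V.open_image[OF o] by (intro frechet_derivative_cong_open[OF _ q]) auto
    ultimately show ?thesis by (simp add: rvec_def)
  qed (simp add: rvec_def)
  then show "rvec A V \<psi> q X = rv q (?T X)" for X by auto
qed

text \<open>The description of \<open>J\<close> demands one value that fits the formula in every
  chart. An arbitrary chart is handled by carrying both vectors into it with \<open>T\<close>, where
  the multiplication by \<open>\<i>\<close> survives; the given chart yields uniqueness.\<close>

lemma J_rv:
  assumes "q \<in> U"
  shows "J A q (\<lambda>f. rv q X f + \<i> * rv q Y f) = (\<lambda>f. rv q (\<i> *s X) f + \<i> * rv q (\<i> *s Y) f)"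
proof -
  have *: "(\<lambda>f. rv q (\<i> *s X) f + \<i> * rv q (\<i> *s Y) f) =
    (\<lambda>f. \<Sum>\<alpha>\<in>UNIV. (rv q X (real_coord \<psi> (Inl \<alpha>)) + \<i> * rv q Y (real_coord \<psi> (Inl \<alpha>))) * d_x A V \<psi> (Inr \<alpha>) q f
      - (rv q X (real_coord \<psi> (Inr \<alpha>)) + \<i> * rv q Y (real_coord \<psi> (Inr \<alpha>))) * d_x A V \<psi> (Inl \<alpha>) q f)"
    if V: "(V, \<psi>) \<in> A" "q \<in> V" for V \<psi>
  proof
    fix f
    interpret V: holomorphic_chart A V \<psi> by unfold_locales (use atlas V in auto)
    obtain T where T: "\<And>X. rv q X = V.rv q (T X)" "\<And>X. T (\<i> *s X) = \<i> *s T X"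
      using V.chart_change[OF chart_in V(2) assms] by auto
    show "rv q (\<i> *s X) f + \<i> * rv q (\<i> *s Y) f = (\<Sum>\<alpha>\<in>UNIV. (rv q X (real_coord \<psi> (Inl \<alpha>)) + \<i> * rv q Y (real_coord \<psi> (Inl \<alpha>))) * d_x A V \<psi> (Inr \<alpha>) q f
      - (rv q X (real_coord \<psi> (Inr \<alpha>)) + \<i> * rv q Y (real_coord \<psi> (Inr \<alpha>))) * d_x A V \<psi> (Inl \<alpha>) q f)"
      unfolding T V.rv_real_coord[OF V(2)] V.rv_expansion[OF V(2), of _ f]
      by (simp add: sum_distrib_left sum.distrib[symmetric] algebra_simps)
  qed
  show ?thesis
    unfolding J_def
  proof (rule the_equality)
    show "\<forall>(V, \<psi>)\<in>A. q \<in> V \<longrightarrow> (\<lambda>f. rv q (\<i> *s X) f + \<i> * rv q (\<i> *s Y) f) =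
      (\<lambda>f. \<Sum>\<alpha>\<in>UNIV. (rv q X (real_coord \<psi> (Inl \<alpha>)) + \<i> * rv q Y (real_coord \<psi> (Inl \<alpha>))) * d_x A V \<psi> (Inr \<alpha>) q f
      - (rv q X (real_coord \<psi> (Inr \<alpha>)) + \<i> * rv q Y (real_coord \<psi> (Inr \<alpha>))) * d_x A V \<psi> (Inl \<alpha>) q f)"
      using * by blast
  qed (use *[OF chart_in assms] chart_in assms in \<open>auto dest!: bspec[OF _ chart_in]\<close>)
qed

lemma J_rv_real:
  assumes "q \<in> U"
  shows "J A q (rv q X) = rv q (\<i> *s X)"
  using J_rv[OF assms, of X 0] by (simp add: linear_0[OF rv_linear[OF assms]])

lemma part10_rv: "q \<in> U \<Longrightarrow> part10 A q (rv q X) = hv q X"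
  by (simp add: part10_def J_rv_real hv_eq fun_eq_iff)

text \<open>A tangent vector may be presented in any chart around \<open>q\<close>; the chart change
  brings it into the fixed one. From here on, tangent vectors are component vectors.\<close>

lemma tangent_eq:
  assumes "q \<in> U"
  shows "tangent A q = range (rv q)"
proof (intro equalityI subsetI)
  fix v assume "v \<in> tangent A q"
  then obtain V \<psi> a where V: "(V, \<psi>) \<in> A" "q \<in> V"
    and v: "v = (\<lambda>f. \<Sum>i\<in>UNIV. complex_of_real (a i) * d_x A V \<psi> i q f)"
    unfolding tangent_def by blast
  interpret V: holomorphic_chart A V \<psi> by unfold_locales (use atlas V in auto)
  have "v = V.rv q (\<chi> \<alpha>. Complex (a (Inl \<alpha>)) (a (Inr \<alpha>)))"
    unfolding v by (simp add: fun_eq_iff V.rv_expansion[OF V(2)] sum_UNIV_Plus sum.distrib)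
  then show "v \<in> range (rv q)"
    using chart_change[OF V(1) assms V(2)] by auto
next
  fix v assume "v \<in> range (rv q)"
  then obtain X where v: "v = rv q X" by auto
  have "v = (\<lambda>f. \<Sum>i\<in>UNIV. complex_of_real (case i of Inl \<alpha> \<Rightarrow> Re (X $ \<alpha>) | Inr \<alpha> \<Rightarrow> Im (X $ \<alpha>)) * d_x A U \<phi> i q f)"
    unfolding v by (simp add: fun_eq_iff rv_expansion[OF assms] sum_UNIV_Plus sum.distrib)
  then show "v \<in> tangent A q"
    unfolding tangent_def using chart_in assms by blast
qed

lemma complex_tangent_eq:
  assumes "q \<in> U"
  shows "complex_tangent A q = {\<lambda>f. rv q X f + \<i> * rv q Y f | X Y. True}"
proof (intro equalityI subsetI)
  fix v assume "v \<in> complex_tangent A q"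
  then obtain V \<psi> a where V: "(V, \<psi>) \<in> A" "q \<in> V"
    and v: "v = (\<lambda>f. \<Sum>i\<in>UNIV. a i * d_x A V \<psi> i q f)"
    unfolding complex_tangent_def by blast
  interpret V: holomorphic_chart A V \<psi> by unfold_locales (use atlas V in auto)
  have e: "a (Inl \<alpha>) * x + a (Inr \<alpha>) * y =
      (complex_of_real (Re (a (Inl \<alpha>))) * x + complex_of_real (Re (a (Inr \<alpha>))) * y)
      + \<i> * (complex_of_real (Im (a (Inl \<alpha>))) * x + complex_of_real (Im (a (Inr \<alpha>))) * y)" for \<alpha> x y
    by (simp add: complex_eq_iff)
  have "v = (\<lambda>f. V.rv q (\<chi> \<alpha>. Complex (Re (a (Inl \<alpha>))) (Re (a (Inr \<alpha>)))) f
     + \<i> * V.rv q (\<chi> \<alpha>. Complex (Im (a (Inl \<alpha>))) (Im (a (Inr \<alpha>)))) f)"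
    unfolding v sum_UNIV_Plus sum.distrib[symmetric] e V.rv_expansion[OF V(2)] sum_distrib_left
    by simp
  moreover obtain T where "\<And>X. V.rv q X = rv q (T X)"
    using chart_change[OF V(1) assms V(2)] by auto
  ultimately show "v \<in> {\<lambda>f. rv q X f + \<i> * rv q Y f | X Y. True}"
    by auto
next
  fix v assume "v \<in> {\<lambda>f. rv q X f + \<i> * rv q Y f | X Y. True}"
  then obtain X Y where v: "v = (\<lambda>f. rv q X f + \<i> * rv q Y f)" by auto
  have "v = (\<lambda>f. \<Sum>i\<in>UNIV. (case i of Inl \<alpha> \<Rightarrow> complex_of_real (Re (X $ \<alpha>)) + \<i> * complex_of_real (Re (Y $ \<alpha>))
      | Inr \<alpha> \<Rightarrow> complex_of_real (Im (X $ \<alpha>)) + \<i> * complex_of_real (Im (Y $ \<alpha>))) * d_x A U \<phi> i q f)"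
    unfolding v
    by (simp add: fun_eq_iff rv_expansion[OF assms] sum_UNIV_Plus sum_distrib_left
        algebra_simps flip: sum.distrib)
  then show "v \<in> complex_tangent A q"
    unfolding complex_tangent_def using chart_in assms by blast
qed

lemma tangent_subset_complex_tangent:
  assumes "q \<in> U"
  shows "tangent A q \<subseteq> complex_tangent A q"
proof
  fix v assume "v \<in> tangent A q"
  then obtain X where X: "v = rv q X" using tangent_eq[OF assms] by auto
  have "v = (\<lambda>f. rv q X f + \<i> * rv q 0 f)"
    unfolding X using linear_0[OF rv_linear[OF assms]] by simp
  then show "v \<in> complex_tangent A q"
    unfolding complex_tangent_eq[OF assms] by blast
qed

lemma T10_eq:
  assumes "q \<in> U"
  shows "T10 A q = range (hv q)"
proof (intro equalityI subsetI)
  note L = rv_linear[OF assms]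
  fix v assume "v \<in> T10 A q"
  then obtain X Y where v: "v = (\<lambda>f. rv q X f + \<i> * rv q Y f)" and J: "J A q v = (\<lambda>f. \<i> * v f)"
    unfolding T10_def complex_tangent_eq[OF assms] by auto
  \<comment> \<open>Tested on a holomorphic coordinate this equation is trivial. Conjugate
    coordinates are used below because they detect the (0,1)-part, and its vanishing forces
    \<open>Y = - (\<i> *s X)\<close>.\<close>
  have *: "rv q (\<i> *s X) f + \<i> * rv q (\<i> *s Y) f = \<i> * (rv q X f + \<i> * rv q Y f)" for f
    using J unfolding v J_rv[OF assms] by metis
  have "Y $ \<alpha> = - \<i> * X $ \<alpha>" for \<alpha>
  proof -
    have c: "bounded_linear (\<lambda>z::complex^'n. cnj (z $ \<alpha>))"
      by (intro bounded_linear_cnj[THEN bounded_linear_compose] bounded_linear_vec_nth)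
    show ?thesis
      using *[of "\<lambda>r. cnj (\<phi> r $ \<alpha>)"] unfolding rv_linear_coordinate[OF c assms]
      by (auto simp: complex_eq_iff)
  qed
  then have "Y = - (\<i> *s X)" by (simp add: vec_eq_iff)
  then have "v = (\<lambda>f. rv q X f - \<i> * rv q (\<i> *s X) f)"
    unfolding v by (simp add: linear_neg[OF L])
  moreover have "hv q (2 *\<^sub>R X) f = rv q X f - \<i> * rv q (\<i> *s X) f" for f
    by (simp only: hv_eq[OF assms] smult_scaleR_commute linear_cmul[OF L])
      (simp add: scaleR_conv_of_real diff_divide_distrib)
  ultimately have "v = hv q (2 *\<^sub>R X)" by auto
  then show "v \<in> range (hv q)" by auto
next
  note L = rv_linear[OF assms]
  fix v assume "v \<in> range (hv q)"
  then obtain X where v: "v = hv q X" by auto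
  have v': "v = (\<lambda>f. rv q ((1/2) *\<^sub>R X) f + \<i> * rv q ((-1/2) *\<^sub>R (\<i> *s X)) f)"
    unfolding v fun_eq_iff
    by (intro allI, simp only: hv_eq[OF assms] linear_cmul[OF L])
      (simp add: scaleR_conv_of_real field_simps)
  have ii: "\<i> *s (\<i> *s X) = - X"
    by (simp add: vec_eq_iff)
  have "J A q v = (\<lambda>f. \<i> * v f)"
    unfolding v' J_rv[OF assms] fun_eq_iff
    by (intro allI, simp only: smult_scaleR_commute ii linear_cmul[OF L] linear_neg[OF L])
      (simp add: scaleR_conv_of_real field_simps)
  then show "v \<in> T10 A q"
    unfolding T10_def complex_tangent_eq[OF assms] using v' by blast
qed

end

section \<open>Sections in a chart\<close>

lemma holomorphic_fun_cong:
  assumes "open S" "\<And>z. z \<in> S \<Longrightarrow> f z = g z"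
  shows "holomorphic_fun S f \<longleftrightarrow> holomorphic_fun S g"
proof -
  have "frechet_derivative f (at z) = frechet_derivative g (at z)" if "z \<in> S" for z
    using assms(1) that assms(2) by (rule frechet_derivative_cong_open)
  then show ?thesis
    using smooth_on_cong[OF assms] by (simp add: holomorphic_fun_def)
qed

context holomorphic_chart
begin

lemma smooth_fun_chart_iff:
  assumes "open W" "W \<subseteq> U" "\<And>q. q \<in> W \<Longrightarrow> f q = F (\<phi> q)"
  shows "smooth_fun A W f \<longleftrightarrow> smooth_on (\<phi> ` W) F"
  unfolding smooth_fun_iff[OF assms(1,2)]
  by (rule smooth_on_cong[OF open_image[OF assms(1,2)]]) (use assms(2,3) in auto)

lemma smooth_fun_chartI:
  assumes "open W" "W \<subseteq> U" "smooth_on (\<phi> ` W) F" "\<And>q. q \<in> W \<Longrightarrow> f q = F (\<phi> q)"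
  shows "smooth_fun A W f"
  using smooth_fun_chart_iff[OF assms(1,2), of f F] assms(3,4) by simp

lemma smooth_fun_cong:
  assumes "open W" "W \<subseteq> U" "smooth_fun A W g" "\<And>q. q \<in> W \<Longrightarrow> f q = g q"
  shows "smooth_fun A W f"
proof (rule smooth_fun_chartI[OF assms(1,2)])
  show "smooth_on (\<phi> ` W) (g \<circ> \<Phi>)"
    using assms smooth_fun_iff by simp
  show "f q = (g \<circ> \<Phi>) (\<phi> q)" if "q \<in> W" for q
    using assms that by auto
qed

lemma smooth_fun_const [simp]: "smooth_fun A W (\<lambda>q. c)"
  by (simp add: smooth_fun_def o_def)

lemma smooth_nearI: "open W \<Longrightarrow> q \<in> W \<Longrightarrow> smooth_fun A W f \<Longrightarrow> smooth_near A q f"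
  by (auto simp: smooth_near_def)

lemma rv_chart_fun:
  assumes "open W" "W \<subseteq> U" "q \<in> W" "smooth_on (\<phi> ` W) F" "\<And>q. q \<in> W \<Longrightarrow> f q = F (\<phi> q)"
  shows "rv q X f = frechet_derivative F (at (\<phi> q)) X"
proof -
  have "smooth_near A q f"
    by (rule smooth_nearI[OF assms(1,3)]) (use smooth_fun_chart_iff[of W f F, OF assms(1,2,5)] assms(4) in auto)
  moreover have "frechet_derivative (f \<circ> \<Phi>) (at (\<phi> q)) = frechet_derivative F (at (\<phi> q))"
    by (rule frechet_derivative_cong_open[OF open_image[OF assms(1,2)]]) (use assms(2,3,5) in auto)
  ultimately show ?thesis by (simp add: rvec_def)
qed

lemma smooth_fun_add:
  assumes "open W" "W \<subseteq> U" "smooth_fun A W f" "smooth_fun A W g"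
  shows "smooth_fun A W (\<lambda>q. f q + g q)"
  using assms smooth_on_add[OF open_image[OF assms(1,2)], of "f \<circ> \<Phi>" "g \<circ> \<Phi>"]
  by (simp add: smooth_fun_iff o_def)

lemma smooth_fun_mult:
  assumes "open W" "W \<subseteq> U" "smooth_fun A W f" "smooth_fun A W g"
  shows "smooth_fun A W (\<lambda>q. f q * g q)"
  using assms smooth_on_mult[OF open_image[OF assms(1,2)], of "f \<circ> \<Phi>" "g \<circ> \<Phi>"]
  by (simp add: smooth_fun_iff o_def)

lemma smooth_fun_rv:
  assumes "open W" "W \<subseteq> U" "smooth_on (\<phi> ` W) X" "smooth_fun A W f"
  shows "smooth_fun A W (\<lambda>q. rv q (X (\<phi> q)) f)"
proof -
  note o = open_image[OF assms(1,2)]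
  have s: "smooth_on (\<phi> ` W) (f \<circ> \<Phi>)"
    using smooth_fun_iff assms by blast
  have "rv q (X (\<phi> q)) f = frechet_derivative (f \<circ> \<Phi>) (at (\<phi> q)) (X (\<phi> q))" if "q \<in> W" for q
    by (rule rv_chart_fun[OF assms(1,2) that s]) (use assms(2) in auto)
  then show ?thesis
    by (rule smooth_fun_chartI[OF assms(1,2) smooth_on_directional[OF o s assms(3)]])
qed

lemma smooth_fun_hv:
  assumes "open W" "W \<subseteq> U" "smooth_on (\<phi> ` W) X" "smooth_fun A W f"
  shows "smooth_fun A W (\<lambda>q. hv q (X (\<phi> q)) f)"
proof -
  note o = open_image[OF assms(1,2)]
  have L: "bounded_linear (\<lambda>x. \<i> *s x :: complex^'n)"
    by (intro linear_conv_bounded_linear[THEN iffD1] linearI) (simp_all add: vec_eq_iff algebra_simps)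
  have "smooth_on (\<phi> ` W) (\<lambda>z. \<i> *s X z)"
    by (rule smooth_on_bounded_linear[OF L o assms(3)])
  note s = smooth_fun_rv[OF assms] smooth_fun_rv[OF assms(1,2) this assms(4)]
  have "smooth_fun A W (\<lambda>q. 1/2 * rv q (X (\<phi> q)) f + (-\<i>/2) * rv q (\<i> *s X (\<phi> q)) f)"
    by (intro smooth_fun_add smooth_fun_mult assms(1,2) smooth_fun_const s)
  then show ?thesis
    by (rule smooth_fun_cong[OF assms(1,2)]) (use assms(2) in \<open>auto simp: hv_eq field_simps\<close>)
qed

lemma smooth_section_components:
  assumes "open W" "W \<subseteq> U" "smooth_section A E W s" "\<And>q. q \<in> W \<Longrightarrow> s q (\<lambda>r. \<phi> r $ \<alpha>) = X (\<phi> q) $ \<alpha>"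
  shows "smooth_on (\<phi> ` W) (\<lambda>z. X z $ \<alpha>)"
proof -
  have "smooth_fun A W (\<lambda>r. \<phi> r $ \<alpha>)"
    using smooth_fun_linear_coordinate[OF bounded_linear_vec_nth] assms(2) by (rule smooth_fun_subset)
  then have "smooth_fun A W (\<lambda>q. s q (\<lambda>r. \<phi> r $ \<alpha>))"
    using assms(1,3) by (auto simp: smooth_section_def)
  then show ?thesis
    using smooth_fun_chart_iff[where f="\<lambda>q. s q (\<lambda>r. \<phi> r $ \<alpha>)" and F="\<lambda>z. X z $ \<alpha>", OF assms(1,2,4)]
    by simp
qed

lemma smooth_section_rvI:
  assumes "open W" "W \<subseteq> U" "smooth_on (\<phi> ` W) X" "\<And>q. q \<in> W \<Longrightarrow> v q = rv q (X (\<phi> q))"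
  shows "smooth_section A (tangent A) W v"
  unfolding smooth_section_def
proof (intro conjI allI impI ballI)
  fix q assume "q \<in> W"
  then show "v q \<in> tangent A q" using assms(2,4) tangent_eq[of q] by auto
next
  fix V f assume V: "open V" "V \<subseteq> W" "smooth_fun A V f"
  have VU: "V \<subseteq> U" using V assms by auto
  show "smooth_fun A V (\<lambda>q. v q f)"
    by (rule smooth_fun_cong[OF V(1) VU smooth_fun_rv[OF V(1) VU smooth_on_subset[OF assms(3) image_mono[OF V(2)]] V(3)]])
      (use assms(4) V(2) in auto)
qed

lemma smooth_section_hvI:
  assumes "open W" "W \<subseteq> U" "smooth_on (\<phi> ` W) X" "\<And>q. q \<in> W \<Longrightarrow> v q = hv q (X (\<phi> q))"
  shows "smooth_section A (T10 A) W v"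
  unfolding smooth_section_def
proof (intro conjI allI impI ballI)
  fix q assume "q \<in> W"
  then show "v q \<in> T10 A q" using assms(2,4) T10_eq[of q] by auto
next
  fix V f assume V: "open V" "V \<subseteq> W" "smooth_fun A V f"
  have VU: "V \<subseteq> U" using V assms by auto
  show "smooth_fun A V (\<lambda>q. v q f)"
    by (rule smooth_fun_cong[OF V(1) VU smooth_fun_hv[OF V(1) VU smooth_on_subset[OF assms(3) image_mono[OF V(2)]] V(3)]])
      (use assms(4) V(2) in auto)
qed

text \<open>Smoothness of a section is defined by its action on smooth functions. Acting on the
  coordinate functions yields the components, so these are smooth as well.\<close>

lemma smooth_section_rvE:
  assumes "open W" "W \<subseteq> U" "smooth_section A (tangent A) W v"
  obtains X where "smooth_on (\<phi> ` W) X" "\<And>q. q \<in> W \<Longrightarrow> v q = rv q (X (\<phi> q))"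
proof
  define X where "X z = (\<chi> \<alpha>. v (\<Phi> z) (\<lambda>r. \<phi> r $ \<alpha>))" for z
  show eq: "v q = rv q (X (\<phi> q))" if "q \<in> W" for q
  proof -
    have q: "q \<in> U" using that assms by auto
    have "v q \<in> range (rv q)"
      using assms(3) that unfolding smooth_section_def tangent_eq[OF q, symmetric] by simp
    then obtain Y where Y: "v q = rv q Y" by (rule rangeE)
    then have "X (\<phi> q) = Y" using q by (simp add: X_def vec_eq_iff)
    then show ?thesis using Y by simp
  qed
  show "smooth_on (\<phi> ` W) X"
    by (intro smooth_on_vec open_image assms smooth_section_components[OF assms])
      (use assms(2) in \<open>auto simp: eq\<close>)
qed

lemma smooth_section_hvE:
  assumes "open W" "W \<subseteq> U" "smooth_section A (T10 A) W v"
  obtains X where "smooth_on (\<phi> ` W) X" "\<And>q. q \<in> W \<Longrightarrow> v q = hv q (X (\<phi> q))"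
proof
  define X where "X z = (\<chi> \<alpha>. v (\<Phi> z) (\<lambda>r. \<phi> r $ \<alpha>))" for z
  show eq: "v q = hv q (X (\<phi> q))" if "q \<in> W" for q
  proof -
    have q: "q \<in> U" using that assms by auto
    have "v q \<in> range (hv q)"
      using assms(3) that unfolding smooth_section_def T10_eq[OF q, symmetric] by simp
    then obtain Y where Y: "v q = hv q Y" by (rule rangeE)
    then have "X (\<phi> q) = Y" using q by (simp add: X_def vec_eq_iff)
    then show ?thesis using Y by simp
  qed
  show "smooth_on (\<phi> ` W) X"
    by (intro smooth_on_vec open_image assms smooth_section_components[OF assms])
      (use assms(2) in \<open>auto simp: eq\<close>)
qed

section \<open>Operations on sections and the coordinate frame\<close>

lemma smooth_section_restrict:
  "smooth_section A E W s \<Longrightarrow> W' \<subseteq> W \<Longrightarrow> smooth_section A E W' s"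
  by (auto simp: smooth_section_def)

lemma complex_tangent_add_scale:
  assumes "q \<in> U" "v \<in> complex_tangent A q" "w \<in> complex_tangent A q"
  shows "(\<lambda>f. c * v f + w f) \<in> complex_tangent A q"
proof -
  note L = rv_linear[OF assms(1)]
  obtain X Y X' Y' where v: "v = (\<lambda>f. rv q X f + \<i> * rv q Y f)" and w: "w = (\<lambda>f. rv q X' f + \<i> * rv q Y' f)"
    using assms(2,3) unfolding complex_tangent_eq[OF assms(1)] by auto
  have "(\<lambda>f. c * v f + w f) = (\<lambda>f. rv q (Re c *\<^sub>R X + (- Im c) *\<^sub>R Y + X') f + \<i> * rv q (Im c *\<^sub>R X + Re c *\<^sub>R Y + Y') f)"
    unfolding v w linear_add[OF L] linear_cmul[OF L]
    by (simp add: fun_eq_iff complex_eq_iff algebra_simps)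
  then show ?thesis
    unfolding complex_tangent_eq[OF assms(1)] by blast
qed

lemma smooth_section_complex_add_scale:
  assumes "open W" "W \<subseteq> U" "smooth_section A (complex_tangent A) W v"
    "smooth_section A (complex_tangent A) W w" "smooth_fun A W k"
  shows "smooth_section A (complex_tangent A) W (\<lambda>q f. k q * v q f + w q f)"
  unfolding smooth_section_def
proof (intro conjI allI impI ballI)
  fix q assume "q \<in> W"
  then show "(\<lambda>f. k q * v q f + w q f) \<in> complex_tangent A q"
    using assms by (intro complex_tangent_add_scale) (auto simp: smooth_section_def)
next
  fix V f assume V: "open V" "V \<subseteq> W" "smooth_fun A V f"
  then have "V \<subseteq> U" "smooth_fun A V k" "smooth_fun A V (\<lambda>q. v q f)" "smooth_fun A V (\<lambda>q. w q f)"
    using assms smooth_fun_subset[OF assms(5) V(2)] by (auto simp: smooth_section_def)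
  then show "smooth_fun A V (\<lambda>q. k q * v q f + w q f)"
    using V by (intro smooth_fun_add smooth_fun_mult)
qed

lemma smooth_section_tangent_complex:
  assumes "W \<subseteq> U" "smooth_section A (tangent A) W v"
  shows "smooth_section A (complex_tangent A) W v"
  using assms(2) subsetD[OF tangent_subset_complex_tangent] subsetD[OF assms(1)]
  by (simp add: smooth_section_def)

lemma smooth_section_T10_complex:
  "smooth_section A (T10 A) W v \<Longrightarrow> smooth_section A (complex_tangent A) W v"
  by (auto simp: smooth_section_def T10_def)

lemma smooth_section_T01_complex:
  "smooth_section A (T01 A) W v \<Longrightarrow> smooth_section A (complex_tangent A) W v"
  by (auto simp: smooth_section_def T01_def)

lemma hv_zero: "hv q 0 = (\<lambda>f. 0)"
  by (simp add: hvec_def)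

lemma hv_add: "hv q (X + Y) = (\<lambda>f. hv q X f + hv q Y f)"
  by (simp add: hvec_def sum.distrib algebra_simps)

lemma hv_scale: "hv q (c *s X) = (\<lambda>f. c * hv q X f)"
  by (simp add: hvec_def sum_distrib_left algebra_simps)

lemma hv_sum: "hv q (\<Sum>i\<in>I. X i) = (\<lambda>f. \<Sum>i\<in>I. hv q (X i) f)"
  by (induction I rule: infinite_finite_induct) (auto simp: hv_zero hv_add)

lemma d_z_hv: "d_z A U \<phi> \<alpha> q = hv q (axis \<alpha> 1)"
proof -
  have "(\<Sum>\<beta>\<in>UNIV. axis \<alpha> 1 $ \<beta> * d_z A U \<phi> \<beta> q f) = (\<Sum>\<beta>\<in>UNIV. if \<beta> = \<alpha> then d_z A U \<phi> \<beta> q f else 0)" for f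
    by (rule sum.cong) (auto simp: axis_def)
  then show ?thesis by (simp add: hvec_def)
qed

lemma smooth_section_d_z: "smooth_section A (T10 A) U (d_z A U \<phi> \<alpha>)"
  by (rule smooth_section_hvI[OF open_U order_refl, where X="\<lambda>z. axis \<alpha> 1"]) (simp_all add: d_z_hv)

text \<open>The field is written as \<open>rv q X f + \<i> * rv q Y f\<close> to make
  \<open>J_rv\<close> applicable: multiplication by \<open>\<i>\<close> sends the pair (e/2, i e/2)
  to (i e/2, -e/2), which is \<open>- \<i>\<close> times the original vector.\<close>

lemma smooth_section_d_zbar: "smooth_section A (T01 A) U (d_zbar A U \<phi> \<alpha>)"
proof -
  note L = rv_linear
  have e: "d_zbar A U \<phi> \<alpha> q f = rv q ((1/2) *\<^sub>R axis \<alpha> 1) f + \<i> * rv q ((1/2) *\<^sub>R axis \<alpha> \<i>) f" if "q \<in> U" for q f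
    by (simp only: d_zbar_def d_x_eq linear_cmul[OF L[OF that]])
      (simp add: scaleR_conv_of_real field_simps)
  have e': "d_zbar A U \<phi> \<alpha> q = (\<lambda>f. rv q ((1/2) *\<^sub>R axis \<alpha> 1) f + \<i> * rv q ((1/2) *\<^sub>R axis \<alpha> \<i>) f)" if "q \<in> U" for q
    using e[OF that] by (rule ext)
  have J: "J A q (d_zbar A U \<phi> \<alpha> q) = (\<lambda>f. - \<i> * d_zbar A U \<phi> \<alpha> q f)" if "q \<in> U" for q
  proof -
    have i: "\<i> *s axis \<alpha> 1 = axis \<alpha> \<i>" "\<i> *s axis \<alpha> \<i> = - (axis \<alpha> 1 :: complex^'n)"
      by (simp_all add: vec_eq_iff axis_def)
    show ?thesis
      unfolding fun_eq_iff e'[OF that] J_rv[OF that]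
      unfolding smult_scaleR_commute i linear_cmul[OF L[OF that]] linear_neg[OF L[OF that]]
      by (simp add: field_simps)
  qed
  have ct: "d_zbar A U \<phi> \<alpha> q \<in> complex_tangent A q" if "q \<in> U" for q
    unfolding complex_tangent_eq[OF that] e'[OF that] by blast
  show ?thesis
    unfolding smooth_section_def
  proof (intro conjI allI impI ballI)
    fix q assume "q \<in> U"
    then show "d_zbar A U \<phi> \<alpha> q \<in> T01 A q" using J ct by (simp add: T01_def)
  next
    fix V f assume V: "open V" "V \<subseteq> U" "smooth_fun A V f"
    have "smooth_fun A V (\<lambda>q. rv q ((1/2) *\<^sub>R axis \<alpha> 1) f + \<i> * rv q ((1/2) *\<^sub>R axis \<alpha> \<i>) f)"
      by (intro smooth_fun_add smooth_fun_mult V smooth_fun_const smooth_fun_rv smooth_on_const)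
    then show "smooth_fun A V (\<lambda>q. d_zbar A U \<phi> \<alpha> q f)"
      by (rule smooth_fun_cong[OF V(1,2)]) (use V(2) in \<open>auto simp: e\<close>)
  qed
qed

section \<open>Lie brackets and holomorphy of the coordinate frame\<close>

lemma bracket_rv:
  assumes "open W" "W \<subseteq> U" "smooth_on (\<phi> ` W) X" "smooth_on (\<phi> ` W) Y"
    "\<And>q. q \<in> W \<Longrightarrow> v q = rv q (X (\<phi> q))" "\<And>q. q \<in> W \<Longrightarrow> w q = rv q (Y (\<phi> q))" "q \<in> W"
  shows "bracket A v w q = rv q (frechet_derivative Y (at (\<phi> q)) (X (\<phi> q)) - frechet_derivative X (at (\<phi> q)) (Y (\<phi> q)))"
proof
  fix f
  have q: "q \<in> U" using assms by auto
  show "bracket A v w q f = rv q (frechet_derivative Y (at (\<phi> q)) (X (\<phi> q)) - frechet_derivative X (at (\<phi> q)) (Y (\<phi> q))) f"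
  proof (cases "smooth_near A q f")
    case False
    then show ?thesis by (simp add: bracket_def rvec_def)
  next
    case True
    then obtain V where V: "open V" "q \<in> V" "smooth_fun A V f" by (auto simp: smooth_near_def)
    define N where "N = V \<inter> W"
    have N: "open N" "q \<in> N" "N \<subseteq> U" "N \<subseteq> W" "smooth_fun A N f"
      using V assms smooth_fun_subset[OF V(3)] by (auto simp: N_def)
    note o = open_image[OF N(1,3)]
    have z: "\<phi> q \<in> \<phi> ` N" using N by auto
    define F where "F = f \<circ> \<Phi>"
    have F: "smooth_on (\<phi> ` N) F" using N smooth_fun_iff by (simp add: F_def)
    have fF: "f r = F (\<phi> r)" if "r \<in> N" for r using that N(3) by (auto simp: F_def)
    have XY: "smooth_on (\<phi> ` N) X" "smooth_on (\<phi> ` N) Y"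
      by (rule smooth_on_subset[OF assms(3) image_mono[OF N(4)]],
          rule smooth_on_subset[OF assms(4) image_mono[OF N(4)]])
    \<comment> \<open>An iterated derivative is a second derivative of \<open>F\<close> plus the
      first derivative of \<open>F\<close> along the derivative of the components. In the commutator
      the second derivatives cancel by symmetry.\<close>
    have D: "rv q Z (\<lambda>r. u r f) = frechet_derivative (\<lambda>y. frechet_derivative F (at y) (Y (\<phi> q))) (at (\<phi> q)) Z
        + frechet_derivative F (at (\<phi> q)) (frechet_derivative Y (at (\<phi> q)) Z)"
      if "smooth_on (\<phi> ` N) Y" "\<And>r. r \<in> W \<Longrightarrow> u r = rv r (Y (\<phi> r))" for Z Y u
    proof -
      have u: "u r f = frechet_derivative F (at (\<phi> r)) (Y (\<phi> r))" if "r \<in> N" for r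
        using rv_chart_fun[OF N(1,3) that F fF] \<open>\<And>r. r \<in> W \<Longrightarrow> u r = rv r (Y (\<phi> r))\<close> that N(4) by auto
      have "rv q Z (\<lambda>r. u r f) = frechet_derivative (\<lambda>y. frechet_derivative F (at y) (Y y)) (at (\<phi> q)) Z"
        by (rule rv_chart_fun[OF N(1,3,2) smooth_on_directional[OF o F that(1)]]) (rule u)
      then show ?thesis
        using frechet_derivative_eqI[OF has_derivative_linear_apply[OF o z smooth_on_linear_derivative[OF F]
              smooth_on_differentiable[OF smooth_on_derivative[OF F] z] smooth_on_has_derivative[OF that(1) z]]]
        by simp
    qed
    have "bracket A v w q f = rv q (X (\<phi> q)) (\<lambda>r. w r f) - rv q (Y (\<phi> q)) (\<lambda>r. v r f)"
      using True assms(5,6,7) by (simp add: bracket_def)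
    also have "\<dots> = frechet_derivative F (at (\<phi> q)) (frechet_derivative Y (at (\<phi> q)) (X (\<phi> q)))
        - frechet_derivative F (at (\<phi> q)) (frechet_derivative X (at (\<phi> q)) (Y (\<phi> q)))"
      using D[of Y w "X (\<phi> q)", OF XY(2) assms(6)] D[of X v "Y (\<phi> q)", OF XY(1) assms(5)]
        second_derivative_symmetric[OF o z F, of "X (\<phi> q)" "Y (\<phi> q)"] by simp
    also have "\<dots> = rv q (frechet_derivative Y (at (\<phi> q)) (X (\<phi> q)) - frechet_derivative X (at (\<phi> q)) (Y (\<phi> q))) f"
    proof -
      have "rv q Z f = frechet_derivative F (at (\<phi> q)) Z" for Z
        by (rule rv_chart_fun[OF N(1,3,2) F fF])
      then show ?thesis
        by (simp add: linear_diff[OF smooth_on_linear_derivative[OF F z]])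
    qed
    finally show ?thesis .
  qed
qed

text \<open>In another chart the components of \<open>d_z\<close> are the complex partial
  derivatives of the transition map \<open>\<tau>\<close>. Partial derivatives of a holomorphic
  function are holomorphic, and the inverse transition \<open>t\<close> expresses them in the
  coordinates of that chart.\<close>

lemma holomorphic_section_d_z: "holomorphic_section A U (d_z A U \<phi> \<alpha>)"
  unfolding holomorphic_section_def
proof (intro conjI smooth_section_d_z, clarify)
  fix V :: "'a set" and \<psi> :: "'a \<Rightarrow> complex^'n" and \<beta>
  assume V: "(V, \<psi>) \<in> A"
  interpret V: holomorphic_chart A V \<psi> by unfold_locales (use atlas V in auto)
  define N where "N = V \<inter> U"
  have N: "open N" "N \<subseteq> U" "N \<subseteq> V" using open_U V.open_U by (auto simp: N_def)
  note oU = open_image[OF N(1,2)] and oV = V.open_image[OF N(1,3)]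
  define t where "t z = \<phi> (inv_into V \<psi> z)" for z
  define \<tau> where "\<tau> y = \<psi> (\<Phi> y) $ \<beta>" for y
  let ?e = "axis \<alpha> 1 :: complex^'n"
  have t: "smooth_on (\<psi> ` N) t" "\<And>z v. z \<in> \<psi> ` N \<Longrightarrow>
      frechet_derivative t (at z) (\<i> *s v) = \<i> *s frechet_derivative t (at z) v"
    using transition[OF V _ N(1)] N unfolding t_def by auto
  have tin: "t z \<in> \<phi> ` N" if "z \<in> \<psi> ` N" for z using that N by (auto simp: t_def)
  have tau: "smooth_on (\<phi> ` N) \<tau>" "\<And>z v. z \<in> \<phi> ` N \<Longrightarrow>
      frechet_derivative \<tau> (at z) (\<i> *s v) = \<i> * frechet_derivative \<tau> (at z) v"
  proof -
    have "holomorphic_fun (\<phi> ` (U \<inter> V)) (\<lambda>z. \<psi> (\<Phi> z) $ \<beta>)"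
      using atlas V chart_in unfolding complex_atlas_def by fastforce
    then show "smooth_on (\<phi> ` N) \<tau>" "\<And>z v. z \<in> \<phi> ` N \<Longrightarrow>
      frechet_derivative \<tau> (at z) (\<i> *s v) = \<i> * frechet_derivative \<tau> (at z) v"
      unfolding holomorphic_fun_def N_def \<tau>_def Int_commute[of V U] by blast+
  qed
  define F where "F y = frechet_derivative \<tau> (at y) ?e" for y
  have F: "smooth_on (\<phi> ` N) F" unfolding F_def by (rule smooth_on_derivative[OF tau(1)])
  \<comment> \<open>Exchanging the order of differentiation puts \<open>\<i> *s w\<close> into the
    inner derivative, where the Cauchy-Riemann condition of \<open>\<tau>\<close> extracts
    \<open>\<i>\<close>; a second exchange restores the order.\<close>
  have F': "frechet_derivative F (at y) (\<i> *s w) = \<i> * frechet_derivative F (at y) w" if y: "y \<in> \<phi> ` N" for y w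
  proof -
    let ?D = "\<lambda>u z. frechet_derivative \<tau> (at z) u"
    have "frechet_derivative F (at y) (\<i> *s w) = frechet_derivative (?D (\<i> *s w)) (at y) ?e"
      unfolding F_def by (rule second_derivative_symmetric[OF oU y tau(1)])
    also have "\<dots> = frechet_derivative (\<lambda>z. \<i> * ?D w z) (at y) ?e"
      by (subst frechet_derivative_cong_open[OF oU y]) (auto simp: tau(2))
    also have "\<dots> = \<i> * frechet_derivative (?D w) (at y) ?e"
      by (subst frechet_derivative_eqI[OF has_derivative_mult_right[OF
            smooth_on_has_derivative[OF smooth_on_derivative[OF tau(1)] y]]]) simp
    also have "frechet_derivative (?D w) (at y) ?e = frechet_derivative F (at y) w"
      unfolding F_def by (rule second_derivative_symmetric[OF oU y tau(1)])
    finally show ?thesis .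
  qed
  have comp: "((\<lambda>q. d_z A U \<phi> \<alpha> q (\<lambda>r. \<psi> r $ \<beta>)) \<circ> inv_into V \<psi>) z = F (t z)" if z: "z \<in> \<psi> ` N" for z
  proof -
    define q where "q = inv_into V \<psi> z"
    have q: "q \<in> N" using z N(3) by (auto simp: q_def)
    then have qU: "q \<in> U" using N(2) by auto
    have r: "rv q X (\<lambda>r. \<psi> r $ \<beta>) = frechet_derivative \<tau> (at (\<phi> q)) X" for X
      by (rule rv_chart_fun[OF N(1,2) q tau(1)]) (use N in \<open>auto simp: \<tau>_def\<close>)
    \<comment> \<open>By the Cauchy-Riemann condition of \<open>\<tau>\<close> the two halves of the
      (1,0)-part agree, so \<open>d_z\<close> acts on the coordinate as the plain derivative along
      \<open>?e\<close>.\<close>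
    show ?thesis
      using q qU tau(2)[of "\<phi> q" ?e] by (simp add: d_z_hv hv_eq r F_def t_def q_def[symmetric])
  qed
  have "holomorphic_fun (\<psi> ` N) (\<lambda>z. F (t z))"
    unfolding holomorphic_fun_def
  proof (intro conjI ballI allI)
    show "smooth_on (\<psi> ` N) (\<lambda>z. F (t z))"
      by (rule smooth_on_compose[OF oV oU _ F t(1)]) (use tin in auto)
    fix z v assume z: "z \<in> \<psi> ` N"
    have "frechet_derivative (\<lambda>z. F (t z)) (at z) w = frechet_derivative F (at (t z)) (frechet_derivative t (at z) w)" for w
      using frechet_derivative_eqI[OF diff_chain_at[OF smooth_on_has_derivative[OF t(1) z]
            smooth_on_has_derivative[OF F tin[OF z]]]] by (simp add: o_def)
    then show "frechet_derivative (\<lambda>z. F (t z)) (at z) (\<i> *s v) = \<i> * frechet_derivative (\<lambda>z. F (t z)) (at z) v"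
      using t(2)[OF z] F'[OF tin[OF z]] by simp
  qed
  then show "holomorphic_fun (\<psi> ` (V \<inter> U)) ((\<lambda>q. d_z A U \<phi> \<alpha> q (\<lambda>r. \<psi> r $ \<beta>)) \<circ> inv_into V \<psi>)"
    unfolding N_def[symmetric] by (subst holomorphic_fun_cong[OF oV comp])
qed

section \<open>The Chern connection in a chart\<close>

lemma smooth_section_T10_zero:
  assumes "open W" "W \<subseteq> U"
  shows "smooth_section A (T10 A) W (\<lambda>q f. 0)"
  by (rule smooth_section_hvI[OF assms, where X="\<lambda>z. 0"]) (simp_all add: hv_zero)

lemma smooth_section_T10_add:
  assumes W: "open W" "W \<subseteq> U" and s: "smooth_section A (T10 A) W s" "smooth_section A (T10 A) W t"
  shows "smooth_section A (T10 A) W (\<lambda>q f. s q f + t q f)"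
proof -
  obtain X where X: "smooth_on (\<phi> ` W) X" "\<And>q. q \<in> W \<Longrightarrow> s q = hv q (X (\<phi> q))"
    by (rule smooth_section_hvE[OF W s(1)]) blast
  obtain Y where Y: "smooth_on (\<phi> ` W) Y" "\<And>q. q \<in> W \<Longrightarrow> t q = hv q (Y (\<phi> q))"
    by (rule smooth_section_hvE[OF W s(2)]) blast
  show ?thesis
    by (rule smooth_section_hvI[OF W smooth_on_add[OF open_image[OF W] X(1) Y(1)]])
      (simp add: hv_add X(2) Y(2))
qed

lemma smooth_section_T10_scale:
  assumes W: "open W" "W \<subseteq> U" and s: "smooth_section A (T10 A) W s" and k: "smooth_fun A W k"
  shows "smooth_section A (T10 A) W (\<lambda>q f. k q * s q f)"
proof -
  obtain X where X: "smooth_on (\<phi> ` W) X" "\<And>q. q \<in> W \<Longrightarrow> s q = hv q (X (\<phi> q))"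
    by (rule smooth_section_hvE[OF W s(1)]) blast
  have K: "smooth_on (\<phi> ` W) (\<lambda>z. k (\<Phi> z))"
    using k smooth_fun_iff[OF W] by (simp add: o_def)
  have "smooth_on (\<phi> ` W) (\<lambda>z. k (\<Phi> z) *s X z)"
  proof (rule smooth_on_vec[OF open_image[OF W]])
    fix \<alpha>
    show "smooth_on (\<phi> ` W) (\<lambda>z. (k (\<Phi> z) *s X z) $ \<alpha>)"
      using smooth_on_mult[OF open_image[OF W] K smooth_on_nth[OF open_image[OF W] X(1)]] by simp
  qed
  then show ?thesis
    by (rule smooth_section_hvI[OF W]) (use W in \<open>auto simp: hv_scale X(2)\<close>)
qed

end

locale chern_chart = holomorphic_chart A U \<phi>
  for A :: "('a::topological_space, 'n::finite) atlas" and U :: "'a set" and \<phi> :: "'a \<Rightarrow> complex^'n" +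
  fixes h :: "'a \<Rightarrow> 'a tvec \<Rightarrow> 'a tvec \<Rightarrow> complex"
    and D :: "('a \<Rightarrow> 'a tvec) \<Rightarrow> ('a \<Rightarrow> 'a tvec) \<Rightarrow> ('a \<Rightarrow> 'a tvec)"
  assumes hermitian: "hermitian_metric A h" and chern: "chern_connection A h D"
begin

text \<open>The single axiom \<open>connection\<close> is split into rules that share its premises;
  this explains the repeated sections and constant functions that fill these premises below.\<close>

lemma D_rules:
  assumes "open W" "smooth_section A (complex_tangent A) W v" "smooth_section A (complex_tangent A) W v'"
    "smooth_section A (T10 A) W s" "smooth_section A (T10 A) W s'" "smooth_fun A W k"
  shows "smooth_section A (T10 A) W (D v s)"
    and "q \<in> W \<Longrightarrow> D (\<lambda>q f. k q * v q f + v' q f) s q = (\<lambda>f. k q * D v s q f + D v' s q f)"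
    and "q \<in> W \<Longrightarrow> D v (\<lambda>q f. s q f + s' q f) q = (\<lambda>f. D v s q f + D v s' q f)"
    and "q \<in> W \<Longrightarrow> D v (\<lambda>q f. k q * s q f) q = (\<lambda>f. v q k * s q f + k q * D v s q f)"
    and "(\<And>q. q \<in> W \<Longrightarrow> v q = v' q) \<Longrightarrow> (\<And>q. q \<in> W \<Longrightarrow> s q = s' q) \<Longrightarrow> q \<in> W \<Longrightarrow> D v s q = D v' s' q"
proof -
  have c: "connection A D" using chern by (simp add: chern_connection_def)
  note * = c[unfolded connection_def, rule_format, OF assms]
  show "smooth_section A (T10 A) W (D v s)" using * by (rule conjunct1)
  show "q \<in> W \<Longrightarrow> D (\<lambda>q f. k q * v q f + v' q f) s q = (\<lambda>f. k q * D v s q f + D v' s q f)"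
    using * by simp
  show "q \<in> W \<Longrightarrow> D v (\<lambda>q f. s q f + s' q f) q = (\<lambda>f. D v s q f + D v s' q f)"
    using * by simp
  show "q \<in> W \<Longrightarrow> D v (\<lambda>q f. k q * s q f) q = (\<lambda>f. v q k * s q f + k q * D v s q f)"
    using * by simp
  show "(\<And>q. q \<in> W \<Longrightarrow> v q = v' q) \<Longrightarrow> (\<And>q. q \<in> W \<Longrightarrow> s q = s' q) \<Longrightarrow> q \<in> W \<Longrightarrow> D v s q = D v' s' q"
    using * by simp
qed

text \<open>Smoothness and the derivative formula are proved in one induction, since additivity of
  \<open>D\<close> applies only once the partial sum is known to be a smooth section.\<close>

lemma D_sum_right:
  assumes W: "open W" "W \<subseteq> U" and v: "smooth_section A (complex_tangent A) W v"
    and "finite I" "\<And>i. i \<in> I \<Longrightarrow> smooth_section A (T10 A) W (s i)" "\<And>i. i \<in> I \<Longrightarrow> smooth_fun A W (k i)"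
  shows "smooth_section A (T10 A) W (\<lambda>q f. \<Sum>i\<in>I. k i q * s i q f) \<and>
    (\<forall>q\<in>W. D v (\<lambda>q f. \<Sum>i\<in>I. k i q * s i q f) q =
      (\<lambda>f. \<Sum>i\<in>I. v q (k i) * s i q f + k i q * D v (s i) q f))"
  using assms(4-6)
proof (induction I rule: finite_induct)
  case empty
  note z = smooth_section_T10_zero[OF W]
  \<comment> \<open>The Leibniz rule for the zero section with the coefficient function
    \<open>0\<close>.\<close>
  have "D v (\<lambda>q f. 0) q = (\<lambda>f. 0)" if "q \<in> W" for q
    using D_rules(4)[OF W(1) v v z z smooth_fun_const[of _ 0] that] by simp
  then show ?case using z by simp
next
  case (insert i I)
  let ?S = "\<lambda>q f. \<Sum>i\<in>I. k i q * s i q f"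
  have S: "smooth_section A (T10 A) W ?S"
    "\<And>q. q \<in> W \<Longrightarrow> D v ?S q = (\<lambda>f. \<Sum>i\<in>I. v q (k i) * s i q f + k i q * D v (s i) q f)"
    using insert by auto
  have si: "smooth_section A (T10 A) W (s i)" "smooth_fun A W (k i)" using insert by auto
  have ks: "smooth_section A (T10 A) W (\<lambda>q f. k i q * s i q f)"
    by (rule smooth_section_T10_scale[OF W si])
  have e: "(\<lambda>q f. \<Sum>i\<in>insert i I. k i q * s i q f) = (\<lambda>q f. k i q * s i q f + ?S q f)"
    using insert by simp
  show ?case
    unfolding e using smooth_section_T10_add[OF W ks S(1)]
      D_rules(3)[OF W(1) v v ks S(1) si(2)] D_rules(4)[OF W(1) v v si(1) si(1) si(2)] S(2) insert(1,2)
    by simp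
qed

lemma D_sum_left:
  assumes W: "open W" "W \<subseteq> U" and s: "smooth_section A (T10 A) W s"
    and "finite I" "\<And>i. i \<in> I \<Longrightarrow> smooth_section A (complex_tangent A) W (v i)" "\<And>i. i \<in> I \<Longrightarrow> smooth_fun A W (k i)"
  shows "smooth_section A (complex_tangent A) W (\<lambda>q f. \<Sum>i\<in>I. k i q * v i q f) \<and>
    (\<forall>q\<in>W. D (\<lambda>q f. \<Sum>i\<in>I. k i q * v i q f) s q = (\<lambda>f. \<Sum>i\<in>I. k i q * D (v i) s q f))"
  using assms(4-6)
proof (induction I rule: finite_induct)
  case empty
  note z = smooth_section_T10_complex[OF smooth_section_T10_zero[OF W]]
  \<comment> \<open>With \<open>k = 1\<close> and both fields zero, linearity says that the value
    equals twice itself.\<close>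
  have "D (\<lambda>q f. 0) s q = (\<lambda>f. 0)" if "q \<in> W" for q
    using D_rules(2)[OF W(1) z z s s smooth_fun_const[of _ 1] that] by (simp add: fun_eq_iff)
  then show ?case using z by simp
next
  case (insert i I)
  let ?S = "\<lambda>q f. \<Sum>i\<in>I. k i q * v i q f"
  have S: "smooth_section A (complex_tangent A) W ?S"
    "\<And>q. q \<in> W \<Longrightarrow> D ?S s q = (\<lambda>f. \<Sum>i\<in>I. k i q * D (v i) s q f)"
    using insert by auto
  have vi: "smooth_section A (complex_tangent A) W (v i)" "smooth_fun A W (k i)" using insert by auto
  have e: "(\<lambda>q f. \<Sum>i\<in>insert i I. k i q * v i q f) = (\<lambda>q f. k i q * v i q f + ?S q f)"
    using insert by simp
  show ?case
    unfolding e using smooth_section_complex_add_scale[OF W vi(1) S(1) vi(2)]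
      D_rules(2)[OF W(1) vi(1) S(1) s s vi(2)] S(2) insert(1,2)
    by simp
qed

section \<open>Christoffel symbols and the local form of the connection\<close>

definition "Gam \<gamma> \<alpha> \<kappa> z = D (d_z A U \<phi> \<gamma>) (d_z A U \<phi> \<alpha>) (\<Phi> z) (\<lambda>r. \<phi> r $ \<kappa>)"

text \<open>The connection form evaluated on components. It is complex bilinear in \<open>X\<close>
  and \<open>Y\<close>: the part that could depend on the conjugate of \<open>X\<close> vanishes by
  \<open>D_d_zbar\<close>.\<close>

definition G :: "complex^'n \<Rightarrow> complex^'n \<Rightarrow> complex^'n \<Rightarrow> complex^'n" where
  "G z X Y = (\<chi> \<kappa>. \<Sum>\<gamma>\<in>UNIV. \<Sum>\<alpha>\<in>UNIV. X $ \<gamma> * Y $ \<alpha> * Gam \<gamma> \<alpha> \<kappa> z)"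

lemmas d_z_section = smooth_section_d_z smooth_section_T10_complex[OF smooth_section_d_z]
  smooth_section_T01_complex[OF smooth_section_d_zbar]

lemma D_d_z:
  "smooth_on (\<phi> ` U) (Gam \<gamma> \<alpha> \<kappa>)"
  "q \<in> U \<Longrightarrow> D (d_z A U \<phi> \<gamma>) (d_z A U \<phi> \<alpha>) q = hv q (\<chi> \<kappa>. Gam \<gamma> \<alpha> \<kappa> (\<phi> q))"
proof -
  have s: "smooth_section A (T10 A) U (D (d_z A U \<phi> \<gamma>) (d_z A U \<phi> \<alpha>))"
    by (rule D_rules(1)[OF open_U d_z_section(2) d_z_section(2) d_z_section(1) d_z_section(1) smooth_fun_const])
  obtain X where X: "smooth_on (\<phi> ` U) X" "\<And>q. q \<in> U \<Longrightarrow> D (d_z A U \<phi> \<gamma>) (d_z A U \<phi> \<alpha>) q = hv q (X (\<phi> q))"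
    by (rule smooth_section_hvE[OF open_U order_refl s]) blast
  have e: "Gam \<gamma> \<alpha> \<kappa> (\<phi> q) = X (\<phi> q) $ \<kappa>" if "q \<in> U" for q \<kappa>
    using that by (simp add: Gam_def X(2))
  then show "q \<in> U \<Longrightarrow> D (d_z A U \<phi> \<gamma>) (d_z A U \<phi> \<alpha>) q = hv q (\<chi> \<kappa>. Gam \<gamma> \<alpha> \<kappa> (\<phi> q))"
    by (simp add: X(2))
  show "smooth_on (\<phi> ` U) (Gam \<gamma> \<alpha> \<kappa>)"
    by (subst smooth_on_cong[OF open_range, of _ "\<lambda>z. X z $ \<kappa>"])
      (use e smooth_on_nth[OF open_range X(1)] in auto)
qed

text \<open>The point where compatibility with the holomorphic structure enters: a (0,1)-field is
  applied to a holomorphic section.\<close>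

lemma D_d_zbar: "q \<in> U \<Longrightarrow> D (d_zbar A U \<phi> \<gamma>) (d_z A U \<phi> \<alpha>) q = (\<lambda>f. 0)"
  using chern open_U smooth_section_d_zbar holomorphic_section_d_z
  unfolding chern_connection_def holomorphic_compatible_def by blast

lemma D_rv_d_z:
  assumes W: "open W" "W \<subseteq> U" and X: "smooth_on (\<phi> ` W) X"
    and v: "\<And>q. q \<in> W \<Longrightarrow> v q = rv q (X (\<phi> q))" and q: "q \<in> W"
  shows "D v (d_z A U \<phi> \<alpha>) q = (\<lambda>f. \<Sum>\<gamma>\<in>UNIV. X (\<phi> q) $ \<gamma> * hv q (\<chi> \<kappa>. Gam \<gamma> \<alpha> \<kappa> (\<phi> q)) f)"
proof -
  \<comment> \<open>The real field is written in the frame of all \<open>d_z\<close> and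
    \<open>d_zbar\<close>, with coefficients \<open>k\<close> given by its components and their
    conjugates; the \<open>d_zbar\<close> half then contributes nothing.\<close>
  define e where "e i = (case i of Inl \<gamma> \<Rightarrow> d_z A U \<phi> \<gamma> | Inr \<gamma> \<Rightarrow> d_zbar A U \<phi> \<gamma>)" for i :: "'n + 'n"
  define k where "k i r = (case i of Inl \<gamma> \<Rightarrow> X (\<phi> r) $ \<gamma> | Inr \<gamma> \<Rightarrow> cnj (X (\<phi> r) $ \<gamma>))" for i :: "'n + 'n" and r
  note o = open_image[OF W]
  have d: "smooth_section A (T10 A) W (d_z A U \<phi> \<alpha>)"
    by (rule smooth_section_restrict[OF d_z_section(1) W(2)])
  have e: "smooth_section A (complex_tangent A) W (e i)" for i
    by (cases i) (simp_all add: e_def smooth_section_restrict[OF d_z_section(2) W(2)] smooth_section_restrict[OF d_z_section(3) W(2)])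
  have k: "smooth_fun A W (k i)" for i
  proof (cases i)
    case (Inl \<gamma>)
    show ?thesis
      by (rule smooth_fun_chartI[OF W smooth_on_nth[OF o X, of \<gamma>]]) (simp add: k_def Inl)
  next
    case (Inr \<gamma>)
    show ?thesis
      by (rule smooth_fun_chartI[OF W smooth_on_cnj[OF o smooth_on_nth[OF o X, of \<gamma>]]]) (simp add: k_def Inr)
  qed
  note S = D_sum_left[where v=e and k=k, OF W d finite_class.finite_UNIV e k]
  have v': "smooth_section A (complex_tangent A) W v"
    by (rule smooth_section_tangent_complex[OF W(2) smooth_section_rvI[OF W X v]])
  have ve: "v r = (\<lambda>f. \<Sum>i\<in>UNIV. k i r * e i r f)" if "r \<in> W" for r
    using that W(2) by (auto simp: v fun_eq_iff rv_wirtinger sum_UNIV_Plus k_def e_def sum.distrib)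
  \<comment> \<open>The expansion of \<open>v\<close> is available only on \<open>W\<close>;
    locality of \<open>D\<close> permits the replacement.\<close>
  have "D v (d_z A U \<phi> \<alpha>) q = D (\<lambda>q f. \<Sum>i\<in>UNIV. k i q * e i q f) (d_z A U \<phi> \<alpha>) q"
    by (rule D_rules(5)[OF W(1) v' conjunct1[OF S] d d smooth_fun_const[of _ 0] ve refl q])
  also have "\<dots> = (\<lambda>f. \<Sum>i\<in>UNIV. k i q * D (e i) (d_z A U \<phi> \<alpha>) q f)"
    using S q by simp
  also have "\<dots> = (\<lambda>f. \<Sum>\<gamma>\<in>UNIV. X (\<phi> q) $ \<gamma> * hv q (\<chi> \<kappa>. Gam \<gamma> \<alpha> \<kappa> (\<phi> q)) f)"
    using q W(2) by (auto simp: sum_UNIV_Plus k_def e_def D_d_z(2) D_d_zbar subset_iff)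
  finally show ?thesis .
qed

text \<open>The Leibniz rule in the holomorphic frame: differentiating the coefficients of
  \<open>s\<close> gives the Frechet derivative, differentiating the frame gives
  \<open>G\<close>.\<close>

lemma D_rv_hv:
  assumes W: "open W" "W \<subseteq> U" and X: "smooth_on (\<phi> ` W) X" and Y: "smooth_on (\<phi> ` W) Y"
    and v: "\<And>q. q \<in> W \<Longrightarrow> v q = rv q (X (\<phi> q))" and s: "\<And>q. q \<in> W \<Longrightarrow> s q = hv q (Y (\<phi> q))" and q: "q \<in> W"
  shows "D v s q = hv q (frechet_derivative Y (at (\<phi> q)) (X (\<phi> q)) + G (\<phi> q) (X (\<phi> q)) (Y (\<phi> q)))"
proof -
  note o = open_image[OF W]
  have z: "\<phi> q \<in> \<phi> ` W" using q by auto
  have d: "smooth_section A (T10 A) W (d_z A U \<phi> \<alpha>)" for \<alpha>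
    by (rule smooth_section_restrict[OF d_z_section(1) W(2)])
  have v': "smooth_section A (complex_tangent A) W v"
    by (rule smooth_section_tangent_complex[OF W(2) smooth_section_rvI[OF W X v]])
  have s': "smooth_section A (T10 A) W s"
    by (rule smooth_section_hvI[OF W Y s])
  define k where "k \<alpha> r = Y (\<phi> r) $ \<alpha>" for \<alpha> r
  have k: "smooth_fun A W (k \<alpha>)" for \<alpha>
    by (rule smooth_fun_chartI[OF W smooth_on_nth[OF o Y, of \<alpha>]]) (simp add: k_def)
  note S = D_sum_right[where s="d_z A U \<phi>" and k=k, OF W v' finite_class.finite_UNIV d k]
  have se: "s r = (\<lambda>f. \<Sum>\<alpha>\<in>UNIV. k \<alpha> r * d_z A U \<phi> \<alpha> r f)" if "r \<in> W" for r
    using that by (simp add: s hvec_def k_def)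
  have vk: "v q (k \<alpha>) = frechet_derivative Y (at (\<phi> q)) (X (\<phi> q)) $ \<alpha>" for \<alpha>
  proof -
    have "v q (k \<alpha>) = frechet_derivative (\<lambda>z. Y z $ \<alpha>) (at (\<phi> q)) (X (\<phi> q))"
      unfolding v[OF q] by (rule rv_chart_fun[OF W q smooth_on_nth[OF o Y]]) (simp add: k_def)
    then show ?thesis
      using frechet_derivative_eqI[OF bounded_linear.has_derivative[OF bounded_linear_vec_nth
            smooth_on_has_derivative[OF Y z]]] by simp
  qed
  have GG: "hv q (G (\<phi> q) (X (\<phi> q)) (Y (\<phi> q))) f = (\<Sum>\<alpha>\<in>UNIV. Y (\<phi> q) $ \<alpha> *
      (\<Sum>\<gamma>\<in>UNIV. X (\<phi> q) $ \<gamma> * hv q (\<chi> \<kappa>. Gam \<gamma> \<alpha> \<kappa> (\<phi> q)) f))" for f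
  proof -
    have "G z X Y = (\<Sum>\<alpha>\<in>UNIV. Y $ \<alpha> *s (\<Sum>\<gamma>\<in>UNIV. X $ \<gamma> *s (\<chi> \<kappa>. Gam \<gamma> \<alpha> \<kappa> z)))" for z X Y
      by (simp add: vec_eq_iff G_def sum_distrib_left algebra_simps) (subst sum.swap, simp)
    then show ?thesis by (simp add: hv_sum hv_scale)
  qed
  have Dv: "D v (d_z A U \<phi> \<alpha>) q = (\<lambda>f. \<Sum>\<gamma>\<in>UNIV. X (\<phi> q) $ \<gamma> * hv q (\<chi> \<kappa>. Gam \<gamma> \<alpha> \<kappa> (\<phi> q)) f)" for \<alpha>
    by (rule D_rv_d_z[OF W X v q])
  have "D v s q = D v (\<lambda>q f. \<Sum>\<alpha>\<in>UNIV. k \<alpha> q * d_z A U \<phi> \<alpha> q f) q"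
    by (rule D_rules(5)[OF W(1) v' v' s' conjunct1[OF S] smooth_fun_const[of _ 0] refl se q])
  also have "\<dots> = (\<lambda>f. \<Sum>\<alpha>\<in>UNIV. v q (k \<alpha>) * d_z A U \<phi> \<alpha> q f + k \<alpha> q * D v (d_z A U \<phi> \<alpha>) q f)"
    using S q by simp
  also have "\<dots> = hv q (frechet_derivative Y (at (\<phi> q)) (X (\<phi> q)) + G (\<phi> q) (X (\<phi> q)) (Y (\<phi> q)))"
    unfolding hv_add GG vk Dv sum.distrib by (simp add: hvec_def k_def)
  finally show ?thesis .
qed

end

section \<open>Wirtinger derivatives\<close>

text \<open>Counterpart of \<open>d_z\<close> for functions of the coordinates, so that iterated
  derivatives can be computed on an open subset of \<open>complex^'n\<close>.\<close>

definition wirt :: "'n \<Rightarrow> (complex^'n::finite \<Rightarrow> complex) \<Rightarrow> complex^'n \<Rightarrow> complex" where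
  "wirt \<gamma> F z = (frechet_derivative F (at z) (axis \<gamma> 1) - \<i> * frechet_derivative F (at z) (axis \<gamma> \<i>)) / 2"

definition wirtbar :: "'n \<Rightarrow> (complex^'n::finite \<Rightarrow> complex) \<Rightarrow> complex^'n \<Rightarrow> complex" where
  "wirtbar \<gamma> F z = (frechet_derivative F (at z) (axis \<gamma> 1) + \<i> * frechet_derivative F (at z) (axis \<gamma> \<i>)) / 2"

lemma frechet_derivative_wirtinger:
  assumes "F differentiable (at z)"
  shows "frechet_derivative F (at z) X = (\<Sum>\<gamma>\<in>UNIV. X $ \<gamma> * wirt \<gamma> F z + cnj (X $ \<gamma>) * wirtbar \<gamma> F z)"
proof -
  note L = linear_frechet_derivative[OF assms]
  have "frechet_derivative F (at z) X = frechet_derivative F (at z)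
      (\<Sum>\<alpha>\<in>UNIV. Re (X $ \<alpha>) *\<^sub>R axis \<alpha> 1 + Im (X $ \<alpha>) *\<^sub>R axis \<alpha> \<i>)"
    using real_axis_expansion[of X] by simp
  also have "\<dots> = (\<Sum>\<gamma>\<in>UNIV. X $ \<gamma> * wirt \<gamma> F z + cnj (X $ \<gamma>) * wirtbar \<gamma> F z)"
    unfolding linear_sum[OF L] linear_add[OF L] linear_cmul[OF L] wirt_def wirtbar_def
    by (rule sum.cong) (simp_all add: complex_eq_iff field_simps)
  finally show ?thesis .
qed

lemma wirt_cong:
  assumes "open S" "z \<in> S" "\<And>y. y \<in> S \<Longrightarrow> f y = g y"
  shows "wirt \<gamma> f z = wirt \<gamma> g z" "wirtbar \<gamma> f z = wirtbar \<gamma> g z"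
  using frechet_derivative_cong_open[OF assms] by (simp_all add: wirt_def wirtbar_def)

lemma smooth_on_wirt:
  assumes "open S" "smooth_on S F"
  shows "smooth_on S (wirt \<gamma> F)" "smooth_on S (wirtbar \<gamma> F)"
proof -
  note d = smooth_on_derivative[OF assms(2)]
  have "smooth_on S (\<lambda>z. 1/2 * (frechet_derivative F (at z) (axis \<gamma> 1) - \<i> * frechet_derivative F (at z) (axis \<gamma> \<i>)))"
    by (intro smooth_on_mult smooth_on_diff assms(1) d smooth_on_const)
  then show "smooth_on S (wirt \<gamma> F)" by (simp add: wirt_def[abs_def])
  have "smooth_on S (\<lambda>z. 1/2 * (frechet_derivative F (at z) (axis \<gamma> 1) + \<i> * frechet_derivative F (at z) (axis \<gamma> \<i>)))"
    by (intro smooth_on_mult smooth_on_add assms(1) d smooth_on_const)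
  then show "smooth_on S (wirtbar \<gamma> F)" by (simp add: wirtbar_def[abs_def])
qed

lemma wirt_sum_mult:
  assumes "\<And>i. i \<in> I \<Longrightarrow> f i differentiable (at z)" "\<And>i. i \<in> I \<Longrightarrow> g i differentiable (at z)"
  shows "wirt \<gamma> (\<lambda>z. \<Sum>i\<in>I. f i z * g i z) z = (\<Sum>i\<in>I. wirt \<gamma> (f i) z * g i z + f i z * wirt \<gamma> (g i) z)"
    and "wirtbar \<gamma> (\<lambda>z. \<Sum>i\<in>I. f i z * g i z) z = (\<Sum>i\<in>I. wirtbar \<gamma> (f i) z * g i z + f i z * wirtbar \<gamma> (g i) z)"
proof -
  have d: "frechet_derivative (\<lambda>z. \<Sum>i\<in>I. f i z * g i z) (at z) =
     (\<lambda>v. \<Sum>i\<in>I. f i z * frechet_derivative (g i) (at z) v + frechet_derivative (f i) (at z) v * g i z)"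
    using assms by (intro frechet_derivative_eqI has_derivative_sum has_derivative_mult) (auto simp: frechet_derivative_works)
  show "wirt \<gamma> (\<lambda>z. \<Sum>i\<in>I. f i z * g i z) z = (\<Sum>i\<in>I. wirt \<gamma> (f i) z * g i z + f i z * wirt \<gamma> (g i) z)"
    unfolding wirt_def d sum_distrib_left sum_subtractf[symmetric] sum_divide_distrib
    by (rule sum.cong) (simp_all add: field_simps)
  show "wirtbar \<gamma> (\<lambda>z. \<Sum>i\<in>I. f i z * g i z) z = (\<Sum>i\<in>I. wirtbar \<gamma> (f i) z * g i z + f i z * wirtbar \<gamma> (g i) z)"
    unfolding wirtbar_def d sum_distrib_left sum.distrib[symmetric] sum_divide_distrib
    by (rule sum.cong) (simp_all add: field_simps)
qed

lemma wirt_cnj: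
  assumes "F differentiable (at z)"
  shows "wirt \<gamma> (\<lambda>z. cnj (F z)) z = cnj (wirtbar \<gamma> F z)" "wirtbar \<gamma> (\<lambda>z. cnj (F z)) z = cnj (wirt \<gamma> F z)"
proof -
  have "frechet_derivative (\<lambda>z. cnj (F z)) (at z) = (\<lambda>v. cnj (frechet_derivative F (at z) v))"
    using assms bounded_linear.has_derivative[OF bounded_linear_cnj]
    by (intro frechet_derivative_eqI) (auto simp: frechet_derivative_works)
  then show "wirt \<gamma> (\<lambda>z. cnj (F z)) z = cnj (wirtbar \<gamma> F z)" "wirtbar \<gamma> (\<lambda>z. cnj (F z)) z = cnj (wirt \<gamma> F z)"
    by (simp_all add: wirt_def wirtbar_def)
qed

lemma frechet_derivative_lincomb:
  fixes f g :: "'a::real_normed_vector \<Rightarrow> complex"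
  assumes "f differentiable (at z)" "g differentiable (at z)"
  shows "frechet_derivative (\<lambda>z. (f z + c * g z) / 2) (at z) v
    = (frechet_derivative f (at z) v + c * frechet_derivative g (at z) v) / 2"
    "frechet_derivative (\<lambda>z. (f z - c * g z) / 2) (at z) v
    = (frechet_derivative f (at z) v - c * frechet_derivative g (at z) v) / 2"
proof -
  note f = assms(1)[unfolded frechet_derivative_works] and g = assms(2)[unfolded frechet_derivative_works]
  have "((\<lambda>z. (f z + c * g z) / 2) has_derivative
      (\<lambda>v. (frechet_derivative f (at z) v + c * frechet_derivative g (at z) v) / 2)) (at z)"
    by (intro bounded_linear.has_derivative[OF bounded_linear_divide] has_derivative_add has_derivative_mult_right f g)
  then show "frechet_derivative (\<lambda>z. (f z + c * g z) / 2) (at z) v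
    = (frechet_derivative f (at z) v + c * frechet_derivative g (at z) v) / 2"
    by (simp add: frechet_derivative_eqI)
  have "((\<lambda>z. (f z - c * g z) / 2) has_derivative
      (\<lambda>v. (frechet_derivative f (at z) v - c * frechet_derivative g (at z) v) / 2)) (at z)"
    by (intro bounded_linear.has_derivative[OF bounded_linear_divide] has_derivative_diff has_derivative_mult_right f g)
  then show "frechet_derivative (\<lambda>z. (f z - c * g z) / 2) (at z) v
    = (frechet_derivative f (at z) v - c * frechet_derivative g (at z) v) / 2"
    by (simp add: frechet_derivative_eqI)
qed

lemma wirt_commute:
  assumes "open S" "z \<in> S" "smooth_on S F"
  shows "wirt \<gamma> (wirtbar \<delta> F) z = wirtbar \<delta> (wirt \<gamma> F) z" "wirt \<gamma> (wirt \<delta> F) z = wirt \<delta> (wirt \<gamma> F) z"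
proof -
  have d: "(\<lambda>y. frechet_derivative F (at y) v) differentiable (at z)" for v
    using smooth_on_differentiable[OF smooth_on_derivative[OF assms(3)] assms(2)] .
  note s = second_derivative_symmetric[OF assms]
  show "wirt \<gamma> (wirtbar \<delta> F) z = wirtbar \<delta> (wirt \<gamma> F) z"
    unfolding wirt_def[abs_def] wirtbar_def[abs_def] frechet_derivative_lincomb[OF d d]
    using s[of "axis \<gamma> 1" "axis \<delta> 1"] s[of "axis \<gamma> 1" "axis \<delta> \<i>"] s[of "axis \<gamma> \<i>" "axis \<delta> 1"] s[of "axis \<gamma> \<i>" "axis \<delta> \<i>"]
    by (simp add: field_simps)
  show "wirt \<gamma> (wirt \<delta> F) z = wirt \<delta> (wirt \<gamma> F) z"
    unfolding wirt_def[abs_def] frechet_derivative_lincomb[OF d d]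
    using s[of "axis \<gamma> 1" "axis \<delta> 1"] s[of "axis \<gamma> 1" "axis \<delta> \<i>"] s[of "axis \<gamma> \<i>" "axis \<delta> 1"] s[of "axis \<gamma> \<i>" "axis \<delta> \<i>"]
    by (simp add: field_simps)
qed

context holomorphic_chart
begin

lemma d_z_chart_fun:
  assumes "open W" "W \<subseteq> U" "q \<in> W" "smooth_on (\<phi> ` W) F" "\<And>q. q \<in> W \<Longrightarrow> f q = F (\<phi> q)"
  shows "d_z A U \<phi> \<gamma> q f = wirt \<gamma> F (\<phi> q)" "d_zbar A U \<phi> \<gamma> q f = wirtbar \<gamma> F (\<phi> q)"
proof -
  have "rv q X f = frechet_derivative F (at (\<phi> q)) X" for X
    by (rule rv_chart_fun[OF assms])
  then show "d_z A U \<phi> \<gamma> q f = wirt \<gamma> F (\<phi> q)" "d_zbar A U \<phi> \<gamma> q f = wirtbar \<gamma> F (\<phi> q)"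
    by (simp_all add: d_z_def d_zbar_def d_x_eq wirt_def wirtbar_def)
qed

end

section \<open>The metric in a chart\<close>

context chern_chart
begin

definition "Hm \<alpha> \<beta> z = h_coeff A U \<phi> h (\<Phi> z) $ \<alpha> $ \<beta>"

lemma h_coeff_eq: "q \<in> U \<Longrightarrow> h_coeff A U \<phi> h q $ \<alpha> $ \<beta> = Hm \<alpha> \<beta> (\<phi> q)"
  by (simp add: Hm_def)

lemmas hermitian_unfolded = hermitian[unfolded hermitian_metric_def]

lemma hv_T10: "q \<in> U \<Longrightarrow> hv q X \<in> T10 A q"
  by (simp add: T10_eq)

lemma h_linear:
  assumes "q \<in> U"
  shows "h q (hv q (c *s X + Y)) (hv q Z) = c * h q (hv q X) (hv q Z) + h q (hv q Y) (hv q Z)"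
  unfolding hv_add hv_scale
  by (rule conjunct1[OF hermitian_unfolded, rule_format, OF hv_T10[OF assms] hv_T10[OF assms] hv_T10[OF assms]])

lemma h_cnj:
  assumes "q \<in> U"
  shows "h q (hv q Y) (hv q X) = cnj (h q (hv q X) (hv q Y))"
  by (rule conjunct1[OF conjunct2[OF hermitian_unfolded], rule_format, OF hv_T10[OF assms] hv_T10[OF assms]])

lemma h_pos:
  assumes "q \<in> U" "X \<noteq> 0"
  shows "Re (h q (hv q X) (hv q X)) > 0"
proof (rule conjunct1[OF conjunct2[OF conjunct2[OF hermitian_unfolded]], rule_format, OF hv_T10[OF assms(1)]])
  show "hv q X \<noteq> (\<lambda>f. 0)"
    using hv_inject[OF assms(1), of X 0] assms(2) by (simp add: hv_zero)
qed

lemma h_zero: "q \<in> U \<Longrightarrow> h q (hv q 0) (hv q Z) = 0"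
  using h_linear[of q 1 0 0 Z] by simp

lemma h_lincomb:
  assumes "q \<in> U" "finite I"
  shows "h q (hv q (\<Sum>i\<in>I. c i *s X i)) (hv q Z) = (\<Sum>i\<in>I. c i * h q (hv q (X i)) (hv q Z))"
  using assms(2) by (induction I rule: finite_induct) (simp_all add: h_zero[OF assms(1)] h_linear[OF assms(1)])

lemma vec_axis_expansion: "(X :: complex^'n) = (\<Sum>\<alpha>\<in>UNIV. X $ \<alpha> *s axis \<alpha> 1)"
  by (simp add: vec_eq_iff axis_def if_distrib cong: if_cong)

lemma h_hv:
  assumes "q \<in> U"
  shows "h q (hv q X) (hv q Y) = (\<Sum>\<alpha>\<in>UNIV. \<Sum>\<beta>\<in>UNIV. X $ \<alpha> * cnj (Y $ \<beta>) * Hm \<alpha> \<beta> (\<phi> q))"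
proof -
  have left: "h q (hv q X) (hv q Z) = (\<Sum>\<alpha>\<in>UNIV. X $ \<alpha> * h q (hv q (axis \<alpha> 1)) (hv q Z))" for X Z
    using h_lincomb[OF assms finite_class.finite_UNIV, of "\<lambda>\<alpha>. X $ \<alpha>" "\<lambda>\<alpha>. axis \<alpha> 1" Z] vec_axis_expansion[of X]
    by simp
  have right: "h q (hv q Z) (hv q Y) = (\<Sum>\<beta>\<in>UNIV. cnj (Y $ \<beta>) * h q (hv q Z) (hv q (axis \<beta> 1)))" for Z
  proof -
    have "h q (hv q Z) (hv q Y) = cnj (\<Sum>\<alpha>\<in>UNIV. Y $ \<alpha> * h q (hv q (axis \<alpha> 1)) (hv q Z))"
      unfolding h_cnj[OF assms, of Z Y] left[of Y Z] ..
    also have "\<dots> = (\<Sum>\<beta>\<in>UNIV. cnj (Y $ \<beta>) * h q (hv q Z) (hv q (axis \<beta> 1)))"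
      by (simp add: h_cnj[OF assms, of Z])
    finally show ?thesis .
  qed
  show ?thesis
    unfolding left[of X Y] unfolding right
    using assms by (simp add: h_coeff_eq[symmetric] h_coeff_def d_z_hv sum_distrib_left algebra_simps)
qed

lemma Hm_hermitian: "z \<in> \<phi> ` U \<Longrightarrow> Hm \<beta> \<alpha> z = cnj (Hm \<alpha> \<beta> z)"
  using h_cnj[of "\<Phi> z" "axis \<beta> 1" "axis \<alpha> 1"] by (auto simp: Hm_def h_coeff_def d_z_hv)

lemma smooth_Hm: "smooth_on (\<phi> ` U) (Hm \<alpha> \<beta>)"
proof -
  have "smooth_fun A U (\<lambda>q. h q (d_z A U \<phi> \<alpha> q) (d_z A U \<phi> \<beta> q))"
    by (rule conjunct2[OF conjunct2[OF conjunct2[OF hermitian_unfolded]], rule_format, OF open_U smooth_section_d_z smooth_section_d_z])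
  moreover have "h q (d_z A U \<phi> \<alpha> q) (d_z A U \<phi> \<beta> q) = Hm \<alpha> \<beta> (\<phi> q)" if "q \<in> U" for q
    using that by (simp add: Hm_def h_coeff_def)
  ultimately show ?thesis
    using smooth_fun_chart_iff[OF open_U order_refl, of "\<lambda>q. h q (d_z A U \<phi> \<alpha> q) (d_z A U \<phi> \<beta> q)" "Hm \<alpha> \<beta>"]
    by simp
qed

lemma h_inv:
  assumes "q \<in> U"
  shows "h_coeff A U \<phi> h q ** h_inv A U \<phi> h q = mat 1" "h_inv A U \<phi> h q ** h_coeff A U \<phi> h q = mat 1"
proof -
  let ?H = "h_coeff A U \<phi> h q"
  have "x = 0" if x: "?H *v x = 0" for x
  proof (rule ccontr)
    assume "x \<noteq> 0"
    \<comment> \<open>The metric conjugates its second argument, so conjugating the kernel vector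
      turns h(X, X) into a contraction with \<open>?H *v x\<close>, which is zero and contradicts
      positivity.\<close>
    define X where "X = (\<chi> \<alpha>. cnj (x $ \<alpha>))"
    have "X \<noteq> 0" using \<open>x \<noteq> 0\<close> by (auto simp: X_def vec_eq_iff)
    then have "Re (h q (hv q X) (hv q X)) > 0" by (rule h_pos[OF assms])
    moreover have "h q (hv q X) (hv q X) = (\<Sum>\<alpha>\<in>UNIV. X $ \<alpha> * (?H *v x) $ \<alpha>)"
      unfolding h_hv[OF assms] matrix_vector_mult_def
      by (simp add: X_def h_coeff_eq[OF assms] sum_distrib_left algebra_simps)
    ultimately show False using x by simp
  qed
  then obtain B where "B ** ?H = mat 1"
    using matrix_left_invertible_ker[of ?H] by auto
  then have "\<exists>B. ?H ** B = mat 1 \<and> B ** ?H = mat 1"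
    using matrix_left_right_inverse by blast
  then have "?H ** matrix_inv ?H = mat 1 \<and> matrix_inv ?H ** ?H = mat 1"
    unfolding matrix_inv_def by (rule someI_ex)
  then show "?H ** h_inv A U \<phi> h q = mat 1" "h_inv A U \<phi> h q ** ?H = mat 1"
    by (simp_all add: h_inv_def)
qed

lemma h_inv_sum:
  assumes "q \<in> U"
  shows "(\<Sum>\<mu>\<in>UNIV. Hm \<alpha> \<mu> (\<phi> q) * h_inv A U \<phi> h q $ \<mu> $ \<kappa>) = (if \<alpha> = \<kappa> then 1 else 0)"
    "(\<Sum>\<mu>\<in>UNIV. h_inv A U \<phi> h q $ \<alpha> $ \<mu> * Hm \<mu> \<kappa> (\<phi> q)) = (if \<alpha> = \<kappa> then 1 else 0)"
  using h_inv[OF assms] by (simp_all add: vec_eq_iff matrix_matrix_mult_def mat_def h_coeff_eq[OF assms])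

text \<open>Identities for the Christoffel symbols arise contracted with the metric; this solves
  them for the individual symbols.\<close>

lemma Hm_right_cancel:
  assumes "q \<in> U" "\<And>\<beta>. (\<Sum>\<mu>\<in>UNIV. x \<mu> * Hm \<mu> \<beta> (\<phi> q)) = y \<beta>"
  shows "x \<kappa> = (\<Sum>\<beta>\<in>UNIV. y \<beta> * h_inv A U \<phi> h q $ \<beta> $ \<kappa>)"
proof -
  have "(\<Sum>\<beta>\<in>UNIV. y \<beta> * h_inv A U \<phi> h q $ \<beta> $ \<kappa>)
      = (\<Sum>\<beta>\<in>UNIV. \<Sum>\<mu>\<in>UNIV. x \<mu> * (Hm \<mu> \<beta> (\<phi> q) * h_inv A U \<phi> h q $ \<beta> $ \<kappa>))"
    unfolding assms(2)[symmetric] sum_distrib_right by (simp add: mult.assoc)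
  also have "\<dots> = (\<Sum>\<mu>\<in>UNIV. x \<mu> * (\<Sum>\<beta>\<in>UNIV. Hm \<mu> \<beta> (\<phi> q) * h_inv A U \<phi> h q $ \<beta> $ \<kappa>))"
    by (subst sum.swap) (simp add: sum_distrib_left)
  also have "\<dots> = x \<kappa>"
    unfolding h_inv_sum[OF assms(1)] by (simp add: if_distrib[of "\<lambda>t. _ * t"] cong: if_cong)
  finally show ?thesis by simp
qed

text \<open>Metric compatibility for the coordinate frame and the real field with constant
  components \<open>X\<close>. The second sum comes from the conjugate linear slot and is therefore
  antilinear in \<open>X\<close>.\<close>

lemma Hm_metric:
  assumes "q \<in> U"
  shows "frechet_derivative (Hm \<alpha> \<beta>) (at (\<phi> q)) X =
      (\<Sum>\<kappa>\<in>UNIV. (\<Sum>\<gamma>\<in>UNIV. X $ \<gamma> * Gam \<gamma> \<alpha> \<kappa> (\<phi> q)) * Hm \<kappa> \<beta> (\<phi> q))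
    + (\<Sum>\<kappa>\<in>UNIV. cnj (\<Sum>\<gamma>\<in>UNIV. X $ \<gamma> * Gam \<gamma> \<beta> \<kappa> (\<phi> q)) * Hm \<alpha> \<kappa> (\<phi> q))"
proof -
  let ?v = "\<lambda>q. rv q X"
  have v: "smooth_section A (tangent A) U ?v"
    by (rule smooth_section_rvI[OF open_U order_refl, where X="\<lambda>z. X"]) simp_all
  have D: "D ?v (d_z A U \<phi> \<alpha>) q = hv q (\<chi> \<kappa>. \<Sum>\<gamma>\<in>UNIV. X $ \<gamma> * Gam \<gamma> \<alpha> \<kappa> (\<phi> q))" for \<alpha>
  proof -
    have "D ?v (d_z A U \<phi> \<alpha>) q = (\<lambda>f. \<Sum>\<gamma>\<in>UNIV. X $ \<gamma> * hv q (\<chi> \<kappa>. Gam \<gamma> \<alpha> \<kappa> (\<phi> q)) f)"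
      by (rule D_rv_d_z[OF open_U order_refl, where X="\<lambda>z. X"]) (use assms in simp_all)
    also have "\<dots> = hv q (\<Sum>\<gamma>\<in>UNIV. X $ \<gamma> *s (\<chi> \<kappa>. Gam \<gamma> \<alpha> \<kappa> (\<phi> q)))"
      by (simp add: hv_sum hv_scale)
    also have "(\<Sum>\<gamma>\<in>UNIV. X $ \<gamma> *s (\<chi> \<kappa>. Gam \<gamma> \<alpha> \<kappa> (\<phi> q))) = (\<chi> \<kappa>. \<Sum>\<gamma>\<in>UNIV. X $ \<gamma> * Gam \<gamma> \<alpha> \<kappa> (\<phi> q))"
      by (simp add: vec_eq_iff)
    finally show ?thesis .
  qed
  have "?v q (\<lambda>r. h r (d_z A U \<phi> \<alpha> r) (d_z A U \<phi> \<beta> r)) = h q (D ?v (d_z A U \<phi> \<alpha>) q) (d_z A U \<phi> \<beta> q)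
      + h q (d_z A U \<phi> \<alpha> q) (D ?v (d_z A U \<phi> \<beta>) q)"
    using chern open_U v smooth_section_d_z assms unfolding chern_connection_def metric_compatible_def by blast
  moreover have "?v q (\<lambda>r. h r (d_z A U \<phi> \<alpha> r) (d_z A U \<phi> \<beta> r)) = frechet_derivative (Hm \<alpha> \<beta>) (at (\<phi> q)) X"
    by (rule rv_chart_fun[OF open_U order_refl assms smooth_Hm]) (simp add: Hm_def h_coeff_def)
  moreover have "(\<Sum>\<alpha>'\<in>UNIV. \<Sum>\<beta>'\<in>UNIV. axis \<alpha> 1 $ \<alpha>' * c \<beta>' * Hm \<alpha>' \<beta>' (\<phi> q)) = (\<Sum>\<kappa>\<in>UNIV. c \<kappa> * Hm \<alpha> \<kappa> (\<phi> q))" for c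
    by (subst sum.remove[of _ \<alpha>]) (auto simp: axis_def intro!: sum.neutral)
  moreover have "(\<Sum>\<alpha>'\<in>UNIV. \<Sum>\<beta>'\<in>UNIV. c \<alpha>' * cnj (axis \<beta> 1 $ \<beta>') * Hm \<alpha>' \<beta>' (\<phi> q)) = (\<Sum>\<kappa>\<in>UNIV. c \<kappa> * Hm \<kappa> \<beta> (\<phi> q))" for c
    by (subst sum.swap, subst sum.remove[of _ \<beta>]) (auto simp: axis_def intro!: sum.neutral)
  ultimately show ?thesis
    unfolding D d_z_hv h_hv[OF assms] by simp
qed

text \<open>In the Wirtinger combination of the directions e and i e the linear term of
  \<open>Hm_metric\<close> doubles and the antilinear one cancels; the division by 2 leaves exactly
  the linear term.\<close>

lemma wirt_Hm:
  assumes "q \<in> U"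
  shows "wirt \<gamma> (Hm \<alpha> \<beta>) (\<phi> q) = (\<Sum>\<kappa>\<in>UNIV. Gam \<gamma> \<alpha> \<kappa> (\<phi> q) * Hm \<kappa> \<beta> (\<phi> q))"
proof -
  have e: "(\<Sum>\<gamma>'\<in>UNIV. axis \<gamma> c $ \<gamma>' * Gam \<gamma>' \<alpha> \<kappa> (\<phi> q)) = c * Gam \<gamma> \<alpha> \<kappa> (\<phi> q)" for c \<alpha> \<kappa>
    by (subst sum.remove[of _ \<gamma>]) (auto simp: axis_def intro!: sum.neutral)
  show ?thesis
    unfolding wirt_def Hm_metric[OF assms] e
    by (simp add: sum_distrib_left sum_subtractf[symmetric] sum_negf sum.distrib[symmetric] algebra_simps)
qed

end

section \<open>Curvature of the Chern connection in a chart\<close>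

lemma sum_rotate4:
  "(\<Sum>i\<in>I. \<Sum>j\<in>M. \<Sum>k\<in>K. \<Sum>l\<in>L. f i j k l) = (\<Sum>j\<in>M. \<Sum>k\<in>K. \<Sum>l\<in>L. \<Sum>i\<in>I. f i j k l)"
  by (simp add: sum.swap[of _ _ I])

context chern_chart
begin

text \<open>This symmetry is the vanishing of the \<open>(2,0)\<close>-part of the curvature: multiplied by \<open>H\<close>, both sides
  are second derivatives of \<open>H\<close>.\<close>

lemma Gam_20:
  assumes "q \<in> U"
  shows "wirt \<delta> (Gam \<gamma> \<alpha> \<kappa>) (\<phi> q) + (\<Sum>\<mu>\<in>UNIV. Gam \<gamma> \<alpha> \<mu> (\<phi> q) * Gam \<delta> \<mu> \<kappa> (\<phi> q))
    = wirt \<gamma> (Gam \<delta> \<alpha> \<kappa>) (\<phi> q) + (\<Sum>\<mu>\<in>UNIV. Gam \<delta> \<alpha> \<mu> (\<phi> q) * Gam \<gamma> \<mu> \<kappa> (\<phi> q))"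
proof -
  have z: "\<phi> q \<in> \<phi> ` U" using assms by auto
  define x where "x \<delta> \<gamma> \<kappa> = wirt \<delta> (Gam \<gamma> \<alpha> \<kappa>) (\<phi> q) + (\<Sum>\<mu>\<in>UNIV. Gam \<gamma> \<alpha> \<mu> (\<phi> q) * Gam \<delta> \<mu> \<kappa> (\<phi> q))" for \<delta> \<gamma> \<kappa>
  have H: "(\<Sum>\<kappa>\<in>UNIV. x \<delta> \<gamma> \<kappa> * Hm \<kappa> \<beta> (\<phi> q)) = wirt \<delta> (wirt \<gamma> (Hm \<alpha> \<beta>)) (\<phi> q)" for \<delta> \<gamma> \<beta>
  proof -
    have "wirt \<delta> (wirt \<gamma> (Hm \<alpha> \<beta>)) (\<phi> q) = wirt \<delta> (\<lambda>z. \<Sum>\<kappa>\<in>UNIV. Gam \<gamma> \<alpha> \<kappa> z * Hm \<kappa> \<beta> z) (\<phi> q)"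
      by (rule wirt_cong[OF open_range z]) (auto simp: wirt_Hm)
    also have "\<dots> = (\<Sum>\<kappa>\<in>UNIV. wirt \<delta> (Gam \<gamma> \<alpha> \<kappa>) (\<phi> q) * Hm \<kappa> \<beta> (\<phi> q)
        + Gam \<gamma> \<alpha> \<kappa> (\<phi> q) * (\<Sum>\<mu>\<in>UNIV. Gam \<delta> \<kappa> \<mu> (\<phi> q) * Hm \<mu> \<beta> (\<phi> q)))"
      by (subst wirt_sum_mult) (auto intro: smooth_on_differentiable[OF _ z] D_d_z(1) smooth_Hm simp: wirt_Hm[OF assms])
    also have "\<dots> = (\<Sum>\<kappa>\<in>UNIV. x \<delta> \<gamma> \<kappa> * Hm \<kappa> \<beta> (\<phi> q))"
      unfolding x_def distrib_right sum.distrib sum_distrib_left sum_distrib_right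
      by (subst (2) sum.swap) (simp add: mult.assoc)
    finally show ?thesis by simp
  qed
  have "x \<delta> \<gamma> \<kappa> = (\<Sum>\<beta>\<in>UNIV. wirt \<delta> (wirt \<gamma> (Hm \<alpha> \<beta>)) (\<phi> q) * h_inv A U \<phi> h q $ \<beta> $ \<kappa>)" for \<delta> \<gamma>
    by (rule Hm_right_cancel[OF assms H])
  then have "x \<delta> \<gamma> \<kappa> = x \<gamma> \<delta> \<kappa>"
    using wirt_commute(2)[OF open_range z smooth_Hm, of \<delta> \<gamma> \<alpha>] by simp
  then show ?thesis by (simp add: x_def)
qed

lemma chern_curv_eq:
  assumes "q \<in> U"
  shows "chern_curv A U \<phi> h q \<alpha> \<beta> \<gamma> \<delta> = - wirt \<gamma> (wirtbar \<delta> (Hm \<alpha> \<beta>)) (\<phi> q)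
    + (\<Sum>\<mu>\<in>UNIV. \<Sum>\<kappa>\<in>UNIV. wirt \<gamma> (Hm \<alpha> \<mu>) (\<phi> q) * h_inv A U \<phi> h q $ \<mu> $ \<kappa> * wirtbar \<delta> (Hm \<kappa> \<beta>) (\<phi> q))"
proof -
  have d: "d_z A U \<phi> \<gamma> r (\<lambda>q. h_coeff A U \<phi> h q $ \<alpha> $ \<beta>) = wirt \<gamma> (Hm \<alpha> \<beta>) (\<phi> r)"
    "d_zbar A U \<phi> \<gamma> r (\<lambda>q. h_coeff A U \<phi> h q $ \<alpha> $ \<beta>) = wirtbar \<gamma> (Hm \<alpha> \<beta>) (\<phi> r)" if "r \<in> U" for r \<gamma> \<alpha> \<beta>
    using that by (intro d_z_chart_fun[OF open_U order_refl _ smooth_Hm] h_coeff_eq; simp)+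
  have "d_z A U \<phi> \<gamma> q (\<lambda>q. d_zbar A U \<phi> \<delta> q (\<lambda>r. h_coeff A U \<phi> h r $ \<alpha> $ \<beta>)) = wirt \<gamma> (wirtbar \<delta> (Hm \<alpha> \<beta>)) (\<phi> q)"
    by (rule d_z_chart_fun(1)[OF open_U order_refl assms smooth_on_wirt(2)[OF open_range smooth_Hm] d(2)])
  then show ?thesis
    by (simp add: chern_curv_def d[OF assms])
qed

text \<open>The conjugate derivative of \<open>wirt_Hm\<close> gives the mixed second derivative of
  the metric. Its product term, after substituting
  \<open>\<Gamma> = \<partial>H H\<^sup>-\<^sup>1\<close>, is exactly the quadratic term in
  \<open>chern_curv\<close>.\<close>

lemma Gam_11:
  assumes "q \<in> U"
  shows "(\<Sum>\<kappa>\<in>UNIV. wirtbar \<delta> (Gam \<gamma> \<alpha> \<kappa>) (\<phi> q) * Hm \<kappa> \<beta> (\<phi> q)) = - chern_curv A U \<phi> h q \<alpha> \<beta> \<gamma> \<delta>"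
proof -
  have z: "\<phi> q \<in> \<phi> ` U" using assms by auto
  have "wirt \<gamma> (wirtbar \<delta> (Hm \<alpha> \<beta>)) (\<phi> q) = wirtbar \<delta> (wirt \<gamma> (Hm \<alpha> \<beta>)) (\<phi> q)"
    by (rule wirt_commute(1)[OF open_range z smooth_Hm])
  also have "\<dots> = wirtbar \<delta> (\<lambda>z. \<Sum>\<kappa>\<in>UNIV. Gam \<gamma> \<alpha> \<kappa> z * Hm \<kappa> \<beta> z) (\<phi> q)"
    by (rule wirt_cong[OF open_range z]) (auto simp: wirt_Hm)
  also have "\<dots> = (\<Sum>\<kappa>\<in>UNIV. wirtbar \<delta> (Gam \<gamma> \<alpha> \<kappa>) (\<phi> q) * Hm \<kappa> \<beta> (\<phi> q)
      + Gam \<gamma> \<alpha> \<kappa> (\<phi> q) * wirtbar \<delta> (Hm \<kappa> \<beta>) (\<phi> q))"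
    by (subst wirt_sum_mult) (auto intro: smooth_on_differentiable[OF _ z] D_d_z(1) smooth_Hm)
  finally have 1: "wirt \<gamma> (wirtbar \<delta> (Hm \<alpha> \<beta>)) (\<phi> q) = (\<Sum>\<kappa>\<in>UNIV. wirtbar \<delta> (Gam \<gamma> \<alpha> \<kappa>) (\<phi> q) * Hm \<kappa> \<beta> (\<phi> q))
      + (\<Sum>\<kappa>\<in>UNIV. Gam \<gamma> \<alpha> \<kappa> (\<phi> q) * wirtbar \<delta> (Hm \<kappa> \<beta>) (\<phi> q))"
    by (simp add: sum.distrib)
  have G: "Gam \<gamma> \<alpha> \<kappa> (\<phi> q) = (\<Sum>\<mu>\<in>UNIV. wirt \<gamma> (Hm \<alpha> \<mu>) (\<phi> q) * h_inv A U \<phi> h q $ \<mu> $ \<kappa>)" for \<kappa>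
    by (rule Hm_right_cancel[OF assms]) (simp add: wirt_Hm[OF assms])
  have "(\<Sum>\<mu>\<in>UNIV. \<Sum>\<kappa>\<in>UNIV. wirt \<gamma> (Hm \<alpha> \<mu>) (\<phi> q) * h_inv A U \<phi> h q $ \<mu> $ \<kappa> * wirtbar \<delta> (Hm \<kappa> \<beta>) (\<phi> q))
     = (\<Sum>\<kappa>\<in>UNIV. Gam \<gamma> \<alpha> \<kappa> (\<phi> q) * wirtbar \<delta> (Hm \<kappa> \<beta>) (\<phi> q))"
    unfolding G by (subst sum.swap) (simp add: sum_distrib_right)
  then show ?thesis
    unfolding chern_curv_eq[OF assms] 1 by simp
qed

section \<open>The curvature operator on components\<close>

lemma linear_G: "linear (\<lambda>X. G z X Y)" "linear (G z X)"
  by (auto intro!: linearI simp: G_def vec_eq_iff sum.distrib scaleR_sum_right algebra_simps)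

lemma smooth_G:
  assumes "open S" "S \<subseteq> \<phi> ` U" "smooth_on S X" "smooth_on S Y"
  shows "smooth_on S (\<lambda>z. G z (X z) (Y z))"
proof (rule smooth_on_vec[OF assms(1)])
  fix \<kappa>
  have "smooth_on S (\<lambda>z. \<Sum>\<gamma>\<in>UNIV. \<Sum>\<alpha>\<in>UNIV. X z $ \<gamma> * Y z $ \<alpha> * Gam \<gamma> \<alpha> \<kappa> z)"
    by (intro smooth_on_sum[OF assms(1)] smooth_on_mult[OF assms(1)] smooth_on_nth[OF assms(1)]
        smooth_on_subset[OF D_d_z(1) assms(2)] assms(3,4))
  then show "smooth_on S (\<lambda>z. G z (X z) (Y z) $ \<kappa>)" by (simp add: G_def)
qed

text \<open>The curvature form of the connection form \<open>G\<close> (its exterior derivative plus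
  its wedge square), evaluated on the constant fields \<open>X\<close>, \<open>Y\<close> and the
  section with components \<open>a\<close>.\<close>

definition curv_op :: "complex^'n \<Rightarrow> complex^'n \<Rightarrow> complex^'n \<Rightarrow> complex^'n \<Rightarrow> complex^'n" where
  "curv_op z X Y a = frechet_derivative (\<lambda>y. G y Y a) (at z) X - frechet_derivative (\<lambda>y. G y X a) (at z) Y
     + G z X (G z Y a) - G z Y (G z X a)"

lemma curv_op_nth:
  assumes "q \<in> U"
  shows "curv_op (\<phi> q) X Y a $ \<kappa> = (\<Sum>\<alpha>\<in>UNIV. \<Sum>\<gamma>\<in>UNIV. \<Sum>\<delta>\<in>UNIV.
    (cnj (X $ \<delta>) * Y $ \<gamma> - cnj (Y $ \<delta>) * X $ \<gamma>) * a $ \<alpha> * wirtbar \<delta> (Gam \<gamma> \<alpha> \<kappa>) (\<phi> q))"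
proof -
  have z: "\<phi> q \<in> \<phi> ` U" using assms by auto
  have Gd: "Gam \<gamma> \<alpha> \<kappa> differentiable (at (\<phi> q))" for \<gamma> \<alpha> \<kappa>
    by (rule smooth_on_differentiable[OF D_d_z(1) z])
  \<comment> \<open>The full coefficient of the complex bilinear part in \<open>X\<close> and
    \<open>Y\<close>. It is symmetric in \<open>\<delta>\<close> and \<open>\<gamma>\<close>, so
    antisymmetrizing in \<open>X\<close> and \<open>Y\<close> removes it and leaves the conjugate
    derivatives.\<close>
  define S where "S \<delta> \<gamma> \<alpha> = wirt \<delta> (Gam \<gamma> \<alpha> \<kappa>) (\<phi> q) + (\<Sum>\<mu>\<in>UNIV. Gam \<gamma> \<alpha> \<mu> (\<phi> q) * Gam \<delta> \<mu> \<kappa> (\<phi> q))" for \<delta> \<gamma> \<alpha>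
  have S: "S \<delta> \<gamma> \<alpha> = S \<gamma> \<delta> \<alpha>" for \<delta> \<gamma> \<alpha>
    unfolding S_def by (rule Gam_20[OF assms])
  have half: "frechet_derivative (\<lambda>y. G y Y a) (at (\<phi> q)) X $ \<kappa> + G (\<phi> q) X (G (\<phi> q) Y a) $ \<kappa>
     = (\<Sum>\<alpha>\<in>UNIV. \<Sum>\<gamma>\<in>UNIV. \<Sum>\<delta>\<in>UNIV. X $ \<delta> * Y $ \<gamma> * a $ \<alpha> * S \<delta> \<gamma> \<alpha>)
     + (\<Sum>\<alpha>\<in>UNIV. \<Sum>\<gamma>\<in>UNIV. \<Sum>\<delta>\<in>UNIV. cnj (X $ \<delta>) * Y $ \<gamma> * a $ \<alpha> * wirtbar \<delta> (Gam \<gamma> \<alpha> \<kappa>) (\<phi> q))" for X Y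
  proof -
    have sG: "smooth_on (\<phi> ` U) (\<lambda>y. G y Y a)"
      by (rule smooth_G[OF open_range order_refl smooth_on_const smooth_on_const])
    have "frechet_derivative (\<lambda>y. G y Y a) (at (\<phi> q)) X $ \<kappa> = frechet_derivative (\<lambda>y. G y Y a $ \<kappa>) (at (\<phi> q)) X"
      using frechet_derivative_eqI[OF bounded_linear.has_derivative[OF bounded_linear_vec_nth
            smooth_on_has_derivative[OF sG z], of \<kappa>]] by simp
    also have "(\<lambda>y. G y Y a $ \<kappa>) = (\<lambda>y. \<Sum>\<gamma>\<in>UNIV. \<Sum>\<alpha>\<in>UNIV. Y $ \<gamma> * a $ \<alpha> * Gam \<gamma> \<alpha> \<kappa> y)"
      by (simp add: G_def)
    also have "frechet_derivative \<dots> (at (\<phi> q)) X = (\<Sum>\<gamma>\<in>UNIV. \<Sum>\<alpha>\<in>UNIV. Y $ \<gamma> * a $ \<alpha> * frechet_derivative (Gam \<gamma> \<alpha> \<kappa>) (at (\<phi> q)) X)"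
      by (subst frechet_derivative_eqI[OF has_derivative_sum[OF has_derivative_sum[OF
                has_derivative_mult_right[OF Gd[unfolded frechet_derivative_works]]]]]) simp
    also have "\<dots> = (\<Sum>\<alpha>\<in>UNIV. \<Sum>\<gamma>\<in>UNIV. \<Sum>\<delta>\<in>UNIV. X $ \<delta> * Y $ \<gamma> * a $ \<alpha> * wirt \<delta> (Gam \<gamma> \<alpha> \<kappa>) (\<phi> q))
      + (\<Sum>\<alpha>\<in>UNIV. \<Sum>\<gamma>\<in>UNIV. \<Sum>\<delta>\<in>UNIV. cnj (X $ \<delta>) * Y $ \<gamma> * a $ \<alpha> * wirtbar \<delta> (Gam \<gamma> \<alpha> \<kappa>) (\<phi> q))"
      unfolding frechet_derivative_wirtinger[OF Gd]
      by (subst sum.swap) (simp add: sum_distrib_left sum.distrib algebra_simps)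
    finally have 1: "frechet_derivative (\<lambda>y. G y Y a) (at (\<phi> q)) X $ \<kappa> = \<dots>" .
    have "G (\<phi> q) X (G (\<phi> q) Y a) $ \<kappa> = (\<Sum>\<delta>\<in>UNIV. \<Sum>\<mu>\<in>UNIV. \<Sum>\<gamma>\<in>UNIV. \<Sum>\<alpha>\<in>UNIV.
        X $ \<delta> * Y $ \<gamma> * a $ \<alpha> * (Gam \<gamma> \<alpha> \<mu> (\<phi> q) * Gam \<delta> \<mu> \<kappa> (\<phi> q)))"
      by (simp add: G_def sum_distrib_left sum_distrib_right algebra_simps)
    also have "\<dots> = (\<Sum>\<mu>\<in>UNIV. \<Sum>\<gamma>\<in>UNIV. \<Sum>\<alpha>\<in>UNIV. \<Sum>\<delta>\<in>UNIV.
        X $ \<delta> * Y $ \<gamma> * a $ \<alpha> * (Gam \<gamma> \<alpha> \<mu> (\<phi> q) * Gam \<delta> \<mu> \<kappa> (\<phi> q)))"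
      by (rule sum_rotate4)
    also have "\<dots> = (\<Sum>\<gamma>\<in>UNIV. \<Sum>\<alpha>\<in>UNIV. \<Sum>\<delta>\<in>UNIV. \<Sum>\<mu>\<in>UNIV.
        X $ \<delta> * Y $ \<gamma> * a $ \<alpha> * (Gam \<gamma> \<alpha> \<mu> (\<phi> q) * Gam \<delta> \<mu> \<kappa> (\<phi> q)))"
      by (rule sum_rotate4)
    also have "\<dots> = (\<Sum>\<alpha>\<in>UNIV. \<Sum>\<gamma>\<in>UNIV. \<Sum>\<delta>\<in>UNIV. X $ \<delta> * Y $ \<gamma> * a $ \<alpha> *
       (\<Sum>\<mu>\<in>UNIV. Gam \<gamma> \<alpha> \<mu> (\<phi> q) * Gam \<delta> \<mu> \<kappa> (\<phi> q)))"
      by (subst sum.swap) (simp add: sum_distrib_left)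
    finally show ?thesis
      unfolding 1 S_def by (simp add: distrib_left sum.distrib)
  qed
  have sym: "(\<Sum>\<gamma>\<in>UNIV. \<Sum>\<delta>\<in>UNIV. Y $ \<delta> * X $ \<gamma> * a $ \<alpha> * S \<delta> \<gamma> \<alpha>)
      = (\<Sum>\<gamma>\<in>UNIV. \<Sum>\<delta>\<in>UNIV. X $ \<delta> * Y $ \<gamma> * a $ \<alpha> * S \<delta> \<gamma> \<alpha>)" for \<alpha>
    by (subst sum.swap) (simp add: S mult.commute)
  have "curv_op (\<phi> q) X Y a $ \<kappa> =
     (frechet_derivative (\<lambda>y. G y Y a) (at (\<phi> q)) X $ \<kappa> + G (\<phi> q) X (G (\<phi> q) Y a) $ \<kappa>)
     - (frechet_derivative (\<lambda>y. G y X a) (at (\<phi> q)) Y $ \<kappa> + G (\<phi> q) Y (G (\<phi> q) X a) $ \<kappa>)"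
    by (simp add: curv_op_def)
  also have "\<dots> = (\<Sum>\<alpha>\<in>UNIV. \<Sum>\<gamma>\<in>UNIV. \<Sum>\<delta>\<in>UNIV. cnj (X $ \<delta>) * Y $ \<gamma> * a $ \<alpha> * wirtbar \<delta> (Gam \<gamma> \<alpha> \<kappa>) (\<phi> q))
     - (\<Sum>\<alpha>\<in>UNIV. \<Sum>\<gamma>\<in>UNIV. \<Sum>\<delta>\<in>UNIV. cnj (Y $ \<delta>) * X $ \<gamma> * a $ \<alpha> * wirtbar \<delta> (Gam \<gamma> \<alpha> \<kappa>) (\<phi> q))"
    unfolding half sym by simp
  finally show ?thesis
    by (simp add: sum_subtractf left_diff_distrib)
qed

text \<open>Lowering the index with the metric makes \<open>Gam_11\<close> applicable. Its minus
  sign is absorbed by exchanging the two halves of the coefficient.\<close>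

lemma h_curv_op:
  assumes "q \<in> U"
  shows "h q (hv q (curv_op (\<phi> q) X Y a)) (hv q b) = (\<Sum>\<beta>\<in>UNIV. \<Sum>\<alpha>\<in>UNIV. \<Sum>\<gamma>\<in>UNIV. \<Sum>\<delta>\<in>UNIV.
     (X $ \<gamma> * cnj (Y $ \<delta>) - Y $ \<gamma> * cnj (X $ \<delta>)) * chern_curv A U \<phi> h q \<alpha> \<beta> \<gamma> \<delta> * a $ \<alpha> * cnj (b $ \<beta>))"
proof -
  let ?c = "\<lambda>\<gamma> \<delta>. cnj (X $ \<delta>) * Y $ \<gamma> - cnj (Y $ \<delta>) * X $ \<gamma>"
  have "h q (hv q (curv_op (\<phi> q) X Y a)) (hv q b) = (\<Sum>\<beta>\<in>UNIV. \<Sum>\<kappa>\<in>UNIV.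
      curv_op (\<phi> q) X Y a $ \<kappa> * cnj (b $ \<beta>) * Hm \<kappa> \<beta> (\<phi> q))"
    unfolding h_hv[OF assms] by (rule sum.swap)
  also have "\<dots> = (\<Sum>\<beta>\<in>UNIV. \<Sum>\<kappa>\<in>UNIV. \<Sum>\<alpha>\<in>UNIV. \<Sum>\<gamma>\<in>UNIV. \<Sum>\<delta>\<in>UNIV.
      ?c \<gamma> \<delta> * a $ \<alpha> * cnj (b $ \<beta>) * (wirtbar \<delta> (Gam \<gamma> \<alpha> \<kappa>) (\<phi> q) * Hm \<kappa> \<beta> (\<phi> q)))"
    unfolding curv_op_nth[OF assms] by (simp add: sum_distrib_right sum_distrib_left mult_ac)
  also have "\<dots> = (\<Sum>\<beta>\<in>UNIV. \<Sum>\<alpha>\<in>UNIV. \<Sum>\<gamma>\<in>UNIV. \<Sum>\<delta>\<in>UNIV. \<Sum>\<kappa>\<in>UNIV.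
      ?c \<gamma> \<delta> * a $ \<alpha> * cnj (b $ \<beta>) * (wirtbar \<delta> (Gam \<gamma> \<alpha> \<kappa>) (\<phi> q) * Hm \<kappa> \<beta> (\<phi> q)))"
    by (intro sum.cong refl sum_rotate4)
  also have "\<dots> = (\<Sum>\<beta>\<in>UNIV. \<Sum>\<alpha>\<in>UNIV. \<Sum>\<gamma>\<in>UNIV. \<Sum>\<delta>\<in>UNIV.
      ?c \<gamma> \<delta> * a $ \<alpha> * cnj (b $ \<beta>) * (- chern_curv A U \<phi> h q \<alpha> \<beta> \<gamma> \<delta>))"
    unfolding sum_distrib_left[symmetric] Gam_11[OF assms] ..
  finally show ?thesis by (simp add: algebra_simps)
qed

section \<open>The induced connection\<close>

abbreviation "IC \<equiv> induced_connection A D"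

text \<open>Passing to the (1,0)-part keeps the components, so transporting the connection back to
  real vectors only replaces \<open>hv\<close> by \<open>rv\<close>.\<close>

lemma induced_connection_rv:
  assumes W: "open W" "W \<subseteq> U" and X: "smooth_on (\<phi> ` W) X" and Y: "smooth_on (\<phi> ` W) Y"
    and v: "\<And>q. q \<in> W \<Longrightarrow> v q = rv q (X (\<phi> q))" and u: "\<And>q. q \<in> W \<Longrightarrow> u q = rv q (Y (\<phi> q))" and q: "q \<in> W"
  shows "IC v u q = rv q (frechet_derivative Y (at (\<phi> q)) (X (\<phi> q)) + G (\<phi> q) (X (\<phi> q)) (Y (\<phi> q)))"
proof -
  have qU: "q \<in> U" using q W by auto
  have "D v (\<lambda>q. part10 A q (u q)) q = hv q (frechet_derivative Y (at (\<phi> q)) (X (\<phi> q)) + G (\<phi> q) (X (\<phi> q)) (Y (\<phi> q)))"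
    by (rule D_rv_hv[OF W X Y v _ q]) (use u part10_rv W(2) in auto)
  moreover have "inj_on (part10 A q) (tangent A q)"
    unfolding tangent_eq[OF qU] inj_on_def by (auto simp: part10_rv[OF qU] hv_inject[OF qU])
  ultimately show ?thesis
    unfolding induced_connection_def
    by (intro the_inv_into_f_eq) (auto simp: part10_rv[OF qU] tangent_eq[OF qU])
qed

text \<open>Tensoriality: every term containing a derivative of the component functions cancels, so
  the result depends only on the values of the three fields at \<open>q\<close>.\<close>

lemma curvature_field_rv:
  assumes W: "open W" "W \<subseteq> U" and S: "smooth_on (\<phi> ` W) Z" "smooth_on (\<phi> ` W) X" "smooth_on (\<phi> ` W) Y"
    and u: "\<And>q. q \<in> W \<Longrightarrow> u q = rv q (Z (\<phi> q))" and v: "\<And>q. q \<in> W \<Longrightarrow> v q = rv q (X (\<phi> q))"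
    and w: "\<And>q. q \<in> W \<Longrightarrow> w q = rv q (Y (\<phi> q))" and q: "q \<in> W"
  shows "curvature_field A IC u v w q = rv q (curv_op (\<phi> q) (X (\<phi> q)) (Y (\<phi> q)) (Z (\<phi> q)))"
proof -
  have qU: "q \<in> U" using q W by auto
  define z where "z = \<phi> q"
  note o = open_image[OF W]
  have z: "z \<in> \<phi> ` W" using q by (simp add: z_def)
  have WU: "\<phi> ` W \<subseteq> \<phi> ` U" using W by auto
  define nab where "nab X Y = (\<lambda>z. frechet_derivative Y (at z) (X z) + G z (X z) (Y z))" for X Y
  have smooth_nab: "smooth_on (\<phi> ` W) (nab X Y)" if "smooth_on (\<phi> ` W) X" "smooth_on (\<phi> ` W) Y" for X Y
    unfolding nab_def by (rule smooth_on_add[OF o smooth_on_directional[OF o that(2,1)] smooth_G[OF o WU that]])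
  have IC: "IC v u q = rv q (nab X Y (\<phi> q))"
    if "smooth_on (\<phi> ` W) X" "smooth_on (\<phi> ` W) Y" "\<And>q. q \<in> W \<Longrightarrow> v q = rv q (X (\<phi> q))"
      "\<And>q. q \<in> W \<Longrightarrow> u q = rv q (Y (\<phi> q))" "q \<in> W" for v u X Y q
    unfolding nab_def by (rule induced_connection_rv[OF W that])
  \<comment> \<open>After exchanging \<open>X\<close> and \<open>Y\<close> and subtracting, the
    second derivative of \<open>Z\<close> and the two terms pairing \<open>G\<close> with a first
    derivative of \<open>Z\<close> cancel by symmetry. The terms with a derivative of
    \<open>Y\<close> are matched by the bracket; the rest is \<open>curv_op\<close>.\<close>
  have second: "nab X (nab Y Z) z =
      frechet_derivative (\<lambda>y. frechet_derivative Z (at y) (Y z)) (at z) (X z)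
      + frechet_derivative Z (at z) (frechet_derivative Y (at z) (X z))
      + frechet_derivative (\<lambda>y. G y (Y z) (Z z)) (at z) (X z)
      + G z (frechet_derivative Y (at z) (X z)) (Z z) + G z (Y z) (frechet_derivative Z (at z) (X z))
      + G z (X z) (frechet_derivative Z (at z) (Y z)) + G z (X z) (G z (Y z) (Z z))"
    if "smooth_on (\<phi> ` W) X" "smooth_on (\<phi> ` W) Y" "smooth_on (\<phi> ` W) Z" for X Y Z
  proof -
    note Y' = smooth_on_has_derivative[OF that(2) z] and Z' = smooth_on_has_derivative[OF that(3) z]
    have 1: "((\<lambda>y. frechet_derivative Z (at y) (Y y)) has_derivative
       (\<lambda>v. frechet_derivative (\<lambda>y. frechet_derivative Z (at y) (Y z)) (at z) v
         + frechet_derivative Z (at z) (frechet_derivative Y (at z) v))) (at z)"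
      by (rule has_derivative_linear_apply[OF o z smooth_on_linear_derivative[OF that(3)]
              smooth_on_differentiable[OF smooth_on_derivative[OF that(3)] z] Y'])
    have 2: "((\<lambda>y. G y (Y y) b) has_derivative
       (\<lambda>v. frechet_derivative (\<lambda>y. G y (Y z) b) (at z) v + G z (frechet_derivative Y (at z) v) b)) (at z)" for b
      by (rule has_derivative_linear_apply[OF o z linear_G(1) smooth_on_differentiable[OF
              smooth_G[OF o WU smooth_on_const smooth_on_const] z] Y'])
    have "((\<lambda>y. G y (Y y) (Z y)) has_derivative
       (\<lambda>v. frechet_derivative (\<lambda>y. G y (Y y) (Z z)) (at z) v + G z (Y z) (frechet_derivative Z (at z) v))) (at z)"
      by (rule has_derivative_linear_apply[OF o z linear_G(2) smooth_on_differentiable[OF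
              smooth_G[OF o WU that(2) smooth_on_const] z] Z'])
    from has_derivative_add[OF 1 this] show ?thesis
      unfolding frechet_derivative_eqI[OF 2]
      by (simp add: nab_def frechet_derivative_eqI linear_add[OF linear_G(2)])
  qed
  have br: "bracket A v w q = rv q ((\<lambda>z. frechet_derivative Y (at z) (X z) - frechet_derivative X (at z) (Y z)) (\<phi> q))"
    if "q \<in> W" for q
    using bracket_rv[OF W S(2,3) v w that] by simp
  have sbr: "smooth_on (\<phi> ` W) (\<lambda>z. frechet_derivative Y (at z) (X z) - frechet_derivative X (at z) (Y z))"
    by (rule smooth_on_diff[OF o smooth_on_directional[OF o S(3,2)] smooth_on_directional[OF o S(2,3)]])
  have "IC v (IC w u) q = rv q (nab X (nab Y Z) z)"
    unfolding z_def by (rule IC[OF S(2) smooth_nab[OF S(3,1)] v IC[OF S(3,1) w u] q])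
  moreover have "IC w (IC v u) q = rv q (nab Y (nab X Z) z)"
    unfolding z_def by (rule IC[OF S(3) smooth_nab[OF S(2,1)] w IC[OF S(2,1) v u] q])
  moreover have "IC (bracket A v w) u q = rv q (nab (\<lambda>z. frechet_derivative Y (at z) (X z) - frechet_derivative X (at z) (Y z)) Z z)"
    unfolding z_def by (rule IC[OF sbr S(1) br u q])
  ultimately have "curvature_field A IC u v w q = rv q (nab X (nab Y Z) z - nab Y (nab X Z) z
      - nab (\<lambda>z. frechet_derivative Y (at z) (X z) - frechet_derivative X (at z) (Y z)) Z z)"
    by (simp add: curvature_field_def fun_eq_iff linear_diff[OF rv_linear[OF qU]])
  also have "nab X (nab Y Z) z - nab Y (nab X Z) z
      - nab (\<lambda>z. frechet_derivative Y (at z) (X z) - frechet_derivative X (at z) (Y z)) Z z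
    = curv_op z (X z) (Y z) (Z z)"
    unfolding second[OF S(2,3,1)] second[OF S(3,2,1)] unfolding nab_def curv_op_def
    using second_derivative_symmetric[OF o z S(1), of "X z" "Y z"]
    by (simp add: linear_diff[OF linear_G(1)] linear_diff[OF smooth_on_linear_derivative[OF S(1) z]] algebra_simps)
  finally show ?thesis by (simp add: z_def)
qed

lemma curvature_rv:
  assumes "q \<in> U"
  shows "curvature A IC q (rv q Z) (rv q X) (rv q Y) = rv q (curv_op (\<phi> q) X Y Z)"
  unfolding curvature_def
proof (rule the_equality)
  show "\<forall>W u v w. open W \<longrightarrow> q \<in> W \<longrightarrow> smooth_section A (tangent A) W u \<longrightarrow>
     smooth_section A (tangent A) W v \<longrightarrow> smooth_section A (tangent A) W w \<longrightarrow>
     u q = rv q Z \<longrightarrow> v q = rv q X \<longrightarrow> w q = rv q Y \<longrightarrow>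
     rv q (curv_op (\<phi> q) X Y Z) = curvature_field A IC u v w q"
  proof (intro allI impI)
    fix W u v w
    assume W: "open W" "q \<in> W" and s: "smooth_section A (tangent A) W u"
      "smooth_section A (tangent A) W v" "smooth_section A (tangent A) W w"
      and eq: "u q = rv q Z" "v q = rv q X" "w q = rv q Y"
    have N: "open (W \<inter> U)" "W \<inter> U \<subseteq> U" "q \<in> W \<inter> U" using W open_U assms by auto
    note r = smooth_section_restrict[OF _ Int_lower1]
    obtain Z' where Z': "smooth_on (\<phi> ` (W \<inter> U)) Z'" "\<And>q. q \<in> W \<inter> U \<Longrightarrow> u q = rv q (Z' (\<phi> q))"
      by (rule smooth_section_rvE[OF N(1,2) r[OF s(1)]]) blast
    obtain X' where X': "smooth_on (\<phi> ` (W \<inter> U)) X'" "\<And>q. q \<in> W \<inter> U \<Longrightarrow> v q = rv q (X' (\<phi> q))"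
      by (rule smooth_section_rvE[OF N(1,2) r[OF s(2)]]) blast
    obtain Y' where Y': "smooth_on (\<phi> ` (W \<inter> U)) Y'" "\<And>q. q \<in> W \<inter> U \<Longrightarrow> w q = rv q (Y' (\<phi> q))"
      by (rule smooth_section_rvE[OF N(1,2) r[OF s(3)]]) blast
    have "Z' (\<phi> q) = Z" "X' (\<phi> q) = X" "Y' (\<phi> q) = Y"
      using eq Z'(2)[OF N(3)] X'(2)[OF N(3)] Y'(2)[OF N(3)] rv_inject[OF assms] by simp_all
    then show "rv q (curv_op (\<phi> q) X Y Z) = curvature_field A IC u v w q"
      using curvature_field_rv[OF N(1,2) Z'(1) X'(1) Y'(1) Z'(2) X'(2) Y'(2) N(3)] by simp
  qed
next
  \<comment> \<open>Fields with constant components extend any tangent vector, so the condition in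
    the description of \<open>curvature\<close> is not vacuous and its value is unique.\<close>
  have c: "smooth_section A (tangent A) U (\<lambda>q. rv q X)" for X
    by (rule smooth_section_rvI[OF open_U order_refl, where X="\<lambda>z. X"]) simp_all
  fix r assume "\<forall>W u v w. open W \<longrightarrow> q \<in> W \<longrightarrow> smooth_section A (tangent A) W u \<longrightarrow>
     smooth_section A (tangent A) W v \<longrightarrow> smooth_section A (tangent A) W w \<longrightarrow>
     u q = rv q Z \<longrightarrow> v q = rv q X \<longrightarrow> w q = rv q Y \<longrightarrow> r = curvature_field A IC u v w q"
  from this[rule_format, OF open_U assms c c c refl refl refl]
  have "r = curvature_field A IC (\<lambda>q. rv q Z) (\<lambda>q. rv q X) (\<lambda>q. rv q Y) q" .
  also have "\<dots> = rv q (curv_op (\<phi> q) X Y Z)"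
    by (rule curvature_field_rv[OF open_U order_refl, where X="\<lambda>z. X" and Y="\<lambda>z. Y" and Z="\<lambda>z. Z"]) (use assms in simp_all)
  finally show "r = rv q (curv_op (\<phi> q) X Y Z)" .
qed

end

section \<open>Orthonormal frames\<close>

lemma orthonormal_sum:
  fixes b :: "'v::real_vector \<Rightarrow> 'v \<Rightarrow> real"
  assumes lin: "\<And>y. linear (\<lambda>x. b x y)" and fin: "finite I"
    and orth: "\<And>i j. i \<in> I \<Longrightarrow> j \<in> I \<Longrightarrow> b (E i) (E j) = (if i = j then 1 else 0)" and j: "j \<in> I"
  shows "b (\<Sum>i\<in>I. c i *\<^sub>R E i) (E j) = c j"
proof -
  have "b (\<Sum>i\<in>I. c i *\<^sub>R E i) (E j) = (\<Sum>i\<in>I. c i * b (E i) (E j))"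
    by (simp add: linear_sum[OF lin] linear_cmul[OF lin])
  also have "\<dots> = (\<Sum>i\<in>I. if i = j then c i else 0)"
    by (rule sum.cong) (auto simp: orth j)
  finally show ?thesis using fin j by simp
qed

text \<open>Gram-Schmidt for the form \<open>b\<close>: while fewer vectors than the dimension are
  chosen, some \<open>y\<close> lies outside their span; its component orthogonal to them is nonzero
  and can be normalized.\<close>

lemma orthonormal_exists:
  fixes b :: "'v::euclidean_space \<Rightarrow> 'v \<Rightarrow> real"
  assumes lin: "\<And>y. linear (\<lambda>x. b x y)" and sym: "\<And>x y. b x y = b y x" and pos: "\<And>x. x \<noteq> 0 \<Longrightarrow> b x x > 0"
    and "finite I" "card I \<le> DIM('v)"
  shows "\<exists>E. \<forall>i\<in>I. \<forall>j\<in>I. b (E i) (E j) = (if i = j then 1 else 0)"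
  using assms(4,5)
proof (induction I rule: finite_induct)
  case (insert k I)
  then obtain E where E: "\<And>i j. i \<in> I \<Longrightarrow> j \<in> I \<Longrightarrow> b (E i) (E j) = (if i = j then 1 else 0)"
    by auto
  have "dim (span (E ` I)) < DIM('v)"
    using dim_le_card[of "E ` I" "E ` I"] insert card_image_le[of I E] by (simp add: span_superset)
  then obtain y where y: "y \<notin> span (E ` I)"
    by (metis UNIV_eq_I dim_UNIV nless_le)
  define x where "x = y - (\<Sum>i\<in>I. b y (E i) *\<^sub>R E i)"
  have "x \<noteq> 0"
  proof
    assume "x = 0"
    then have "y = (\<Sum>i\<in>I. b y (E i) *\<^sub>R E i)" by (simp add: x_def)
    moreover have "(\<Sum>i\<in>I. b y (E i) *\<^sub>R E i) \<in> span (E ` I)"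
      by (intro span_sum span_scale span_base imageI)
    ultimately show False using y by simp
  qed
  then have p: "b x x > 0" by (rule pos)
  have orth: "b x (E j) = 0" if "j \<in> I" for j
    using orthonormal_sum[OF lin insert(1) E that, of "\<lambda>i. b y (E i)"] by (simp add: x_def linear_diff[OF lin])
  define e where "e = (1 / sqrt (b x x)) *\<^sub>R x"
  have ex: "b e v = b x v / sqrt (b x x)" for v
    by (simp add: e_def linear_cmul[OF lin])
  have "b e e = (b x x / sqrt (b x x)) / sqrt (b x x)"
    by (simp only: ex[of e] sym[of x e] ex[of x])
  also have "\<dots> = 1"
    using p by (simp add: real_div_sqrt)
  finally have ee: "b e e = 1" .
  have orth': "b (E j) x = 0" if "j \<in> I" for j
    using orth[OF that] sym by metis
  then have "\<forall>i\<in>insert k I. \<forall>j\<in>insert k I. b ((E(k := e)) i) ((E(k := e)) j) = (if i = j then 1 else 0)"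
    using insert(2) orth orth' ee by (auto simp: E ex sym[of "E _" e])
  then show ?case by blast
qed simp

text \<open>Orthonormal vectors are linearly independent, and their number equals the dimension, so
  they span. On the span the formula follows by linearity from its case
  \<open>x = E i\<close>.\<close>

lemma orthonormal_expansion:
  fixes b :: "'v::euclidean_space \<Rightarrow> 'v \<Rightarrow> real" and E :: "'i::finite \<Rightarrow> 'v"
  assumes lin: "\<And>y. linear (\<lambda>x. b x y)" and card: "CARD('i) = DIM('v)"
    and orth: "\<And>i j. b (E i) (E j) = (if i = j then 1 else 0)"
  shows "x = (\<Sum>i\<in>UNIV. b x (E i) *\<^sub>R E i)"
proof -
  note os = orthonormal_sum[OF lin finite_class.finite_UNIV orth UNIV_I]
  have inj: "inj E"
  proof (rule injI)
    fix i j assume "E i = E j"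
    then show "i = j" using orth[of i j] orth[of j j] by (auto split: if_splits)
  qed
  have "independent (range E)"
    unfolding dependent_finite[OF finite_imageI[OF finite_class.finite_UNIV]]
  proof clarify
    fix u i assume "(\<Sum>v\<in>range E. u v *\<^sub>R v) = 0" "u (E i) \<noteq> 0"
    then have "(\<Sum>i\<in>UNIV. u (E i) *\<^sub>R E i) = 0"
      by (simp add: sum.reindex[OF inj])
    then have "u (E i) = b 0 (E i)" using os[of "\<lambda>i. u (E i)" i] by simp
    then show False using \<open>u (E i) \<noteq> 0\<close> linear_0[OF lin] by simp
  qed
  then have "UNIV \<subseteq> span (range E)"
    by (intro card_ge_dim_independent) (simp_all add: card_image[OF inj] card)
  then have "x \<in> span (range E)" by auto
  then show ?thesis
  proof (induction rule: span_induct_alt)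
    case base
    then show ?case by (simp add: linear_0[OF lin])
  next
    case (step c v y)
    then obtain i where i: "v = E i" by auto
    have "v = (\<Sum>j\<in>UNIV. b v (E j) *\<^sub>R E j)"
      unfolding i orth by (simp add: if_distrib[of "\<lambda>t. t *\<^sub>R _"] cong: if_cong)
    moreover have "(\<Sum>j\<in>UNIV. b (c *\<^sub>R v + y) (E j) *\<^sub>R E j) = c *\<^sub>R (\<Sum>j\<in>UNIV. b v (E j) *\<^sub>R E j) + (\<Sum>j\<in>UNIV. b y (E j) *\<^sub>R E j)"
      by (simp add: linear_add[OF lin] linear_cmul[OF lin] scaleR_add_left sum.distrib scaleR_sum_right)
    ultimately show ?case using step by simp
  qed
qed

lemma card_plus_eq_DIM: "CARD('n + 'n::finite) = DIM(complex^'n)"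
  by (simp flip: UNIV_Plus_UNIV add: card_Plus)

section \<open>Ricci curvature\<close>

context chern_chart
begin

definition "bil q X Y = Re (h q (hv q X) (hv q Y))"

lemma riemannian_rv: "q \<in> U \<Longrightarrow> riemannian A h q (rv q X) (rv q Y) = bil q X Y"
  by (simp add: riemannian_def part10_rv bil_def)

lemma bil_linear: "q \<in> U \<Longrightarrow> linear (\<lambda>X. bil q X Y)"
proof (rule linearI)
  assume q: "q \<in> U"
  show "bil q (X + X') Y = bil q X Y + bil q X' Y" for X X'
    using h_linear[OF q, of 1 X X' Y] by (simp add: bil_def)
  have "r *\<^sub>R X = complex_of_real r *s X" for r and X :: "complex^'n"
    unfolding vec_eq_iff by (simp add: scaleR_conv_of_real[of _ "x :: complex" for x])
  then show "bil q (r *\<^sub>R X) Y = r *\<^sub>R bil q X Y" for r X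
    using h_linear[OF q, of "complex_of_real r" X 0 Y] h_zero[OF q, of Y] by (simp add: bil_def)
qed

lemma bil_sym: "q \<in> U \<Longrightarrow> bil q X Y = bil q Y X"
  using h_cnj[of q X Y] by (simp add: bil_def)

lemma orthonormal_frame_iff:
  assumes "q \<in> U"
  shows "orthonormal_frame A h q e \<longleftrightarrow> (\<exists>E. e = (\<lambda>i. rv q (E i)) \<and> (\<forall>i j. bil q (E i) (E j) = (if i = j then 1 else 0)))"
proof
  assume e: "orthonormal_frame A h q e"
  then have "\<forall>i. \<exists>X. e i = rv q X"
    unfolding orthonormal_frame_def tangent_eq[OF assms] by blast
  then obtain E where E: "\<And>i. e i = rv q (E i)" by metis
  then show "\<exists>E. e = (\<lambda>i. rv q (E i)) \<and> (\<forall>i j. bil q (E i) (E j) = (if i = j then 1 else 0))"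
    using e unfolding orthonormal_frame_def
    by (intro exI[where x=E]) (auto simp: riemannian_rv[OF assms])
qed (auto simp: orthonormal_frame_def tangent_eq[OF assms] riemannian_rv[OF assms])

text \<open>The real expansions of X and i X together determine the sums of E against Z and against
  its conjugate, where Z pairs a vector with the frame by h. For coordinate vectors, Z is the metric
  matrix applied to the conjugate of E, and inverting this matrix gives both claims.\<close>

lemma frame_sums:
  fixes E :: "'n + 'n \<Rightarrow> complex^'n"
  assumes q: "q \<in> U" and orth: "\<And>i j. bil q (E i) (E j) = (if i = j then 1 else 0)"
  shows "(\<Sum>i\<in>UNIV. cnj (E i $ \<beta>) * E i $ \<gamma>) = 2 * h_inv A U \<phi> h q $ \<beta> $ \<gamma>"
    and "(\<Sum>i\<in>UNIV. E i $ \<beta> * E i $ \<gamma>) = 0"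
proof -
  define Z where "Z X i = h q (hv q X) (hv q (E i))" for X i
  have exp: "X $ \<gamma> = (\<Sum>i\<in>UNIV. complex_of_real (Re (Z X i)) * E i $ \<gamma>)" for X \<gamma>
  proof -
    have "X = (\<Sum>i\<in>UNIV. Re (Z X i) *\<^sub>R E i)"
      using orthonormal_expansion[OF bil_linear[OF q] card_plus_eq_DIM orth] by (simp add: bil_def Z_def)
    then have "X $ \<gamma> = (\<Sum>i\<in>UNIV. Re (Z X i) *\<^sub>R E i) $ \<gamma>" by (rule arg_cong)
    then show ?thesis by (simp add: scaleR_conv_of_real[of _ "x :: complex" for x])
  qed
  have Zi: "Z (\<i> *s X) i = \<i> * Z X i" for X i
    using h_linear[OF q, of \<i> X 0 "E i"] h_zero[OF q, of "E i"] by (simp add: Z_def)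
  have e1: "(\<Sum>i\<in>UNIV. Z X i * E i $ \<gamma>) = 2 * X $ \<gamma>" and e2: "(\<Sum>i\<in>UNIV. cnj (Z X i) * E i $ \<gamma>) = 0" for X \<gamma>
  proof -
    define a where "a = (\<Sum>i\<in>UNIV. complex_of_real (Re (Z X i)) * E i $ \<gamma>)"
    define c where "c = (\<Sum>i\<in>UNIV. complex_of_real (Im (Z X i)) * E i $ \<gamma>)"
    have a: "X $ \<gamma> = a" using exp[of X \<gamma>] by (simp add: a_def)
    \<comment> \<open>The coefficient of i X is the real part of \<open>\<i> * Z X i\<close>, that
      is minus the imaginary part of \<open>Z X i\<close>. Hence \<open>a + \<i> * c\<close> is
      twice the component of X and \<open>a - \<i> * c\<close> is zero.\<close>
    have c: "\<i> * X $ \<gamma> = - c" using exp[of "\<i> *s X" \<gamma>] by (simp add: c_def Zi sum_negf)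
    have "Z X i = complex_of_real (Re (Z X i)) + \<i> * complex_of_real (Im (Z X i))" for i
      by (simp add: complex_eq_iff)
    then have "(\<Sum>i\<in>UNIV. Z X i * E i $ \<gamma>) = (\<Sum>i\<in>UNIV. complex_of_real (Re (Z X i)) * E i $ \<gamma> + \<i> * (complex_of_real (Im (Z X i)) * E i $ \<gamma>))"
      by (metis (no_types, lifting) distrib_right mult.assoc)
    also have "\<dots> = a + \<i> * c"
      by (simp add: a_def c_def sum.distrib sum_distrib_left)
    finally show "(\<Sum>i\<in>UNIV. Z X i * E i $ \<gamma>) = 2 * X $ \<gamma>"
      using a c by (simp add: complex_eq_iff)
    have "cnj (Z X i) = complex_of_real (Re (Z X i)) - \<i> * complex_of_real (Im (Z X i))" for i
      by (simp add: complex_eq_iff)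
    then have "(\<Sum>i\<in>UNIV. cnj (Z X i) * E i $ \<gamma>) = (\<Sum>i\<in>UNIV. complex_of_real (Re (Z X i)) * E i $ \<gamma> - \<i> * (complex_of_real (Im (Z X i)) * E i $ \<gamma>))"
      by (simp add: left_diff_distrib mult.assoc)
    also have "\<dots> = a - \<i> * c"
      by (simp add: a_def c_def sum_subtractf sum_distrib_left)
    finally show "(\<Sum>i\<in>UNIV. cnj (Z X i) * E i $ \<gamma>) = 0"
      using a c by (simp add: complex_eq_iff)
  qed
  have Za: "Z (axis \<alpha> 1) i = (\<Sum>\<beta>\<in>UNIV. cnj (E i $ \<beta>) * Hm \<alpha> \<beta> (\<phi> q))" for \<alpha> i
    unfolding Z_def h_hv[OF q]
    by (subst sum.remove[of _ \<alpha>]) (auto simp: axis_def intro!: sum.neutral)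
  have left_cancel: "x \<beta> = (\<Sum>\<alpha>\<in>UNIV. h_inv A U \<phi> h q $ \<beta> $ \<alpha> * y \<alpha>)"
    if "\<And>\<alpha>. (\<Sum>\<mu>\<in>UNIV. Hm \<alpha> \<mu> (\<phi> q) * x \<mu>) = y \<alpha>" for x y \<beta>
  proof -
    have "(\<Sum>\<alpha>\<in>UNIV. h_inv A U \<phi> h q $ \<beta> $ \<alpha> * y \<alpha>)
        = (\<Sum>\<alpha>\<in>UNIV. \<Sum>\<mu>\<in>UNIV. h_inv A U \<phi> h q $ \<beta> $ \<alpha> * Hm \<alpha> \<mu> (\<phi> q) * x \<mu>)"
      unfolding that[symmetric] by (simp add: sum_distrib_left mult.assoc)
    also have "\<dots> = (\<Sum>\<mu>\<in>UNIV. (\<Sum>\<alpha>\<in>UNIV. h_inv A U \<phi> h q $ \<beta> $ \<alpha> * Hm \<alpha> \<mu> (\<phi> q)) * x \<mu>)"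
      by (subst sum.swap) (simp add: sum_distrib_right)
    also have "\<dots> = x \<beta>"
      unfolding h_inv_sum[OF q] by (simp add: if_distrib[of "\<lambda>t. t * _"] cong: if_cong)
    finally show ?thesis by simp
  qed
  have "(\<Sum>\<mu>\<in>UNIV. Hm \<alpha> \<mu> (\<phi> q) * (\<Sum>i\<in>UNIV. cnj (E i $ \<mu>) * E i $ \<gamma>)) = 2 * axis \<alpha> 1 $ \<gamma>" for \<alpha>
  proof -
    have "(\<Sum>\<mu>\<in>UNIV. Hm \<alpha> \<mu> (\<phi> q) * (\<Sum>i\<in>UNIV. cnj (E i $ \<mu>) * E i $ \<gamma>)) = (\<Sum>i\<in>UNIV. Z (axis \<alpha> 1) i * E i $ \<gamma>)"
      unfolding Za sum_distrib_left sum_distrib_right by (subst sum.swap) (simp add: mult_ac)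
    then show ?thesis by (simp add: e1)
  qed
  from left_cancel[OF this] have "(\<Sum>i\<in>UNIV. cnj (E i $ \<beta>) * E i $ \<gamma>) = (\<Sum>\<alpha>\<in>UNIV. h_inv A U \<phi> h q $ \<beta> $ \<alpha> * (2 * axis \<alpha> 1 $ \<gamma>))" .
  also have "\<dots> = 2 * h_inv A U \<phi> h q $ \<beta> $ \<gamma>"
    by (subst sum.remove[of _ \<gamma>]) (auto simp: axis_def intro!: sum.neutral)
  finally show "(\<Sum>i\<in>UNIV. cnj (E i $ \<beta>) * E i $ \<gamma>) = 2 * h_inv A U \<phi> h q $ \<beta> $ \<gamma>" .
  have "(\<Sum>\<mu>\<in>UNIV. Hm \<alpha> \<mu> (\<phi> q) * cnj (\<Sum>i\<in>UNIV. E i $ \<mu> * E i $ \<gamma>)) = 0" for \<alpha>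
  proof -
    have "(\<Sum>\<mu>\<in>UNIV. Hm \<alpha> \<mu> (\<phi> q) * cnj (\<Sum>i\<in>UNIV. E i $ \<mu> * E i $ \<gamma>)) = cnj (\<Sum>i\<in>UNIV. cnj (Z (axis \<alpha> 1) i) * E i $ \<gamma>)"
      unfolding Za cnj_sum sum_distrib_left sum_distrib_right by (subst sum.swap) (simp add: mult_ac)
    then show ?thesis by (simp add: e2)
  qed
  from left_cancel[OF this] have "cnj (\<Sum>i\<in>UNIV. E i $ \<beta> * E i $ \<gamma>) = 0"
    by simp
  then show "(\<Sum>i\<in>UNIV. E i $ \<beta> * E i $ \<gamma>) = 0"
    by (simp only: complex_cnj_zero_iff)
qed

lemma frame_trace:
  fixes E :: "'n + 'n \<Rightarrow> complex^'n"
  assumes q: "q \<in> U" and orth: "\<And>i j. bil q (E i) (E j) = (if i = j then 1 else 0)"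
  shows "(\<Sum>i\<in>UNIV. h q (hv q (curv_op (\<phi> q) (E i) Y a)) (hv q (E i)))
    = 2 * (\<Sum>\<alpha>\<in>UNIV. \<Sum>\<delta>\<in>UNIV. fourth_ricci A U \<phi> h q \<alpha> \<delta> * a $ \<alpha> * cnj (Y $ \<delta>))"
proof -
  let ?R = "chern_curv A U \<phi> h q"
  have "(\<Sum>i\<in>UNIV. h q (hv q (curv_op (\<phi> q) (E i) Y a)) (hv q (E i)))
    = (\<Sum>\<beta>\<in>UNIV. \<Sum>i\<in>UNIV. \<Sum>\<alpha>\<in>UNIV. \<Sum>\<gamma>\<in>UNIV. \<Sum>\<delta>\<in>UNIV.
     (E i $ \<gamma> * cnj (Y $ \<delta>) - Y $ \<gamma> * cnj (E i $ \<delta>)) * ?R \<alpha> \<beta> \<gamma> \<delta> * a $ \<alpha> * cnj (E i $ \<beta>))"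
    unfolding h_curv_op[OF q] by (rule sum.swap)
  \<comment> \<open>With the frame index innermost, each coefficient contains one of the two sums of
    \<open>frame_sums\<close>, the second one conjugated.\<close>
  also have "\<dots> = (\<Sum>\<beta>\<in>UNIV. \<Sum>\<alpha>\<in>UNIV. \<Sum>\<gamma>\<in>UNIV. \<Sum>\<delta>\<in>UNIV. \<Sum>i\<in>UNIV.
     (E i $ \<gamma> * cnj (Y $ \<delta>) - Y $ \<gamma> * cnj (E i $ \<delta>)) * ?R \<alpha> \<beta> \<gamma> \<delta> * a $ \<alpha> * cnj (E i $ \<beta>))"
    by (intro sum.cong refl sum_rotate4)
  also have "\<dots> = (\<Sum>\<beta>\<in>UNIV. \<Sum>\<alpha>\<in>UNIV. \<Sum>\<gamma>\<in>UNIV. \<Sum>\<delta>\<in>UNIV.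
     2 * (h_inv A U \<phi> h q $ \<beta> $ \<gamma> * ?R \<alpha> \<beta> \<gamma> \<delta> * a $ \<alpha> * cnj (Y $ \<delta>)))"
  proof (intro sum.cong refl)
    fix \<alpha> \<beta> \<gamma> \<delta>
    have "(\<Sum>i\<in>UNIV. (E i $ \<gamma> * cnj (Y $ \<delta>) - Y $ \<gamma> * cnj (E i $ \<delta>)) * ?R \<alpha> \<beta> \<gamma> \<delta> * a $ \<alpha> * cnj (E i $ \<beta>))
       = (\<Sum>i\<in>UNIV. cnj (E i $ \<beta>) * E i $ \<gamma>) * (?R \<alpha> \<beta> \<gamma> \<delta> * a $ \<alpha> * cnj (Y $ \<delta>))
       - cnj (\<Sum>i\<in>UNIV. E i $ \<beta> * E i $ \<delta>) * (Y $ \<gamma> * ?R \<alpha> \<beta> \<gamma> \<delta> * a $ \<alpha>)"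
      unfolding cnj_sum sum_distrib_right sum_subtractf[symmetric]
      by (rule sum.cong) (simp_all add: algebra_simps)
    then show "(\<Sum>i\<in>UNIV. (E i $ \<gamma> * cnj (Y $ \<delta>) - Y $ \<gamma> * cnj (E i $ \<delta>)) * ?R \<alpha> \<beta> \<gamma> \<delta> * a $ \<alpha> * cnj (E i $ \<beta>))
      = 2 * (h_inv A U \<phi> h q $ \<beta> $ \<gamma> * ?R \<alpha> \<beta> \<gamma> \<delta> * a $ \<alpha> * cnj (Y $ \<delta>))"
      unfolding frame_sums[OF q orth] by simp
  qed
  also have "\<dots> = (\<Sum>\<alpha>\<in>UNIV. \<Sum>\<gamma>\<in>UNIV. \<Sum>\<delta>\<in>UNIV. \<Sum>\<beta>\<in>UNIV.
     2 * (h_inv A U \<phi> h q $ \<beta> $ \<gamma> * ?R \<alpha> \<beta> \<gamma> \<delta> * a $ \<alpha> * cnj (Y $ \<delta>)))"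
    by (rule sum_rotate4)
  also have "\<dots> = (\<Sum>\<alpha>\<in>UNIV. \<Sum>\<delta>\<in>UNIV. \<Sum>\<gamma>\<in>UNIV. \<Sum>\<beta>\<in>UNIV.
     2 * (h_inv A U \<phi> h q $ \<beta> $ \<gamma> * ?R \<alpha> \<beta> \<gamma> \<delta> * a $ \<alpha> * cnj (Y $ \<delta>)))"
    by (intro sum.cong refl sum.swap)
  finally show ?thesis
    by (simp add: fourth_ricci_def sum_distrib_left sum_distrib_right mult.assoc)
qed

section \<open>Hermitian symmetry of the inverse metric and of the curvature\<close>

lemma cnj_h_inv:
  assumes q: "q \<in> U"
  shows "cnj (h_inv A U \<phi> h q $ \<beta> $ \<alpha>) = h_inv A U \<phi> h q $ \<alpha> $ \<beta>"
proof -
  have z: "\<phi> q \<in> \<phi> ` U" using q by auto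
  have "(\<Sum>\<mu>\<in>UNIV. cnj (h_inv A U \<phi> h q $ \<mu> $ \<alpha>) * Hm \<mu> \<beta> (\<phi> q)) = (if \<beta> = \<alpha> then 1 else 0)" for \<beta>
  proof -
    have "(\<Sum>\<mu>\<in>UNIV. cnj (h_inv A U \<phi> h q $ \<mu> $ \<alpha>) * Hm \<mu> \<beta> (\<phi> q))
      = cnj (\<Sum>\<mu>\<in>UNIV. Hm \<beta> \<mu> (\<phi> q) * h_inv A U \<phi> h q $ \<mu> $ \<alpha>)"
      by (simp add: Hm_hermitian[OF z, of \<beta>] mult.commute)
    then show ?thesis unfolding h_inv_sum[OF q] by simp
  qed
  from Hm_right_cancel[OF q this, of \<beta>] show ?thesis
    by (simp add: if_distrib[of "\<lambda>t. t * _"] cong: if_cong)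
qed

text \<open>Conjugation exchanges the two kinds of Wirtinger derivatives and transposes the metric.
  In the second-order term the derivatives come out in the opposite order and are commuted back; in
  the quadratic term the outer factors change places.\<close>

lemma cnj_chern_curv:
  assumes q: "q \<in> U"
  shows "cnj (chern_curv A U \<phi> h q \<alpha> \<beta> \<gamma> \<delta>) = chern_curv A U \<phi> h q \<beta> \<alpha> \<delta> \<gamma>"
proof -
  have z: "\<phi> q \<in> \<phi> ` U" using q by auto
  have d: "Hm \<alpha> \<beta> differentiable (at z)" if "z \<in> \<phi> ` U" for \<alpha> \<beta> z
    by (rule smooth_on_differentiable[OF smooth_Hm that])
  have 1: "cnj (wirt \<gamma> (Hm \<alpha> \<beta>) z) = wirtbar \<gamma> (Hm \<beta> \<alpha>) z" "cnj (wirtbar \<gamma> (Hm \<alpha> \<beta>) z) = wirt \<gamma> (Hm \<beta> \<alpha>) z"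
    if "z \<in> \<phi> ` U" for \<alpha> \<beta> \<gamma> z
    unfolding wirt_cnj[OF d[OF that], symmetric]
    by (rule wirt_cong[OF open_range that], rule Hm_hermitian[symmetric], assumption)+
  have "cnj (wirt \<gamma> (wirtbar \<delta> (Hm \<alpha> \<beta>)) (\<phi> q)) = wirtbar \<gamma> (\<lambda>z. cnj (wirtbar \<delta> (Hm \<alpha> \<beta>) z)) (\<phi> q)"
    by (rule wirt_cnj(2)[OF smooth_on_differentiable[OF smooth_on_wirt(2)[OF open_range smooth_Hm] z], symmetric])
  also have "\<dots> = wirtbar \<gamma> (wirt \<delta> (Hm \<beta> \<alpha>)) (\<phi> q)"
    by (rule wirt_cong(2)[OF open_range z 1(2)])
  also have "\<dots> = wirt \<delta> (wirtbar \<gamma> (Hm \<beta> \<alpha>)) (\<phi> q)"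
    by (rule wirt_commute(1)[OF open_range z smooth_Hm, symmetric])
  finally have 2: "cnj (wirt \<gamma> (wirtbar \<delta> (Hm \<alpha> \<beta>)) (\<phi> q)) = wirt \<delta> (wirtbar \<gamma> (Hm \<beta> \<alpha>)) (\<phi> q)" .
  have "cnj (\<Sum>\<mu>\<in>UNIV. \<Sum>\<kappa>\<in>UNIV. wirt \<gamma> (Hm \<alpha> \<mu>) (\<phi> q) * h_inv A U \<phi> h q $ \<mu> $ \<kappa> * wirtbar \<delta> (Hm \<kappa> \<beta>) (\<phi> q))
     = (\<Sum>\<mu>\<in>UNIV. \<Sum>\<kappa>\<in>UNIV. wirtbar \<gamma> (Hm \<mu> \<alpha>) (\<phi> q) * h_inv A U \<phi> h q $ \<kappa> $ \<mu> * wirt \<delta> (Hm \<beta> \<kappa>) (\<phi> q))"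
    unfolding cnj_sum complex_cnj_mult 1[OF z] cnj_h_inv[OF q] ..
  also have "\<dots> = (\<Sum>\<kappa>\<in>UNIV. \<Sum>\<mu>\<in>UNIV. wirt \<delta> (Hm \<beta> \<kappa>) (\<phi> q) * h_inv A U \<phi> h q $ \<kappa> $ \<mu> * wirtbar \<gamma> (Hm \<mu> \<alpha>) (\<phi> q))"
    by (subst sum.swap) (simp add: mult_ac)
  finally show ?thesis
    unfolding chern_curv_eq[OF q] complex_cnj_add complex_cnj_minus 2 by simp
qed

text \<open>Conjugation swaps the indices inside each of the two pairs of the curvature. Renaming
  the contracted indices then gives the third contraction with the free indices exchanged.\<close>

lemma cnj_fourth_ricci:
  assumes q: "q \<in> U"
  shows "cnj (fourth_ricci A U \<phi> h q \<alpha> \<delta>) = third_ricci A U \<phi> h q \<delta> \<alpha>"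
  unfolding fourth_ricci_def third_ricci_def
proof -
  have "cnj (\<Sum>\<gamma>\<in>UNIV. \<Sum>\<beta>\<in>UNIV. h_inv A U \<phi> h q $ \<beta> $ \<gamma> * chern_curv A U \<phi> h q \<alpha> \<beta> \<gamma> \<delta>)
    = (\<Sum>\<gamma>\<in>UNIV. \<Sum>\<beta>\<in>UNIV. h_inv A U \<phi> h q $ \<gamma> $ \<beta> * chern_curv A U \<phi> h q \<beta> \<alpha> \<delta> \<gamma>)"
    unfolding cnj_sum complex_cnj_mult cnj_h_inv[OF q] cnj_chern_curv[OF q] ..
  also have "\<dots> = (\<Sum>\<beta>\<in>UNIV. \<Sum>\<gamma>\<in>UNIV. h_inv A U \<phi> h q $ \<gamma> $ \<beta> * chern_curv A U \<phi> h q \<beta> \<alpha> \<delta> \<gamma>)"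
    by (rule sum.swap)
  finally show "cnj (\<Sum>\<gamma>\<in>UNIV. \<Sum>\<beta>\<in>UNIV. h_inv A U \<phi> h q $ \<beta> $ \<gamma> * chern_curv A U \<phi> h q \<alpha> \<beta> \<gamma> \<delta>)
    = (\<Sum>\<beta>\<in>UNIV. \<Sum>\<gamma>\<in>UNIV. h_inv A U \<phi> h q $ \<gamma> $ \<beta> * chern_curv A U \<phi> h q \<beta> \<alpha> \<delta> \<gamma>)" .
qed

lemma ricci_rv:
  assumes q: "q \<in> U"
  shows "ricci A h IC q (rv q a) (rv q Y)
    = 2 * Re (\<Sum>\<alpha>\<in>UNIV. \<Sum>\<delta>\<in>UNIV. fourth_ricci A U \<phi> h q \<alpha> \<delta> * a $ \<alpha> * cnj (Y $ \<delta>))"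
  (is "_ = ?r")
proof -
  have val: "(\<Sum>i\<in>UNIV. riemannian A h q (curvature A IC q (rv q a) (e i) (rv q Y)) (e i)) = ?r"
    if e: "orthonormal_frame A h q e" for e
  proof -
    obtain E where E: "e = (\<lambda>i. rv q (E i))" "\<And>i j. bil q (E i) (E j) = (if i = j then 1 else 0)"
      using e orthonormal_frame_iff[OF q] by auto
    have "(\<Sum>i\<in>UNIV. riemannian A h q (curvature A IC q (rv q a) (e i) (rv q Y)) (e i))
       = Re (\<Sum>i\<in>UNIV. h q (hv q (curv_op (\<phi> q) (E i) Y a)) (hv q (E i)))"
      by (simp add: E(1) curvature_rv[OF q] riemannian_rv[OF q] bil_def)
    then show ?thesis
      unfolding frame_trace[OF q E(2)] by simp
  qed
  \<comment> \<open>Without an orthonormal frame every real number would satisfy the description of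
    \<open>ricci\<close>; existence gives uniqueness.\<close>
  have "\<exists>E :: 'n + 'n \<Rightarrow> complex^'n. \<forall>i\<in>UNIV. \<forall>j\<in>UNIV. bil q (E i) (E j) = (if i = j then 1 else 0)"
    using h_pos[OF q] by (intro orthonormal_exists bil_linear[OF q] bil_sym[OF q]) (auto simp: bil_def card_plus_eq_DIM)
  then obtain e where e: "orthonormal_frame A h q e"
    using orthonormal_frame_iff[OF q] by auto
  show ?thesis
    unfolding ricci_def
  proof (rule the_equality)
    show "\<forall>e. orthonormal_frame A h q e \<longrightarrow>
      ?r = (\<Sum>i\<in>UNIV. riemannian A h q (curvature A IC q (rv q a) (e i) (rv q Y)) (e i))"
      using val by simp
    show "r = ?r" if "\<forall>e. orthonormal_frame A h q e \<longrightarrow>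
      r = (\<Sum>i\<in>UNIV. riemannian A h q (curvature A IC q (rv q a) (e i) (rv q Y)) (e i))" for r
      using that e val[OF e] by simp
  qed
qed

end

theorem proposition2p6:
  fixes A :: "('a::{t2_space, second_countable_topology}, 'n::finite) atlas"
    and h :: "'a \<Rightarrow> 'a tvec \<Rightarrow> 'a tvec \<Rightarrow> complex"
    and D :: "('a \<Rightarrow> 'a tvec) \<Rightarrow> ('a \<Rightarrow> 'a tvec) \<Rightarrow> ('a \<Rightarrow> 'a tvec)"
    and p :: 'a and u w :: "'a tvec"
    and U :: "'a set" and \<phi> :: "'a \<Rightarrow> complex^'n"
    and \<xi> \<zeta> :: "'n \<Rightarrow> complex"
  assumes "complex_atlas A"
    and "hermitian_metric A h"
    and "chern_connection A h D"
    and "u \<in> tangent A p" and "w \<in> tangent A p"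
    and "(U, \<phi>) \<in> A" and "p \<in> U"
    and "part10 A p u = (\<lambda>f. \<Sum>\<alpha>\<in>UNIV. \<xi> \<alpha> * d_z A U \<phi> \<alpha> p f)"
    and "part10 A p w = (\<lambda>f. \<Sum>\<alpha>\<in>UNIV. \<zeta> \<alpha> * d_z A U \<phi> \<alpha> p f)"
  shows "complex_of_real (ricci A h (induced_connection A D) p u w) =
      (\<Sum>\<alpha>\<in>UNIV. \<Sum>\<delta>\<in>UNIV. fourth_ricci A U \<phi> h p \<alpha> \<delta> * \<xi> \<alpha> * cnj (\<zeta> \<delta>))
    + (\<Sum>\<alpha>\<in>UNIV. \<Sum>\<delta>\<in>UNIV. third_ricci A U \<phi> h p \<alpha> \<delta> * \<zeta> \<alpha> * cnj (\<xi> \<delta>))"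
proof -
  interpret chern_chart A U \<phi> h D
    by unfold_locales (use assms in auto)
  note p = \<open>p \<in> U\<close>
  \<comment> \<open>The coefficients of the (1,0)-part in the frame \<open>d_z\<close> are the chart
    components of the real vector itself.\<close>
  have rep: "v = rv p (\<chi> \<alpha>. c \<alpha>)"
    if "v \<in> tangent A p" "part10 A p v = (\<lambda>f. \<Sum>\<alpha>\<in>UNIV. c \<alpha> * d_z A U \<phi> \<alpha> p f)" for v c
  proof -
    have "v \<in> range (rv p)" using that(1) unfolding tangent_eq[OF p] .
    then obtain X where X: "v = rv p X" by (rule rangeE)
    have "hv p X = hv p (\<chi> \<alpha>. c \<alpha>)"
      using that(2) by (simp add: X part10_rv[OF p] hvec_def)
    then show ?thesis using X hv_inject[OF p] by simp
  qed
  define S where "S = (\<Sum>\<alpha>\<in>UNIV. \<Sum>\<delta>\<in>UNIV. fourth_ricci A U \<phi> h p \<alpha> \<delta> * \<xi> \<alpha> * cnj (\<zeta> \<delta>))"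
  have "ricci A h (induced_connection A D) p u w = 2 * Re S"
    unfolding rep[OF assms(4,8)] rep[OF assms(5,9)] ricci_rv[OF p] S_def by simp
  \<comment> \<open>Twice the real part is the sum with the conjugate; the conjugate of the fourth
    Ricci term is the third Ricci term with \<open>\<xi>\<close> and \<open>\<zeta>\<close>
    exchanged.\<close>
  then have "complex_of_real (ricci A h (induced_connection A D) p u w) = S + cnj S"
    by (simp add: complex_add_cnj)
  also have "cnj S = (\<Sum>\<alpha>\<in>UNIV. \<Sum>\<delta>\<in>UNIV. third_ricci A U \<phi> h p \<alpha> \<delta> * \<zeta> \<alpha> * cnj (\<xi> \<delta>))"
    unfolding S_def cnj_sum complex_cnj_mult cnj_fourth_ricci[OF p]
    by (subst sum.swap) (simp add: mult_ac)
  finally show ?thesis by (simp add: S_def)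
qed

end
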